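(* Let $f,g:\mathbb{R}^d\to\mathbb{R}^d$, let $x(t)$ solve $dx(t)=f(x(t))dt+g(x(t))dW(t)$, $x(0)=x_0\in\mathbb{R}^d$, with scalar Brownian motion $W$, and let $X_k$ be the backward Euler–Maruyama approximation $X_0=x_0$, $X_k=X_{k-1}+f(X_k)h+g(X_{k-1})\Delta W_{k-1}$, $\Delta W_{k-1}=W(kh)-W((k-1)h)$. Suppose: (A1) there exist $q\ge1$, $L_1>0$ with $|f(x_1)-f(x_2)|\le L_1(1+|x_1|^{q-1}+|x_2|^{q-1})|x_1-x_2|$ for all $x_1,x_2$; (A2) there exist $c_1,c_2,c_3>0$, $l_1\ge\max\{2q,3\}$, $l_2\ge3$ with $2\langle x,f(x)\rangle+l_1|g(x)|^2\le c_1|x|^2+c_2$ and $2\langle x_1-x_2,f(x_1)-f(x_2)\rangle+l_2|g(x_1)-g(x_2)|^2\le c_3|x_1-x_2|^2$ for all $x,x_1,x_2$; (A3) there exist $\alpha>0$, $D>0$, $C_3\ge0$ such that for all $x$, $\frac{(1-l_1)|g(x)|^2}{D+|x|^2+\alpha|g(x)|^2}-\frac{2|\langle x,g(x)\rangle|^2}{(D+|x|^2+\alpha|g(x)|^2)^2}\le k_1+\frac{P(x)}{(D+|x|^2+\alpha|g(x)|^2)^2}$, where $k_1+c_1<0$ and $P$ is a polynomial with $\sup_x|P(x)/(D+|x|^2+\alpha|g(x)|^2)^{2-p/2}|\le C_3$ for a sufficiently small constant $p$; (A4) there exists $\beta>0$ such that for all $x\ne y$, $\frac{(1-l_2)|g(x)-g(y)|^2}{|x-y|^2+\beta|g(x)-g(y)|^2}-\frac{2|\langle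 x-y,g(x)-g(y)\rangle|^2}{(|x-y|^2+\beta|g(x)-g(y)|^2)^2}\le k_2$, where $k_2+c_3<0$. Then the BEM solution converges uniformly to the exact solution: for sufficiently small $p\in(0,1)$ and sufficiently small step size $h>0$, $\sup_{j\in\mathbb{N}}\mathbb{E}|x(jh)-X_j|^p\le Ch^{p/2}$ for a positive constant $C$.
   Context: $|\cdot|$ and $\langle\cdot,\cdot\rangle$ are the Euclidean norm and inner product on $\mathbb{R}^d$. "Converges uniformly" means an error bound in $p$-th moment uniform over all grid times $jh$, $j\in\mathbb{N}$. *)

theory Defs
  imports "HOL-Probability.Probability"
begin

inductive_set poly_fun :: "('a::euclidean_space \<Rightarrow> real) set" where
  const: "(\<lambda>x. c) \<in> poly_fun"
| coord: "b \<in> Basis \<Longrightarrow> (\<lambda>x. x \<bullet> b) \<in> poly_fun"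
| add: "p \<in> poly_fun \<Longrightarrow> q \<in> poly_fun \<Longrightarrow> (\<lambda>x. p x + q x) \<in> poly_fun"
| mult: "p \<in> poly_fun \<Longrightarrow> q \<in> poly_fun \<Longrightarrow> (\<lambda>x. p x * q x) \<in> poly_fun"

definition filtration :: "'m measure \<Rightarrow> (real \<Rightarrow> 'm measure) \<Rightarrow> bool" where
  "filtration M F \<longleftrightarrow>
     (\<forall>t. space (F t) = space M \<and> sets (F t) \<subseteq> sets M) \<and>
     (\<forall>s t. s \<le> t \<longrightarrow> sets (F s) \<subseteq> sets (F t))"

definition brownian_motion :: "'m measure \<Rightarrow> (real \<Rightarrow> 'm measure) \<Rightarrow> (real \<Rightarrow> 'm \<Rightarrow> real) \<Rightarrow> bool" where
  "brownian_motion M F W \<longleftrightarrow>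
     prob_space M \<and> filtration M F \<and>
     (\<forall>\<omega>\<in>space M. W 0 \<omega> = 0) \<and>
     (\<forall>\<omega>\<in>space M. continuous_on {0..} (\<lambda>t. W t \<omega>)) \<and>
     (\<forall>t\<ge>0. W t \<in> borel_measurable (F t)) \<and>
     (\<forall>s t. 0 \<le> s \<and> s < t \<longrightarrow>
        distributed M lborel (\<lambda>\<omega>. W t \<omega> - W s \<omega>) (normal_density 0 (sqrt (t - s))) \<and>
        prob_space.indep_set M (sets (F s))
          (sigma_sets (space M) {(\<lambda>\<omega>. W t \<omega> - W s \<omega>) -` A \<inter> space M | A. A \<in> sets borel}))"

definition ito_sum :: "(real \<Rightarrow> 'm \<Rightarrow> real) \<Rightarrow> (real \<Rightarrow> 'm \<Rightarrow> 'a::real_vector) \<Rightarrow> real \<Rightarrow> nat \<Rightarrow> 'm \<Rightarrow> 'a" where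
  "ito_sum W H t n \<omega> =
     (\<Sum>i<n. (W (t * real (Suc i) / real n) \<omega> - W (t * real i / real n) \<omega>) *\<^sub>R H (t * real i / real n) \<omega>)"

text \<open>I is the Ito integral of H dW over [0,t]: limit in probability of left Riemann sums
  (this coincides with the Ito integral for continuous adapted integrands).\<close>
definition ito_integral_is :: "'m measure \<Rightarrow> (real \<Rightarrow> 'm \<Rightarrow> real) \<Rightarrow> (real \<Rightarrow> 'm \<Rightarrow> 'a::euclidean_space) \<Rightarrow> real \<Rightarrow> ('m \<Rightarrow> 'a) \<Rightarrow> bool" where
  "ito_integral_is M W H t I \<longleftrightarrow>
     I \<in> borel_measurable M \<and>
     (\<forall>\<epsilon>>0. (\<lambda>n. measure M {\<omega>\<in>space M. norm (ito_sum W H t n \<omega> - I \<omega>) > \<epsilon>}) \<longlonglongrightarrow> 0)"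

definition sde_solution :: "'m measure \<Rightarrow> (real \<Rightarrow> 'm measure) \<Rightarrow> (real \<Rightarrow> 'm \<Rightarrow> real) \<Rightarrow>
    ('a::euclidean_space \<Rightarrow> 'a) \<Rightarrow> ('a \<Rightarrow> 'a) \<Rightarrow> 'a \<Rightarrow> (real \<Rightarrow> 'm \<Rightarrow> 'a) \<Rightarrow> bool" where
  "sde_solution M F W f g x0 x \<longleftrightarrow>
     (\<forall>t\<ge>0. x t \<in> borel_measurable (F t)) \<and>
     (\<forall>\<omega>\<in>space M. continuous_on {0..} (\<lambda>t. x t \<omega>)) \<and>
     (\<forall>t\<ge>0. \<exists>I. ito_integral_is M W (\<lambda>s \<omega>. g (x s \<omega>)) t I \<and>
        (AE \<omega> in M. x t \<omega> = x0 + integral {0..t} (\<lambda>s. f (x s \<omega>)) + I \<omega>))"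

definition bem_scheme :: "'m measure \<Rightarrow> (real \<Rightarrow> 'm \<Rightarrow> real) \<Rightarrow> ('a::euclidean_space \<Rightarrow> 'a) \<Rightarrow> ('a \<Rightarrow> 'a) \<Rightarrow>
    'a \<Rightarrow> real \<Rightarrow> (nat \<Rightarrow> 'm \<Rightarrow> 'a) \<Rightarrow> bool" where
  "bem_scheme M W f g x0 h X \<longleftrightarrow>
     (\<forall>\<omega>\<in>space M. X 0 \<omega> = x0) \<and>
     (\<forall>k. \<forall>\<omega>\<in>space M. X (Suc k) \<omega> = X k \<omega> + h *\<^sub>R f (X (Suc k) \<omega>)
        + (W (real (Suc k) * h) \<omega> - W (real k * h) \<omega>) *\<^sub>R g (X k \<omega>))"

end

theory Submission
  imports Defs
begin

text \<open>
  No Ito calculus is used. Compare the scheme of step size \<open>h\<close> with the same scheme run on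
  the finer grid \<open>h / m\<close>, uniformly in \<open>m\<close>; for \<open>m \<rightarrow> \<infinity>\<close> the fine scheme converges in probability to
  the solution, so Fatou's argument transfers the bound.

  For a Gaussian step \<open>z\<close> of variance \<open>\<tau>\<close> put \<open>V = c + |u|\<^sup>2 + l \<tau> |v|\<^sup>2\<close> and expand \<open>(c + |u + z v|\<^sup>2)\<^sup>s\<close> to third
  order around \<open>V\<close>. For \<open>l \<ge> 3\<close> the other terms up to third order contribute nonpositively, and for small \<open>s\<close>
  what remains is controlled by (A3) and (A4). Implicitness turns \<open>c + |u + z v|\<^sup>2\<close> back into \<open>V\<close> at the next
  step. With \<open>u = X\<^sub>k\<close>, \<open>v = g (X\<^sub>k)\<close> this gives moments bounded uniformly in time, and with the differences of two
  numerical solutions it gives contraction in a small power.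

  On windows of length about one, the squared difference of fine and coarse solutions satisfies a
  one-step inequality whose source is polynomial in the current states. Superlinear growth rules out
  high moments, but only a small power of the error is needed: a Lenglart-type domination bounds it by a small power
  of the accumulated source. The window errors are then summed geometrically using contraction.
\<close>

section \<open>Gaussian averages of powers\<close>

text \<open>The obstacle is that (A3) and (A4) give decay for small powers only: with
  \<open>l * \<tau>\<close> in place of \<alpha> or \<beta>, their left sides are the limits for s
  \<rightarrow> 0 of the rate in the one-step bound for s-th powers. Centring the expansion at V
  rather than at c + |u|^2 turns the mean contribution |v|^2 of the noise into (1 - l) |v|^2, and l
  \<tau> |v|^2 is exactly the surplus that (A2) leaves when the implicit equation is squared.

  Conditional expectations never appear. An inequality between them is stated as one between
  nonnegative integrals against arbitrary weights measurable at the earlier time. This needs no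
  integrability, hence \<open>ennreal\<close> throughout.

  Two exponents are in play. Moments are uniform in time for an exponent r fixed by the margin k1 +
  c1 < 0. The error exponent is then taken so small, depending on r and on the growth degree d, that
  polynomial weights raised to it are controlled by those moments.\<close>

lemma powr_taylor3:
  fixes s x :: real
  assumes s: "0 < s" "s < 1" and x: "x \<ge> -1"
  shows "(1 + x) powr s \<le> 1 + s * x + s * (s - 1) / 2 * x\<^sup>2 + s * (s - 1) * (s - 2) / 6 * x ^ 3"
proof (cases "x = -1")
  case True
  have "1 - s + s * (s - 1) / 2 - s * (s - 1) * (s - 2) / 6 = (1 - s) * (1 - s / 2) * (1 - s / 3)"
    by (simp add: field_simps power2_eq_square)
  also have "\<dots> \<ge> 0" using s by simp
  finally show ?thesis using True by simp
next
  case False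
  with x have x: "x > -1" by simp
  show ?thesis
  proof (cases "x = 0")
    case True then show ?thesis by simp
  next
    case x0: False
    \<comment> \<open>Falling factorials: \<open>d m\<close> is the m-th derivative of
      \<open>(1 + t) powr s\<close>.\<close>
    define c where "c m = (\<Prod>i<m. s - real i)" for m :: nat
    define d where "d m t = c m * (1 + t) powr (s - real m)" for m :: nat and t :: real
    have "\<exists>t. (if x < 0 then x < t \<and> t < 0 else 0 < t \<and> t < x) \<and>
        d 0 x = (\<Sum>m<4. d m 0 / fact m * (x - 0) ^ m) + d 4 t / fact 4 * (x - 0) ^ 4"
    proof (rule Taylor[where a = "min x 0" and b = "max x 0"])
      show "\<forall>m t. m < 4 \<and> min x 0 \<le> t \<and> t \<le> max x 0 \<longrightarrow> DERIV (d m) t :> d (Suc m) t"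
      proof (intro allI impI)
        fix m :: nat and t :: real
        assume "m < 4 \<and> min x 0 \<le> t \<and> t \<le> max x 0"
        with x have t: "1 + t > 0" by (auto simp: min_def max_def split: if_splits)
        show "DERIV (d m) t :> d (Suc m) t"
        proof -
          have "((\<lambda>t. (1 + t) powr (s - real m)) has_real_derivative (s - real m) * (1 + t) powr (s - real m - 1)) (at t)"
            using t by (auto intro!: derivative_eq_intros)
          from DERIV_cmult[OF this, of "c m"] show ?thesis
            unfolding d_def c_def by (simp add: algebra_simps)
        qed
      qed
    qed (use x0 in auto)
    then obtain t where t: "(if x < 0 then x < t \<and> t < 0 else 0 < t \<and> t < x)"
      and eq: "d 0 x = (\<Sum>m<4. d m 0 / fact m * (x - 0) ^ m) + d 4 t / fact 4 * (x - 0) ^ 4" by blast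
    have "c 4 = - (s * (1 - s) * (2 - s) * (3 - s))"
      by (simp add: c_def eval_nat_numeral lessThan_Suc algebra_simps)
    also have "\<dots> \<le> 0" using s by (simp add: mult_nonneg_nonneg)
    finally have "c 4 \<le> 0" .
    hence "d 4 t \<le> 0" unfolding d_def by (simp add: mult_le_0_iff)
    hence "d 4 t / fact 4 * (x - 0) ^ 4 \<le> 0" by (simp add: mult_le_0_iff divide_le_0_iff)
    moreover have "(\<Sum>m<4. d m 0 / fact m * (x - 0) ^ m) =
        1 + s * x + s * (s - 1) / 2 * x\<^sup>2 + s * (s - 1) * (s - 2) / 6 * x ^ 3"
      by (simp add: d_def c_def eval_nat_numeral lessThan_Suc algebra_simps)
    moreover have "d 0 x = (1 + x) powr s" by (simp add: d_def c_def)
    ultimately show ?thesis using eq by linarith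
  qed
qed

abbreviation gaussian :: "real \<Rightarrow> real measure" where
  "gaussian \<tau> \<equiv> density lborel (\<lambda>z. ennreal (normal_density 0 (sqrt \<tau>) z))"

lemma gaussian_moments:
  assumes "\<tau> > 0"
  shows "has_bochner_integral lborel (\<lambda>z. normal_density 0 (sqrt \<tau>) z * 1) 1"
    "has_bochner_integral lborel (\<lambda>z. normal_density 0 (sqrt \<tau>) z * z) 0"
    "has_bochner_integral lborel (\<lambda>z. normal_density 0 (sqrt \<tau>) z * z ^ 2) \<tau>"
    "has_bochner_integral lborel (\<lambda>z. normal_density 0 (sqrt \<tau>) z * z ^ 3) 0"
    "has_bochner_integral lborel (\<lambda>z. normal_density 0 (sqrt \<tau>) z * z ^ 4) (3 * \<tau>\<^sup>2)"
    "has_bochner_integral lborel (\<lambda>z. normal_density 0 (sqrt \<tau>) z * z ^ 5) 0"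
    "has_bochner_integral lborel (\<lambda>z. normal_density 0 (sqrt \<tau>) z * z ^ 6) (15 * \<tau> ^ 3)"
proof -
  have p: "0 < sqrt \<tau>" using assms by simp
  note e = normal_moment_even[OF p, of 0] and o = normal_moment_odd[OF p, of 0]
  show "has_bochner_integral lborel (\<lambda>z. normal_density 0 (sqrt \<tau>) z * 1) 1"
    using e[of 0] by simp
  show "has_bochner_integral lborel (\<lambda>z. normal_density 0 (sqrt \<tau>) z * z) 0"
    using o[of 0] by simp
  show "has_bochner_integral lborel (\<lambda>z. normal_density 0 (sqrt \<tau>) z * z ^ 2) \<tau>"
    using e[of 1] assms by simp
  show "has_bochner_integral lborel (\<lambda>z. normal_density 0 (sqrt \<tau>) z * z ^ 3) 0"
    using o[of 1] by (simp add: eval_nat_numeral)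
  show "has_bochner_integral lborel (\<lambda>z. normal_density 0 (sqrt \<tau>) z * z ^ 4) (3 * \<tau>\<^sup>2)"
    using e[of 2] assms by (simp add: fact_numeral power_divide)
  show "has_bochner_integral lborel (\<lambda>z. normal_density 0 (sqrt \<tau>) z * z ^ 5) 0"
    using o[of 2] by (simp add: eval_nat_numeral)
  show "has_bochner_integral lborel (\<lambda>z. normal_density 0 (sqrt \<tau>) z * z ^ 6) (15 * \<tau> ^ 3)"
    using e[of 3] assms by (simp add: fact_numeral power_divide)
qed

text \<open>Degree six is what the cube of a quadratic in z requires. Pointwise nonnegativity of the
  whole polynomial, though not of its terms, lets the nonnegative integral be computed from signed
  Bochner moments.\<close>

lemma gaussian_poly6:
  fixes a0 a1 a2 a3 a4 a5 a6 \<tau> :: real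
  assumes \<tau>: "\<tau> > 0"
    and nn: "\<And>z. 0 \<le> a0 + a1 * z + a2 * z ^ 2 + a3 * z ^ 3 + a4 * z ^ 4 + a5 * z ^ 5 + a6 * z ^ 6"
  shows "(\<integral>\<^sup>+z. ennreal (a0 + a1 * z + a2 * z ^ 2 + a3 * z ^ 3 + a4 * z ^ 4 + a5 * z ^ 5 + a6 * z ^ 6)
      \<partial>gaussian \<tau>) = ennreal (a0 + a2 * \<tau> + a4 * (3 * \<tau>\<^sup>2) + a6 * (15 * \<tau> ^ 3))"
proof -
  let ?n = "normal_density 0 (sqrt \<tau>)"
  note m = gaussian_moments[OF \<tau>]
  have "has_bochner_integral lborel (\<lambda>z. a0 * (?n z * 1) + a1 * (?n z * z) + a2 * (?n z * z ^ 2)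
      + a3 * (?n z * z ^ 3) + a4 * (?n z * z ^ 4) + a5 * (?n z * z ^ 5) + a6 * (?n z * z ^ 6))
      (a0 * 1 + a1 * 0 + a2 * \<tau> + a3 * 0 + a4 * (3 * \<tau>\<^sup>2) + a5 * 0 + a6 * (15 * \<tau> ^ 3))"
    by (intro has_bochner_integral_add has_bochner_integral_mult_right m)
  also have "(\<lambda>z. a0 * (?n z * 1) + a1 * (?n z * z) + a2 * (?n z * z ^ 2)
      + a3 * (?n z * z ^ 3) + a4 * (?n z * z ^ 4) + a5 * (?n z * z ^ 5) + a6 * (?n z * z ^ 6))
     = (\<lambda>z. ?n z * (a0 + a1 * z + a2 * z ^ 2 + a3 * z ^ 3 + a4 * z ^ 4 + a5 * z ^ 5 + a6 * z ^ 6))"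
    by (simp add: algebra_simps)
  finally have "(\<integral>\<^sup>+z. ennreal (?n z * (a0 + a1 * z + a2 * z ^ 2 + a3 * z ^ 3 + a4 * z ^ 4 + a5 * z ^ 5 + a6 * z ^ 6)) \<partial>lborel)
      = ennreal (a0 + a2 * \<tau> + a4 * (3 * \<tau>\<^sup>2) + a6 * (15 * \<tau> ^ 3))"
    by (subst nn_integral_eq_integral)
      (auto simp: has_bochner_integral_iff nn normal_density_nonneg)
  then show ?thesis
    by (subst nn_integral_density) (simp_all add: ennreal_mult'[OF normal_density_nonneg, symmetric])
qed

lemma gaussian_second_moment:
  fixes u v :: "'a::real_inner"
  assumes \<tau>: "\<tau> > 0"
  shows "(\<integral>\<^sup>+z. ennreal ((norm (u + z *\<^sub>R v))\<^sup>2) \<partial>gaussian \<tau>) = ennreal ((norm u)\<^sup>2 + \<tau> * (norm v)\<^sup>2)"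
proof -
  have eq: "(norm (u + z *\<^sub>R v))\<^sup>2 = (norm u)\<^sup>2 + (2 * (u \<bullet> v)) * z + (norm v)\<^sup>2 * z ^ 2 + 0 * z ^ 3 + 0 * z ^ 4 + 0 * z ^ 5 + 0 * z ^ 6" for z
    by (simp only: power2_norm_eq_inner) (simp add: inner_add_left inner_add_right inner_commute algebra_simps power2_eq_square)
  have "(\<integral>\<^sup>+z. ennreal ((norm (u + z *\<^sub>R v))\<^sup>2) \<partial>gaussian \<tau>) = ennreal ((norm u)\<^sup>2 + (norm v)\<^sup>2 * \<tau> + 0 * (3 * \<tau>\<^sup>2) + 0 * (15 * \<tau> ^ 3))"
    unfolding eq by (rule gaussian_poly6[OF \<tau>]) (simp only: eq[symmetric], simp)
  then show ?thesis by (simp add: mult.commute)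
qed

text \<open>Write the base as \<open>V * (1 + \<xi> z)\<close> and integrate the cubic bound
  exactly. The mean of \<xi> gives the factor 1 - l, the mean square of its linear part gives the
  inner-product term, and every further term has a favourable sign once l \<ge> 3. No remainder of
  higher order in \<tau> is left over, so no smallness of \<tau> is involved.\<close>

lemma gaussian_powr_step:
  fixes u v :: "'a::real_inner"
  assumes \<tau>: "\<tau> > 0" and s: "0 < s" "s < 1" and l: "l \<ge> 3" and c: "c \<ge> 0"
    and V: "V = c + (norm u)\<^sup>2 + l * \<tau> * (norm v)\<^sup>2" "V > 0"
  shows "(\<integral>\<^sup>+z. ennreal ((c + (norm (u + z *\<^sub>R v))\<^sup>2) powr s) \<partial>gaussian \<tau>)
    \<le> ennreal (V powr s * (1 + s * \<tau> * ((1 - l) * (norm v)\<^sup>2 / V - 2 * (1 - s) * (u \<bullet> v)\<^sup>2 / V\<^sup>2)))"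
proof -
  \<comment> \<open>Linear and quadratic coefficients of the base in z, relative to V. Shifting
    \<open>z\<^sup>2\<close> by \<open>l * \<tau>\<close> in \<xi> is what centres the expansion at
    V.\<close>
  define A where "A = 2 * (u \<bullet> v) / V"
  define B where "B = (norm v)\<^sup>2 / V"
  have B: "B \<ge> 0" using V by (simp add: B_def)
  define \<xi> where "\<xi> z = A * z + B * (z\<^sup>2 - l * \<tau>)" for z
  have exp_norm: "(norm (u + z *\<^sub>R v))\<^sup>2 = (norm u)\<^sup>2 + 2 * (u \<bullet> v) * z + (norm v)\<^sup>2 * z\<^sup>2" for z
    by (simp only: power2_norm_eq_inner) (simp add: inner_add_left inner_add_right inner_commute algebra_simps power2_eq_square)
  have VA: "V * A = 2 * (u \<bullet> v)" and VB: "V * B = (norm v)\<^sup>2" using V(2) by (simp_all add: A_def B_def)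
  have base: "c + (norm (u + z *\<^sub>R v))\<^sup>2 = V * (1 + \<xi> z)" for z
  proof -
    have "V * (1 + \<xi> z) = V + (V * A) * z + (V * B) * (z\<^sup>2 - l * \<tau>)" by (simp add: \<xi>_def algebra_simps)
    also have "\<dots> = V + 2 * (u \<bullet> v) * z + (norm v)\<^sup>2 * (z\<^sup>2 - l * \<tau>)" by (simp add: VA VB)
    also have "\<dots> = c + ((norm u)\<^sup>2 + 2 * (u \<bullet> v) * z + (norm v)\<^sup>2 * z\<^sup>2)" using V(1) by (simp add: algebra_simps)
    finally show ?thesis unfolding exp_norm by simp
  qed
  have \<xi>: "\<xi> z \<ge> -1" for z
  proof -
    have "0 \<le> V * (1 + \<xi> z)" using c by (simp flip: base)
    then show ?thesis using V(2) by (simp add: zero_le_mult_iff)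
  qed
  define k2 where "k2 = s * (s - 1) / 2"
  define k3 where "k3 = s * (s - 1) * (s - 2) / 6"
  have k2: "k2 \<le> 0" and k3: "k3 \<ge> 0"
    using s by (auto simp: k2_def k3_def mult_le_0_iff zero_le_mult_iff)
  have T: "(1 + \<xi> z) powr s \<le> 1 + s * \<xi> z + k2 * (\<xi> z)\<^sup>2 + k3 * \<xi> z ^ 3" for z
    using powr_taylor3[OF s \<xi>[of z]] by (simp add: k2_def k3_def)
  let ?b = "B * l * \<tau>"
  define p0 where "p0 = 1 - s * ?b + k2 * ?b^2 - k3 * ?b^3"
  define p1 where "p1 = s * A - 2 * k2 * A * ?b + 3 * k3 * A * ?b^2"
  define p2 where "p2 = s * B + k2 * (A^2 - 2 * B * ?b) + k3 * (3 * B * ?b^2 - 3 * A^2 * ?b)"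
  define p3 where "p3 = k2 * (2 * A * B) + k3 * (A^3 - 6 * A * B * ?b)"
  define p4 where "p4 = k2 * B^2 + k3 * (3 * A^2 * B - 3 * B^2 * ?b)"
  define p5 where "p5 = k3 * (3 * A * B^2)"
  define p6 where "p6 = k3 * B^3"
  have poly: "1 + s * \<xi> z + k2 * (\<xi> z)\<^sup>2 + k3 * \<xi> z ^ 3 =
      p0 + p1 * z + p2 * z ^ 2 + p3 * z ^ 3 + p4 * z ^ 4 + p5 * z ^ 5 + p6 * z ^ 6" for z
    unfolding \<xi>_def p0_def p1_def p2_def p3_def p4_def p5_def p6_def
    by (simp add: power2_eq_square power3_eq_cube eval_nat_numeral algebra_simps)
  have poly_nn: "0 \<le> p0 + p1 * z + p2 * z ^ 2 + p3 * z ^ 3 + p4 * z ^ 4 + p5 * z ^ 5 + p6 * z ^ 6" for z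
    using order_trans[OF powr_ge_zero T[of z]] by (simp only: poly)
  \<comment> \<open>Odd powers of z integrate to 0. The factor \<open>(l - 1)\<^sup>2 + 2\<close> is
    the mean square of \<open>z\<^sup>2 - l * \<tau>\<close> in units of \<tau>,
    \<open>3 - l\<close> comes from the mean of \<open>z\<^sup>2 * (z\<^sup>2 - l * \<tau>)\<close>,
    and the cubic in l is the third moment of the shifted square.\<close>
  have mean: "p0 + p2 * \<tau> + p4 * (3 * \<tau>\<^sup>2) + p6 * (15 * \<tau> ^ 3) =
      1 + s * \<tau> * (B * (1 - l)) + k2 * (A\<^sup>2 * \<tau>) + k2 * (B\<^sup>2 * \<tau>\<^sup>2 * ((l - 1)\<^sup>2 + 2))
      + k3 * (3 * A\<^sup>2 * B * \<tau>\<^sup>2 * (3 - l)) + k3 * (B ^ 3 * \<tau> ^ 3 * (15 - 9 * l + 3 * l\<^sup>2 - l ^ 3))"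
    unfolding p0_def p2_def p4_def p6_def
    by (simp add: power2_eq_square power3_eq_cube eval_nat_numeral algebra_simps)
  have t1: "k2 * (B\<^sup>2 * \<tau>\<^sup>2 * ((l - 1)\<^sup>2 + 2)) \<le> 0" using k2 by (intro mult_nonpos_nonneg) auto
  \<comment> \<open>The condition l \<ge> 3 is dictated by this mixed third-order term, whose
    coefficient \<open>k3\<close> is nonnegative.\<close>
  have t2: "k3 * (3 * A\<^sup>2 * B * \<tau>\<^sup>2 * (3 - l)) \<le> 0"
    using k3 B l by (intro mult_nonneg_nonpos mult_nonneg_nonneg) auto
  have "15 - 9 * l + 3 * l\<^sup>2 - l ^ 3 = - (l\<^sup>2 * (l - 3) + (9 * (l - 3) + 12))" by algebra
  also have "\<dots> \<le> 0" using l by (intro iffD2[OF neg_le_0_iff_le] add_nonneg_nonneg mult_nonneg_nonneg) auto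
  finally have t3: "k3 * (B ^ 3 * \<tau> ^ 3 * (15 - 9 * l + 3 * l\<^sup>2 - l ^ 3)) \<le> 0"
    using k3 B \<tau> by (intro mult_nonneg_nonpos mult_nonneg_nonneg) auto
  have A2: "k2 * (A\<^sup>2 * \<tau>) = s * \<tau> * (- 2 * (1 - s) * (u \<bullet> v)\<^sup>2 / V\<^sup>2)"
    using V(2) by (simp add: k2_def A_def power_divide power_mult_distrib field_simps)
  have mean_le: "p0 + p2 * \<tau> + p4 * (3 * \<tau>\<^sup>2) + p6 * (15 * \<tau> ^ 3) \<le>
      1 + s * \<tau> * ((1 - l) * (norm v)\<^sup>2 / V - 2 * (1 - s) * (u \<bullet> v)\<^sup>2 / V\<^sup>2)"
  proof -
    have "B * (1 - l) = (1 - l) * (norm v)\<^sup>2 / V" by (simp add: B_def)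
    moreover have "s * \<tau> * x + s * \<tau> * (- 2 * (1 - s) * q / w) = s * \<tau> * (x - 2 * (1 - s) * q / w)" for x q w :: real
      by (simp add: algebra_simps diff_divide_distrib)
    ultimately show ?thesis using t1 t2 t3 unfolding mean A2 by (metis (no_types, lifting) add.assoc add_decreasing2 add_left_mono order_refl)
  qed
  have "(\<integral>\<^sup>+z. ennreal ((c + (norm (u + z *\<^sub>R v))\<^sup>2) powr s) \<partial>gaussian \<tau>)
      \<le> (\<integral>\<^sup>+z. ennreal (V powr s) * ennreal (p0 + p1 * z + p2 * z ^ 2 + p3 * z ^ 3 + p4 * z ^ 4 + p5 * z ^ 5 + p6 * z ^ 6) \<partial>gaussian \<tau>)"
  proof (rule nn_integral_mono)
    fix z
    have "(c + (norm (u + z *\<^sub>R v))\<^sup>2) powr s = V powr s * (1 + \<xi> z) powr s"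
      unfolding base using V(2) \<xi>[of z] by (subst powr_mult) auto
    also have "\<dots> \<le> V powr s * (p0 + p1 * z + p2 * z ^ 2 + p3 * z ^ 3 + p4 * z ^ 4 + p5 * z ^ 5 + p6 * z ^ 6)"
      using T[of z] unfolding poly by (intro mult_left_mono) auto
    finally show "ennreal ((c + (norm (u + z *\<^sub>R v))\<^sup>2) powr s) \<le>
       ennreal (V powr s) * ennreal (p0 + p1 * z + p2 * z ^ 2 + p3 * z ^ 3 + p4 * z ^ 4 + p5 * z ^ 5 + p6 * z ^ 6)"
      using poly_nn[of z] by (subst ennreal_mult[symmetric]) (auto intro: ennreal_leI)
  qed
  also have "\<dots> = ennreal (V powr s) * ennreal (p0 + p2 * \<tau> + p4 * (3 * \<tau>\<^sup>2) + p6 * (15 * \<tau> ^ 3))"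
    by (subst nn_integral_cmult) (auto simp: gaussian_poly6[OF \<tau> poly_nn])
  also have "\<dots> \<le> ennreal (V powr s) * ennreal (1 + s * \<tau> * ((1 - l) * (norm v)\<^sup>2 / V - 2 * (1 - s) * (u \<bullet> v)\<^sup>2 / V\<^sup>2))"
    by (intro mult_left_mono ennreal_leI mean_le) simp
  also have "\<dots> = ennreal (V powr s * (1 + s * \<tau> * ((1 - l) * (norm v)\<^sup>2 / V - 2 * (1 - s) * (u \<bullet> v)\<^sup>2 / V\<^sup>2)))"
    by (rule ennreal_mult'[symmetric]) simp
  finally show ?thesis .
qed


text \<open>With weight \<open>1 - s\<close> on the dissipativity hypothesis and weight \<open>s\<close> on \<open>(1 - l) |v|\<^sup>2 / V \<le> 0\<close>, the convex
  combination is exactly the first-order term of the preceding estimate.\<close>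

lemma gaussian_powr_dissipative:
  fixes u v :: "'a::real_inner"
  assumes \<tau>: "\<tau> > 0" and s: "0 < s" "s < 1" and l: "l \<ge> 3" and c: "c \<ge> 0" and b: "l * \<tau> \<le> b"
    and V: "V = c + (norm u)\<^sup>2 + l * \<tau> * (norm v)\<^sup>2"
    and V': "V' = c + (norm u)\<^sup>2 + b * (norm v)\<^sup>2"
    and \<kappa>: "V' > 0 \<Longrightarrow> (1 - l) * (norm v)\<^sup>2 / V' - 2 * (u \<bullet> v)\<^sup>2 / V'\<^sup>2 \<le> \<kappa>"
  shows "(\<integral>\<^sup>+z. ennreal ((c + (norm (u + z *\<^sub>R v))\<^sup>2) powr s) \<partial>gaussian \<tau>)
    \<le> ennreal (V powr s * (1 + s * \<tau> * ((1 - s) * \<kappa>)))"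
proof (cases "V > 0")
  case True
  \<comment> \<open>Both terms of the hypothesis are nonpositive, so replacing V' by the smaller V
    makes them only more negative. A bound for the fixed weight b thus transfers to every step with
    \<open>l * \<tau> \<le> b\<close>.\<close>
  have VV': "V \<le> V'" unfolding V V' using b by (simp add: mult_right_mono)
  hence V'0: "V' > 0" using True by simp
  have "(1 - l) * (norm v)\<^sup>2 / V \<le> (1 - l) * (norm v)\<^sup>2 / V'"
    using True VV' l by (intro divide_left_mono_neg mult_nonpos_nonneg) auto
  moreover have "(u \<bullet> v)\<^sup>2 / V'\<^sup>2 \<le> (u \<bullet> v)\<^sup>2 / V\<^sup>2"
    using True VV' by (intro divide_left_mono power_mono mult_pos_pos) auto
  ultimately have d: "(1 - l) * (norm v)\<^sup>2 / V - 2 * (u \<bullet> v)\<^sup>2 / V\<^sup>2 \<le> \<kappa>"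
    using \<kappa>[OF V'0] by (simp add: field_simps)
  have neg: "(1 - l) * (norm v)\<^sup>2 / V \<le> 0"
    using True l by (intro divide_nonpos_nonneg mult_nonpos_nonneg) auto
  have "(1 - l) * (norm v)\<^sup>2 / V - 2 * (1 - s) * (u \<bullet> v)\<^sup>2 / V\<^sup>2
      = (1 - s) * ((1 - l) * (norm v)\<^sup>2 / V - 2 * (u \<bullet> v)\<^sup>2 / V\<^sup>2) + s * ((1 - l) * (norm v)\<^sup>2 / V)"
  proof -
    have "x - 2 * (1 - s) * q / w = (1 - s) * (x - 2 * q / w) + s * x" for x q w :: real
      by (simp add: algebra_simps diff_divide_distrib)
    then show ?thesis .
  qed
  also have "\<dots> \<le> (1 - s) * \<kappa> + s * 0"
    using d neg s by (intro add_mono mult_left_mono) auto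
  finally have "(1 - l) * (norm v)\<^sup>2 / V - 2 * (1 - s) * (u \<bullet> v)\<^sup>2 / V\<^sup>2 \<le> (1 - s) * \<kappa>" by simp
  hence "V powr s * (1 + s * \<tau> * ((1 - l) * (norm v)\<^sup>2 / V - 2 * (1 - s) * (u \<bullet> v)\<^sup>2 / V\<^sup>2))
      \<le> V powr s * (1 + s * \<tau> * ((1 - s) * \<kappa>))"
    using s \<tau> by (intro mult_left_mono add_left_mono) auto
  with gaussian_powr_step[OF \<tau> s l c V True] show ?thesis
    by (meson ennreal_leI order_trans)
next
  case False
  \<comment> \<open>V = 0 forces c, u and v to vanish, and both sides are 0 because
    \<open>0 powr s = 0\<close>.\<close>
  have "c + (norm u)\<^sup>2 + l * \<tau> * (norm v)\<^sup>2 \<ge> 0" using c l \<tau> by simp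
  hence "c + (norm u)\<^sup>2 + l * \<tau> * (norm v)\<^sup>2 = 0" using False V by simp
  moreover have "0 \<le> l * \<tau> * (norm v)\<^sup>2" using l \<tau> by simp
  ultimately have "c = 0" "(norm u)\<^sup>2 = 0" "l * \<tau> * (norm v)\<^sup>2 = 0"
    using c zero_le_power2[of "norm u"] by linarith+
  thus ?thesis using l \<tau> False by (simp add: V)
qed

section \<open>Nonnegative processes in discrete time\<close>

lemma powr_le_tangent:
  fixes r s :: real
  assumes "r \<ge> 0" "0 < s" "s \<le> 1"
  shows "r powr s \<le> 1 + s * (r - 1)"
proof (cases "r = 0")
  case False
  then have "r powr s * 1 powr (1 - s) \<le> s * r + (1 - s) * 1"
    using assms by (intro Youngs_inequality_0) auto
  then show ?thesis by (simp add: algebra_simps)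
qed (use assms in auto)

lemma powr_le_tangent_at:
  fixes x y s :: real
  assumes "x \<ge> 0" "y > 0" "0 < s" "s \<le> 1"
  shows "x powr s \<le> y powr s + s * y powr (s - 1) * (x - y)"
proof -
  have "x powr s = y powr s * (x / y) powr s"
    using assms by (simp add: powr_divide)
  also have "\<dots> \<le> y powr s * (1 + s * (x / y - 1))"
    using assms by (intro mult_left_mono powr_le_tangent) auto
  also have "\<dots> = y powr s + s * (y powr s / y) * (x - y)"
    using assms by (simp add: field_simps)
  also have "y powr s / y = y powr (s - 1)"
    using assms by (simp add: powr_diff)
  finally show ?thesis .
qed

text \<open>After division by a + b both summands lie in the unit interval, where
  \<open>t \<le> t powr p\<close>.\<close>

lemma powr_add_le:
  fixes a b p :: real
  assumes "a \<ge> 0" "b \<ge> 0" "0 < p" "p \<le> 1"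
  shows "(a + b) powr p \<le> a powr p + b powr p"
proof (cases "a + b = 0")
  case True then show ?thesis using assms by (simp add: add_nonneg_eq_0_iff)
next
  case False
  then have pos: "a + b > 0" using assms by simp
  have *: "x / (a + b) \<le> (x / (a + b)) powr p" if "0 \<le> x" "x \<le> a + b" for x
  proof (cases "x = 0")
    case False
    have "(x / (a + b)) powr 1 \<le> (x / (a + b)) powr p"
      using that pos assms False by (intro powr_mono') (auto simp: field_simps)
    then show ?thesis using that pos by simp
  qed simp
  have "1 = a / (a + b) + b / (a + b)" using pos by (simp flip: add_divide_distrib)
  also have "\<dots> \<le> (a / (a + b)) powr p + (b / (a + b)) powr p"
    using assms by (intro add_mono *) auto
  also have "\<dots> = (a powr p + b powr p) / (a + b) powr p"
    using assms by (simp add: powr_divide add_divide_distrib)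
  finally show ?thesis using pos by (simp add: field_simps)
qed

section \<open>Weak supermartingale inequalities and running maxima\<close>

primrec running_max :: "(nat \<Rightarrow> 'm \<Rightarrow> real) \<Rightarrow> nat \<Rightarrow> 'm \<Rightarrow> real" where
  "running_max S 0 \<omega> = S 0 \<omega>"
| "running_max S (Suc n) \<omega> = max (running_max S n \<omega>) (S (Suc n) \<omega>)"

lemma running_max_ge: "i \<le> n \<Longrightarrow> S i \<omega> \<le> running_max S n \<omega>"
  by (induction n) (auto simp: le_Suc_eq max_def)

lemma running_max_attained: "\<exists>i\<le>n. running_max S n \<omega> = S i \<omega>"
  by (induction n) (auto simp: le_Suc_eq max_def)

locale discrete_filtration =
  fixes M :: "'m measure" and G :: "nat \<Rightarrow> 'm measure"
  assumes space_G: "space (G i) = space M"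
    and sets_G: "sets (G i) \<subseteq> sets M"
    and G_Suc: "sets (G i) \<subseteq> sets (G (Suc i))"
begin

lemma G_M: "f \<in> measurable (G i) N \<Longrightarrow> f \<in> measurable M N"
  using measurable_mono[OF subset_refl refl sets_G space_G] by blast

lemma sets_G_mono: "i \<le> j \<Longrightarrow> sets (G i) \<subseteq> sets (G j)"
  using lift_Suc_mono_le[of "\<lambda>i. sets (G i)" i j] G_Suc by blast

lemma G_mono: "i \<le> j \<Longrightarrow> f \<in> measurable (G i) N \<Longrightarrow> f \<in> measurable (G j) N"
  unfolding measurable_def using sets_G_mono[of i j] by (auto simp: space_G)

lemma running_max_measurable:
  assumes "\<And>i. i \<le> n \<Longrightarrow> S i \<in> borel_measurable (G i)"
  shows "running_max S n \<in> borel_measurable (G n)"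
  using assms
proof (induction n)
  case 0
  have "running_max S 0 = S 0" by auto
  then show ?case using 0 by simp
next
  case (Suc n)
  have "running_max S n \<in> borel_measurable (G (Suc n))" "S (Suc n) \<in> borel_measurable (G (Suc n))"
    using Suc by (auto intro: G_mono[of n "Suc n"])
  moreover have "running_max S (Suc n) = (\<lambda>\<omega>. max (running_max S n \<omega>) (S (Suc n) \<omega>))" by auto
  ultimately show ?case by simp
qed

text \<open>The hypothesis \<open>step\<close>, over all weights v of \<open>G i\<close>, is a
  conditional-expectation inequality in weak form. The weights w are predictable and decreasing:
  \<open>w (Suc i)\<close> may serve as v, and afterwards it may be replaced by \<open>w i\<close>
  in front of \<open>Y i\<close>, while the source keeps the smaller weight.\<close>

lemma weighted_growth:
  fixes Y a w :: "nat \<Rightarrow> 'm \<Rightarrow> ennreal" and c :: ennreal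
  assumes Y: "\<And>i. i \<le> n \<Longrightarrow> Y i \<in> borel_measurable M"
    and a: "\<And>i. i < n \<Longrightarrow> a i \<in> borel_measurable M"
    and w: "w 0 \<in> borel_measurable M" "\<And>i. i < n \<Longrightarrow> w (Suc i) \<in> borel_measurable (G i)"
    and w_le: "\<And>i \<omega>. i < n \<Longrightarrow> \<omega> \<in> space M \<Longrightarrow> w (Suc i) \<omega> \<le> w i \<omega>"
    and c: "c \<ge> 1"
    and step: "\<And>i v. i < n \<Longrightarrow> v \<in> borel_measurable (G i) \<Longrightarrow>
      (\<integral>\<^sup>+\<omega>. v \<omega> * Y (Suc i) \<omega> \<partial>M) \<le> c * (\<integral>\<^sup>+\<omega>. v \<omega> * (Y i \<omega> + a i \<omega>) \<partial>M)"
  shows "(\<integral>\<^sup>+\<omega>. w n \<omega> * Y n \<omega> \<partial>M) \<le> c ^ n * (\<integral>\<^sup>+\<omega>. w 0 \<omega> * Y 0 \<omega> + (\<Sum>l<n. w (Suc l) \<omega> * a l \<omega>) \<partial>M)"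
  using Y a w w_le step
proof (induction n)
  case 0 then show ?case by simp
next
  case (Suc n)
  have wM: "w i \<in> borel_measurable M" if "i \<le> Suc n" for i
    using that Suc.prems(3) G_M[OF Suc.prems(4)] by (cases i) auto
  note [measurable] = Suc.prems(1) Suc.prems(2) wM
  have [measurable]: "Y n \<in> borel_measurable M" "a n \<in> borel_measurable M" "w n \<in> borel_measurable M"
    "w (Suc n) \<in> borel_measurable M" "Y 0 \<in> borel_measurable M" "w 0 \<in> borel_measurable M"
    by (auto intro!: Suc.prems wM)
  have [measurable]: "(\<lambda>\<omega>. \<Sum>l<n. w (Suc l) \<omega> * a l \<omega>) \<in> borel_measurable M"
    by (intro borel_measurable_sum borel_measurable_times_ennreal) (auto intro!: wM Suc.prems)
  have IH: "(\<integral>\<^sup>+\<omega>. w n \<omega> * Y n \<omega> \<partial>M) \<le> c ^ n * (\<integral>\<^sup>+\<omega>. w 0 \<omega> * Y 0 \<omega> + (\<Sum>l<n. w (Suc l) \<omega> * a l \<omega>) \<partial>M)"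
    by (rule Suc.IH) (use Suc.prems in auto)
  have "(\<integral>\<^sup>+\<omega>. w (Suc n) \<omega> * Y (Suc n) \<omega> \<partial>M) \<le> c * (\<integral>\<^sup>+\<omega>. w (Suc n) \<omega> * (Y n \<omega> + a n \<omega>) \<partial>M)"
    using Suc.prems by simp
  also have "\<dots> \<le> c * (\<integral>\<^sup>+\<omega>. w n \<omega> * Y n \<omega> + w (Suc n) \<omega> * a n \<omega> \<partial>M)"
    using Suc.prems(5) by (intro mult_left_mono nn_integral_mono) (auto simp: distrib_left intro!: add_right_mono mult_right_mono)
  also have "\<dots> = c * ((\<integral>\<^sup>+\<omega>. w n \<omega> * Y n \<omega> \<partial>M) + (\<integral>\<^sup>+\<omega>. w (Suc n) \<omega> * a n \<omega> \<partial>M))"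
    by (subst nn_integral_add) auto
  also have "\<dots> \<le> c * (c ^ n * (\<integral>\<^sup>+\<omega>. w 0 \<omega> * Y 0 \<omega> + (\<Sum>l<n. w (Suc l) \<omega> * a l \<omega>) \<partial>M)
      + c ^ n * (\<integral>\<^sup>+\<omega>. w (Suc n) \<omega> * a n \<omega> \<partial>M))"
  proof (intro mult_left_mono add_mono IH)
    have "1 \<le> c ^ n" using c by (simp add: one_le_power)
    from mult_right_mono[OF this, of "\<integral>\<^sup>+\<omega>. w (Suc n) \<omega> * a n \<omega> \<partial>M"]
    show "(\<integral>\<^sup>+\<omega>. w (Suc n) \<omega> * a n \<omega> \<partial>M) \<le> c ^ n * (\<integral>\<^sup>+\<omega>. w (Suc n) \<omega> * a n \<omega> \<partial>M)" by simp
  qed auto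
  also have "\<dots> = c ^ Suc n * ((\<integral>\<^sup>+\<omega>. w 0 \<omega> * Y 0 \<omega> + (\<Sum>l<n. w (Suc l) \<omega> * a l \<omega>) \<partial>M)
      + (\<integral>\<^sup>+\<omega>. w (Suc n) \<omega> * a n \<omega> \<partial>M))"
    by (simp add: distrib_left mult_ac)
  also have "\<dots> = c ^ Suc n * (\<integral>\<^sup>+\<omega>. w 0 \<omega> * Y 0 \<omega> + (\<Sum>l<Suc n. w (Suc l) \<omega> * a l \<omega>) \<partial>M)"
    by (subst nn_integral_add[symmetric]) (auto simp: add_ac)
  finally show ?case .
qed

text \<open>A Lenglart-type domination: the weights \<open>B n powr (s - 1)\<close> make the compensated sum telescope, by concavity.\<close>

lemma powr_domination:
  fixes Y a :: "nat \<Rightarrow> 'm \<Rightarrow> real" and c s \<delta> :: real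
  assumes Y: "Y 0 \<in> borel_measurable (G 0)" "\<And>i. i \<le> n \<Longrightarrow> Y i \<in> borel_measurable M" "\<And>i \<omega>. Y i \<omega> \<ge> 0"
    and a: "\<And>i. i < n \<Longrightarrow> a i \<in> borel_measurable (G i)" "\<And>i \<omega>. a i \<omega> \<ge> 0"
    and c: "c \<ge> 1" and s: "0 < s" "s < 1" and \<delta>: "\<delta> > 0"
    and step: "\<And>i v. i < n \<Longrightarrow> v \<in> borel_measurable (G i) \<Longrightarrow>
      (\<integral>\<^sup>+\<omega>. v \<omega> * ennreal (Y (Suc i) \<omega>) \<partial>M) \<le> ennreal c * (\<integral>\<^sup>+\<omega>. v \<omega> * ennreal (Y i \<omega> + a i \<omega>) \<partial>M)"
  shows "(\<integral>\<^sup>+\<omega>. ennreal (Y n \<omega> powr s) \<partial>M) \<le>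
    ennreal (c ^ n / s + 1) * (\<integral>\<^sup>+\<omega>. ennreal ((\<delta> + Y 0 \<omega> + (\<Sum>l<n. a l \<omega>)) powr s) \<partial>M)"
proof -
  \<comment> \<open>\<open>B (Suc k)\<close> involves the sources up to index k only, so it is known
    at time k and its powers are predictable weights. The positive \<delta> keeps B away from 0,
    since the exponent s - 1 is negative.\<close>
  define B where "B k \<omega> = \<delta> + Y 0 \<omega> + (\<Sum>l<k. a l \<omega>)" for k \<omega>
  have B0: "B k \<omega> > 0" for k \<omega>
    unfolding B_def using \<delta> Y(3)[of 0 \<omega>] by (intro add_pos_nonneg sum_nonneg a) auto
  have BS: "B (Suc k) \<omega> = B k \<omega> + a k \<omega>" for k \<omega> by (simp add: B_def)
  have BG: "B (Suc k) \<in> borel_measurable (G k)" if "k < n" for k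
  proof -
    have "Y 0 \<in> borel_measurable (G k)" using G_mono[of 0 k] Y(1) by blast
    moreover have "(\<lambda>\<omega>. \<Sum>l<Suc k. a l \<omega>) \<in> borel_measurable (G k)"
      by (intro borel_measurable_sum) (use that in \<open>auto intro: G_mono[OF _ a(1)]\<close>)
    ultimately show ?thesis unfolding B_def[abs_def] by measurable
  qed
  have BM[measurable]: "B k \<in> borel_measurable M" if "k \<le> n" for k
  proof (cases k)
    case 0
    have "B 0 = (\<lambda>\<omega>. \<delta> + Y 0 \<omega>)" by (auto simp: B_def)
    then show ?thesis using Y(2)[of 0] 0 by simp
  next
    case (Suc j) then show ?thesis using BG[of j] that G_M by auto
  qed
  have [measurable]: "Y n \<in> borel_measurable M" "B n \<in> borel_measurable M" using Y(2) BM by auto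
  have growth: "(\<integral>\<^sup>+\<omega>. ennreal (B n \<omega> powr (s - 1)) * ennreal (Y n \<omega>) \<partial>M) \<le> ennreal c ^ n *
     (\<integral>\<^sup>+\<omega>. ennreal (B 0 \<omega> powr (s - 1)) * ennreal (Y 0 \<omega>) + (\<Sum>l<n. ennreal (B (Suc l) \<omega> powr (s - 1)) * ennreal (a l \<omega>)) \<partial>M)"
  proof (rule weighted_growth)
    show "(\<lambda>\<omega>. ennreal (B (Suc i) \<omega> powr (s - 1))) \<in> borel_measurable (G i)" if "i < n" for i
      using BG[OF that] by measurable
    show "ennreal (B (Suc i) \<omega> powr (s - 1)) \<le> ennreal (B i \<omega> powr (s - 1))" for i \<omega>
      using a(2)[of i \<omega>] B0[of i \<omega>] s by (intro ennreal_leI powr_mono2') (auto simp: BS)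
    show "(\<integral>\<^sup>+\<omega>. v \<omega> * ennreal (Y (Suc i) \<omega>) \<partial>M) \<le> ennreal c * (\<integral>\<^sup>+\<omega>. v \<omega> * (ennreal (Y i \<omega>) + ennreal (a i \<omega>)) \<partial>M)"
      if "i < n" "v \<in> borel_measurable (G i)" for i v
      using step[OF that] Y(3) a(2) by (simp add: ennreal_plus)
    show "1 \<le> ennreal c" using c by simp
    show "(\<lambda>\<omega>. ennreal (B 0 \<omega> powr (s - 1))) \<in> borel_measurable M" using BM[of 0] by simp
    show "(\<lambda>\<omega>. ennreal (a i \<omega>)) \<in> borel_measurable M" if "i < n" for i using G_M[OF a(1)[OF that]] by simp
    show "(\<lambda>\<omega>. ennreal (Y i \<omega>)) \<in> borel_measurable M" if "i \<le> n" for i using Y(2)[OF that] by simp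
  qed
  \<comment> \<open>By concavity \<open>B (Suc k) powr (s - 1) * a k\<close> is at most the
    increment of \<open>B powr s / s\<close>; the tangent is taken at the later point, to match the
    predictable weight.\<close>
  have tele: "B 0 \<omega> powr (s - 1) * Y 0 \<omega> + (\<Sum>l<k. B (Suc l) \<omega> powr (s - 1) * a l \<omega>) \<le> B k \<omega> powr s / s" for k \<omega>
  proof (induction k)
    case 0
    have "B 0 \<omega> powr (s - 1) * Y 0 \<omega> \<le> B 0 \<omega> powr (s - 1) * B 0 \<omega>"
      using \<delta> by (intro mult_left_mono) (auto simp: B_def)
    also have "\<dots> = B 0 \<omega> powr s" using B0[of 0 \<omega>] by (simp add: powr_diff)
    also have "\<dots> \<le> B 0 \<omega> powr s / s" using s by (simp add: divide_simps mult_left_le)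
    finally show ?case by simp
  next
    case (Suc k)
    have "B k \<omega> powr s \<le> B (Suc k) \<omega> powr s + s * B (Suc k) \<omega> powr (s - 1) * (B k \<omega> - B (Suc k) \<omega>)"
      using B0 s by (intro powr_le_tangent_at) (auto intro: less_imp_le)
    hence "B (Suc k) \<omega> powr (s - 1) * a k \<omega> \<le> B (Suc k) \<omega> powr s / s - B k \<omega> powr s / s"
      using s by (simp add: BS field_simps)
    with Suc show ?case by simp
  qed
  have "(\<integral>\<^sup>+\<omega>. ennreal (Y n \<omega> powr s) \<partial>M) \<le>
     (\<integral>\<^sup>+\<omega>. ennreal (B n \<omega> powr (s - 1)) * ennreal (Y n \<omega>) + ennreal (B n \<omega> powr s) \<partial>M)"
  proof (rule nn_integral_mono)
    fix \<omega>
    \<comment> \<open>The tangent at \<open>B n\<close> splits the power of \<open>Y n\<close> into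
      a weighted first moment, which the recursion controls, and a power of \<open>B n\<close>
      alone.\<close>
    have "Y n \<omega> powr s \<le> B n \<omega> powr s + s * B n \<omega> powr (s - 1) * (Y n \<omega> - B n \<omega>)"
      using B0 s Y by (intro powr_le_tangent_at) auto
    also have "\<dots> \<le> B n \<omega> powr s + s * B n \<omega> powr (s - 1) * Y n \<omega>"
      using B0[of n \<omega>] s by (intro add_left_mono mult_left_mono) auto
    also have "s * B n \<omega> powr (s - 1) * Y n \<omega> \<le> 1 * B n \<omega> powr (s - 1) * Y n \<omega>"
      using s Y(3) by (intro mult_right_mono) auto
    finally show "ennreal (Y n \<omega> powr s) \<le> ennreal (B n \<omega> powr (s - 1)) * ennreal (Y n \<omega>) + ennreal (B n \<omega> powr s)"
      using Y(3)[of n \<omega>] by (simp add: ennreal_mult[symmetric] ennreal_plus[symmetric] ennreal_leI add.commute del: ennreal_plus)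
  qed
  also have "\<dots> = (\<integral>\<^sup>+\<omega>. ennreal (B n \<omega> powr (s - 1)) * ennreal (Y n \<omega>) \<partial>M) + (\<integral>\<^sup>+\<omega>. ennreal (B n \<omega> powr s) \<partial>M)"
    by (rule nn_integral_add) auto
  also have "(\<integral>\<^sup>+\<omega>. ennreal (B n \<omega> powr (s - 1)) * ennreal (Y n \<omega>) \<partial>M) \<le> ennreal (c ^ n / s) * (\<integral>\<^sup>+\<omega>. ennreal (B n \<omega> powr s) \<partial>M)"
  proof -
    note growth
    also have "ennreal c ^ n *
     (\<integral>\<^sup>+\<omega>. ennreal (B 0 \<omega> powr (s - 1)) * ennreal (Y 0 \<omega>) + (\<Sum>l<n. ennreal (B (Suc l) \<omega> powr (s - 1)) * ennreal (a l \<omega>)) \<partial>M)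
     \<le> ennreal c ^ n * (\<integral>\<^sup>+\<omega>. ennreal (1 / s) * ennreal (B n \<omega> powr s) \<partial>M)"
    proof (intro mult_left_mono nn_integral_mono)
      fix \<omega>
      have "ennreal (B 0 \<omega> powr (s - 1)) * ennreal (Y 0 \<omega>) + (\<Sum>l<n. ennreal (B (Suc l) \<omega> powr (s - 1)) * ennreal (a l \<omega>))
         = ennreal (B 0 \<omega> powr (s - 1) * Y 0 \<omega> + (\<Sum>l<n. B (Suc l) \<omega> powr (s - 1) * a l \<omega>))"
        using Y(3) a(2) by (simp add: ennreal_mult sum_nonneg ennreal_plus sum_ennreal[symmetric])
      also have "\<dots> \<le> ennreal (B n \<omega> powr s / s)" by (intro ennreal_leI tele)
      finally show "ennreal (B 0 \<omega> powr (s - 1)) * ennreal (Y 0 \<omega>) + (\<Sum>l<n. ennreal (B (Suc l) \<omega> powr (s - 1)) * ennreal (a l \<omega>))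
        \<le> ennreal (1 / s) * ennreal (B n \<omega> powr s)"
        using s by (simp add: ennreal_mult'[symmetric])
    qed auto
    also have "\<dots> = ennreal (c ^ n / s) * (\<integral>\<^sup>+\<omega>. ennreal (B n \<omega> powr s) \<partial>M)"
      using c s by (subst nn_integral_cmult) (auto simp: ennreal_power mult.assoc[symmetric] ennreal_mult[symmetric])
    finally show ?thesis .
  qed
  also have "ennreal (c ^ n / s) * (\<integral>\<^sup>+\<omega>. ennreal (B n \<omega> powr s) \<partial>M) + (\<integral>\<^sup>+\<omega>. ennreal (B n \<omega> powr s) \<partial>M)
     = ennreal (c ^ n / s + 1) * (\<integral>\<^sup>+\<omega>. ennreal (B n \<omega> powr s) \<partial>M)"
    using c s by (subst ennreal_plus) (auto simp: distrib_right)
  finally show ?thesis by (simp add: B_def add_right_mono)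
qed

text \<open>With \<open>m\<close> the running maximum of a positive supermartingale \<open>S\<close>, the process
  \<open>m powr s + s / (1 - s) * S * m powr (s - 1)\<close> is again a supermartingale.\<close>

lemma running_max_powr:
  fixes S :: "nat \<Rightarrow> 'm \<Rightarrow> real" and s :: real
  assumes S: "\<And>i. i \<le> n \<Longrightarrow> S i \<in> borel_measurable (G i)" "\<And>i \<omega>. S i \<omega> > 0"
    and s: "0 < s" "s < 1"
    and step: "\<And>i v. i < n \<Longrightarrow> v \<in> borel_measurable (G i) \<Longrightarrow>
      (\<integral>\<^sup>+\<omega>. v \<omega> * ennreal (S (Suc i) \<omega>) \<partial>M) \<le> (\<integral>\<^sup>+\<omega>. v \<omega> * ennreal (S i \<omega>) \<partial>M)"
  shows "(\<integral>\<^sup>+\<omega>. ennreal (running_max S n \<omega> powr s) \<partial>M) \<le> ennreal (1 / (1 - s)) * (\<integral>\<^sup>+\<omega>. ennreal (S 0 \<omega> powr s) \<partial>M)"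
proof -
  let ?m = "running_max S" and ?k = "s / (1 - s)"
  have m0: "?m i \<omega> > 0" for i \<omega>
    using S(2)[of 0 \<omega>] running_max_ge[of 0 i S \<omega>] by simp
  have k0: "?k \<ge> 0" using s by simp
  define I where "I i = (\<integral>\<^sup>+\<omega>. ennreal (?m i \<omega> powr s) + ennreal (?k * ?m i \<omega> powr (s - 1)) * ennreal (S i \<omega>) \<partial>M)" for i
  have I_le: "I i \<le> I 0" if "i \<le> n" for i
    using that
  proof (induction i)
    case (Suc i)
    have i: "i < n" using Suc by simp
    have mG: "?m i \<in> borel_measurable (G i)" using S(1) i by (intro running_max_measurable) auto
    have [measurable]: "?m i \<in> borel_measurable M" "S i \<in> borel_measurable M" "S (Suc i) \<in> borel_measurable M"
      using G_M[OF mG] G_M[OF S(1)] i by auto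
    have "I (Suc i) \<le> (\<integral>\<^sup>+\<omega>. ennreal (?m i \<omega> powr s) + ennreal (?k * ?m i \<omega> powr (s - 1)) * ennreal (S (Suc i) \<omega>) \<partial>M)"
      unfolding I_def
    proof (rule nn_integral_mono)
      fix \<omega>
      let ?x = "S (Suc i) \<omega>" and ?y = "?m i \<omega>"
      \<comment> \<open>A pathwise fact: with the new value x held fixed, updating the maximum does
        not increase the functional. When x exceeds the old maximum y, this is the tangent
        inequality at y divided by 1 - s, which is what fixes the constant s / (1 - s).\<close>
      have "max ?y ?x powr s + ?k * max ?y ?x powr (s - 1) * ?x \<le> ?y powr s + ?k * ?y powr (s - 1) * ?x"
      proof (cases "?x \<le> ?y")
        case True then show ?thesis by (simp add: max_def)
      next
        case False
        have x: "?x > 0" by (rule S(2))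
        have "?x powr s \<le> ?y powr s + s * ?y powr (s - 1) * (?x - ?y)"
          using x m0[of i \<omega>] s by (intro powr_le_tangent_at) auto
        also have "\<dots> = (1 - s) * ?y powr s + s * ?y powr (s - 1) * ?x"
          using m0[of i \<omega>] by (simp add: powr_diff field_simps)
        finally have *: "?x powr s \<le> (1 - s) * ?y powr s + s * ?y powr (s - 1) * ?x" .
        have **: "?x powr s / (1 - s) \<le> ?y powr s + ?k * ?y powr (s - 1) * ?x"
        proof -
          have "(y + ?k * z * x) * (1 - s) = (1 - s) * y + (?k * (1 - s)) * z * x" for x y z :: real by algebra
          moreover have "?k * (1 - s) = s" using s by simp
          ultimately show ?thesis using * s by (simp add: pos_divide_le_eq)
        qed
        have "max ?y ?x powr s + ?k * max ?y ?x powr (s - 1) * ?x = ?x powr s + ?k * ?x powr s"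
          using False x by (simp add: powr_diff)
        also have "\<dots> = ?x powr s / (1 - s)" using s by (simp add: field_simps)
        finally show ?thesis using ** by simp
      qed
      then show "ennreal (?m (Suc i) \<omega> powr s) + ennreal (?k * ?m (Suc i) \<omega> powr (s - 1)) * ennreal ?x
         \<le> ennreal (?y powr s) + ennreal (?k * ?y powr (s - 1)) * ennreal ?x"
        using s S(2)[of "Suc i" \<omega>]
        by (simp add: ennreal_mult[symmetric] ennreal_plus[symmetric] ennreal_leI less_imp_le del: ennreal_plus)
    qed
    also have "\<dots> = (\<integral>\<^sup>+\<omega>. ennreal (?m i \<omega> powr s) \<partial>M) + (\<integral>\<^sup>+\<omega>. ennreal (?k * ?m i \<omega> powr (s - 1)) * ennreal (S (Suc i) \<omega>) \<partial>M)"
      by (rule nn_integral_add) auto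
    also have "\<dots> \<le> (\<integral>\<^sup>+\<omega>. ennreal (?m i \<omega> powr s) \<partial>M) + (\<integral>\<^sup>+\<omega>. ennreal (?k * ?m i \<omega> powr (s - 1)) * ennreal (S i \<omega>) \<partial>M)"
    proof (intro add_left_mono step i)
      show "(\<lambda>\<omega>. ennreal (?k * ?m i \<omega> powr (s - 1))) \<in> borel_measurable (G i)"
        using mG by measurable
    qed
    also have "\<dots> = I i"
      unfolding I_def by (rule nn_integral_add[symmetric]) auto
    finally show ?case using Suc by simp
  qed simp
  have [measurable]: "S 0 \<in> borel_measurable M" using S(1) by (auto intro: G_M)
  have "(\<integral>\<^sup>+\<omega>. ennreal (?m n \<omega> powr s) \<partial>M) \<le> I n"
    unfolding I_def by (intro nn_integral_mono) simp
  also have "\<dots> \<le> I 0" by (rule I_le) simp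
  also have "I 0 = (\<integral>\<^sup>+\<omega>. ennreal (1 / (1 - s)) * ennreal (S 0 \<omega> powr s) \<partial>M)"
    unfolding I_def
  proof (rule nn_integral_cong)
    fix \<omega>
    have "S 0 \<omega> powr s + ?k * S 0 \<omega> powr (s - 1) * S 0 \<omega> = 1 / (1 - s) * S 0 \<omega> powr s"
      using S(2)[of 0 \<omega>] s by (simp add: powr_diff field_simps)
    then show "ennreal (?m 0 \<omega> powr s) + ennreal (?k * ?m 0 \<omega> powr (s - 1)) * ennreal (S 0 \<omega>) = ennreal (1 / (1 - s)) * ennreal (S 0 \<omega> powr s)"
      using s S(2)[of 0 \<omega>]
      by (simp add: ennreal_mult[symmetric] ennreal_plus[symmetric] less_imp_le del: ennreal_plus)
  qed
  also have "\<dots> = ennreal (1 / (1 - s)) * (\<integral>\<^sup>+\<omega>. ennreal (S 0 \<omega> powr s) \<partial>M)"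
    by (rule nn_integral_cmult) simp
  finally show ?thesis .
qed

text \<open>Dividing by \<open>c ^ i\<close> yields a supermartingale. Undoing this inside the
  maximum costs \<open>(c ^ n) powr s\<close>, at most \<open>c ^ n\<close> because c \<ge> 1 and s
  < 1.\<close>

lemma running_max_powr_growth:
  fixes S :: "nat \<Rightarrow> 'm \<Rightarrow> real" and c s :: real
  assumes S: "\<And>i. i \<le> n \<Longrightarrow> S i \<in> borel_measurable (G i)" "\<And>i \<omega>. S i \<omega> > 0"
    and c: "c \<ge> 1" and s: "0 < s" "s < 1"
    and step: "\<And>i v. i < n \<Longrightarrow> v \<in> borel_measurable (G i) \<Longrightarrow>
      (\<integral>\<^sup>+\<omega>. v \<omega> * ennreal (S (Suc i) \<omega>) \<partial>M) \<le> ennreal c * (\<integral>\<^sup>+\<omega>. v \<omega> * ennreal (S i \<omega>) \<partial>M)"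
  shows "(\<integral>\<^sup>+\<omega>. ennreal (running_max S n \<omega> powr s) \<partial>M) \<le> ennreal (c ^ n / (1 - s)) * (\<integral>\<^sup>+\<omega>. ennreal (S 0 \<omega> powr s) \<partial>M)"
proof -
  define R where "R i \<omega> = S i \<omega> / c ^ i" for i \<omega>
  have c0: "c > 0" using c by simp
  have SM[measurable]: "S i \<in> borel_measurable M" if "i \<le> n" for i using S(1)[OF that] by (rule G_M)
  have main: "(\<integral>\<^sup>+\<omega>. ennreal (running_max R n \<omega> powr s) \<partial>M) \<le> ennreal (1 / (1 - s)) * (\<integral>\<^sup>+\<omega>. ennreal (R 0 \<omega> powr s) \<partial>M)"
  proof (rule running_max_powr)
    show "R i \<in> borel_measurable (G i)" if "i \<le> n" for i
      using S(1)[OF that] unfolding R_def[abs_def] by measurable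
    show "R i \<omega> > 0" for i \<omega> using S(2) c0 by (simp add: R_def)
    fix i and v :: "'m \<Rightarrow> ennreal" assume i: "i < n" and v: "v \<in> borel_measurable (G i)"
    have [measurable]: "v \<in> borel_measurable M" using v by (rule G_M)
    have [measurable]: "S i \<in> borel_measurable M" "S (Suc i) \<in> borel_measurable M" using SM i by auto
    have R: "ennreal (R j \<omega>) = ennreal (1 / c ^ j) * ennreal (S j \<omega>)" for j \<omega>
      using S(2)[of j \<omega>] c0 by (simp add: R_def ennreal_mult[symmetric])
    have "(\<integral>\<^sup>+\<omega>. v \<omega> * ennreal (R (Suc i) \<omega>) \<partial>M) = (\<integral>\<^sup>+\<omega>. ennreal (1 / c ^ Suc i) * (v \<omega> * ennreal (S (Suc i) \<omega>)) \<partial>M)"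
      by (simp only: R mult_ac)
    also have "\<dots> = ennreal (1 / c ^ Suc i) * (\<integral>\<^sup>+\<omega>. v \<omega> * ennreal (S (Suc i) \<omega>) \<partial>M)"
      by (rule nn_integral_cmult) measurable
    also have "\<dots> \<le> ennreal (1 / c ^ Suc i) * (ennreal c * (\<integral>\<^sup>+\<omega>. v \<omega> * ennreal (S i \<omega>) \<partial>M))"
      by (intro mult_left_mono step i v) auto
    also have "\<dots> = ennreal (1 / c ^ i) * (\<integral>\<^sup>+\<omega>. v \<omega> * ennreal (S i \<omega>) \<partial>M)"
      using c0 by (simp add: mult.assoc[symmetric] ennreal_mult[symmetric])
    also have "\<dots> = (\<integral>\<^sup>+\<omega>. ennreal (1 / c ^ i) * (v \<omega> * ennreal (S i \<omega>)) \<partial>M)"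
      by (rule nn_integral_cmult[symmetric]) measurable
    also have "\<dots> = (\<integral>\<^sup>+\<omega>. v \<omega> * ennreal (R i \<omega>) \<partial>M)"
      by (simp only: R mult_ac)
    finally show "(\<integral>\<^sup>+\<omega>. v \<omega> * ennreal (R (Suc i) \<omega>) \<partial>M) \<le> (\<integral>\<^sup>+\<omega>. v \<omega> * ennreal (R i \<omega>) \<partial>M)" .
  qed (use s in auto)
  have le: "running_max S n \<omega> powr s \<le> c ^ n * running_max R n \<omega> powr s" for \<omega>
  proof -
    obtain i where i: "i \<le> n" "running_max S n \<omega> = S i \<omega>" using running_max_attained by metis
    have "S i \<omega> = c ^ i * R i \<omega>" using c0 by (simp add: R_def)
    also have "\<dots> \<le> c ^ n * running_max R n \<omega>"
      using c0 c i(1) S(2)[of i \<omega>] by (intro mult_mono running_max_ge power_increasing) (auto simp: R_def)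
    finally have "running_max S n \<omega> powr s \<le> (c ^ n * running_max R n \<omega>) powr s"
      using S(2)[of i \<omega>] s i by (intro powr_mono2) auto
    moreover have "running_max R n \<omega> > 0"
      using running_max_ge[of 0 n R \<omega>] S(2)[of 0 \<omega>] by (simp add: R_def)
    moreover have "(c ^ n) powr s \<le> (c ^ n) powr 1" using c s by (intro powr_mono) (auto simp: one_le_power)
    ultimately show ?thesis using c0
      by (simp add: powr_mult) (meson mult_right_mono order_trans powr_ge_zero)
  qed
  have [measurable]: "R 0 \<in> borel_measurable M" "running_max R n \<in> borel_measurable M"
  proof -
    show "R 0 \<in> borel_measurable M" using SM[of 0] by (simp add: R_def[abs_def])
    have "running_max R n \<in> borel_measurable (G n)"
      by (rule running_max_measurable) (use S(1) in \<open>simp add: R_def[abs_def]\<close>)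
    then show "running_max R n \<in> borel_measurable M" by (rule G_M)
  qed
  have "(\<integral>\<^sup>+\<omega>. ennreal (running_max S n \<omega> powr s) \<partial>M) \<le> (\<integral>\<^sup>+\<omega>. ennreal (c ^ n) * ennreal (running_max R n \<omega> powr s) \<partial>M)"
    using le c0 by (intro nn_integral_mono) (simp add: ennreal_mult[symmetric] ennreal_leI)
  also have "\<dots> = ennreal (c ^ n) * (\<integral>\<^sup>+\<omega>. ennreal (running_max R n \<omega> powr s) \<partial>M)"
    by (rule nn_integral_cmult) measurable
  also have "\<dots> \<le> ennreal (c ^ n) * (ennreal (1 / (1 - s)) * (\<integral>\<^sup>+\<omega>. ennreal (R 0 \<omega> powr s) \<partial>M))"
    by (intro mult_left_mono main) auto
  also have "\<dots> = ennreal (c ^ n / (1 - s)) * (\<integral>\<^sup>+\<omega>. ennreal (S 0 \<omega> powr s) \<partial>M)"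
    using c0 s by (simp add: mult.assoc[symmetric] ennreal_mult[symmetric] R_def)
  finally show ?thesis .
qed

end

section \<open>Brownian increments\<close>

locale brownian =
  fixes M :: "'m measure" and F :: "real \<Rightarrow> 'm measure" and W :: "real \<Rightarrow> 'm \<Rightarrow> real"
  assumes BM: "brownian_motion M F W"
begin

sublocale prob_space M
  using BM by (simp add: brownian_motion_def)

lemma space_F: "space (F t) = space M" and sets_F: "sets (F t) \<subseteq> sets M"
  and sets_F_mono: "s \<le> t \<Longrightarrow> sets (F s) \<subseteq> sets (F t)"
  using BM by (auto simp: brownian_motion_def filtration_def)

lemma F_M: "X \<in> measurable (F t) N \<Longrightarrow> X \<in> measurable M N"
  using sets_F[of t] by (auto simp: measurable_def space_F)

lemma F_mono: "X \<in> measurable (F s) N \<Longrightarrow> s \<le> t \<Longrightarrow> X \<in> measurable (F t) N"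
  using sets_F_mono[of s t] by (auto simp: measurable_def space_F)

lemma W_measurable: "0 \<le> s \<Longrightarrow> s \<le> t \<Longrightarrow> W s \<in> borel_measurable (F t)"
  using BM by (auto simp: brownian_motion_def intro: F_mono)

lemma increment_measurable: "0 \<le> s \<Longrightarrow> s \<le> t \<Longrightarrow> (\<lambda>\<omega>. W t \<omega> - W s \<omega>) \<in> borel_measurable (F t)"
  by (intro borel_measurable_diff W_measurable) auto

lemma increment_measurable_M: "0 \<le> s \<Longrightarrow> s \<le> t \<Longrightarrow> (\<lambda>\<omega>. W t \<omega> - W s \<omega>) \<in> borel_measurable M"
  using increment_measurable F_M by blast

text \<open>The freezing lemma. The joint law of the sample point, seen through \<open>F s\<close>
  only, and of the increment is a product measure, so Tonelli integrates out the increment first.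
  Every later use of independence goes through this identity.\<close>

lemma increment_integral:
  assumes st: "0 \<le> s" "s < t" and \<phi>: "(\<lambda>(\<omega>, z). \<phi> \<omega> z) \<in> borel_measurable (F s \<Otimes>\<^sub>M borel)"
  shows "(\<integral>\<^sup>+\<omega>. \<phi> \<omega> (W t \<omega> - W s \<omega>) \<partial>M) = (\<integral>\<^sup>+\<omega>. (\<integral>\<^sup>+z. \<phi> \<omega> z \<partial>gaussian (t - s)) \<partial>M)"
proof -
  let ?D = "\<lambda>\<omega>. W t \<omega> - W s \<omega>"
  \<comment> \<open>The identity, regarded as a random element of the space with the
    \<sigma>-algebra \<open>F s\<close>, encodes all information at time s at once.\<close>
  have id: "(\<lambda>\<omega>. \<omega>) \<in> measurable M (F s)" using F_M[of "\<lambda>\<omega>. \<omega>" s "F s"] by simp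
  have D: "?D \<in> borel_measurable M" using st by (intro increment_measurable_M) auto
  have dist: "distributed M lborel ?D (normal_density 0 (sqrt (t - s)))"
    and ind: "indep_set (sets (F s)) (sigma_sets (space M) {?D -` A \<inter> space M | A. A \<in> sets borel})"
    using BM st unfolding brownian_motion_def by blast+
  interpret D: prob_space "distr M borel ?D" using D by (rule prob_space_distr)
  interpret I: prob_space "distr M (F s) (\<lambda>\<omega>. \<omega>)" using id by (rule prob_space_distr)
  have prod: "distr M (F s) (\<lambda>\<omega>. \<omega>) \<Otimes>\<^sub>M distr M borel ?D = distr M (F s \<Otimes>\<^sub>M borel) (\<lambda>\<omega>. (\<omega>, ?D \<omega>))"
  proof (rule pair_measure_eqI)
    show "sigma_finite_measure (distr M (F s) (\<lambda>\<omega>. \<omega>))" "sigma_finite_measure (distr M borel ?D)"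
      by unfold_locales
    show "sets (distr M (F s) (\<lambda>\<omega>. \<omega>) \<Otimes>\<^sub>M distr M borel ?D) = sets (distr M (F s \<Otimes>\<^sub>M borel) (\<lambda>\<omega>. (\<omega>, ?D \<omega>)))"
      by (simp cong: sets_pair_measure_cong)
    fix A B assume "A \<in> sets (distr M (F s) (\<lambda>\<omega>. \<omega>))" "B \<in> sets (distr M borel ?D)"
    then have A: "A \<in> sets (F s)" and B: "B \<in> sets borel" by auto
    have AM: "A \<inter> space M = A" using sets.sets_into_space[OF A] space_F by auto
    have "?D -` B \<inter> space M \<in> sigma_sets (space M) {?D -` A \<inter> space M | A. A \<in> sets borel}"
      using B by (intro sigma_sets.Basic) auto
    then have "prob (A \<inter> (?D -` B \<inter> space M)) = prob A * prob (?D -` B \<inter> space M)"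
      using ind A unfolding indep_sets2_eq by blast
    moreover have "(\<lambda>\<omega>. (\<omega>, ?D \<omega>)) -` (A \<times> B) \<inter> space M = A \<inter> (?D -` B \<inter> space M)" using AM by auto
    moreover have "(\<lambda>\<omega>. \<omega>) -` A \<inter> space M = A" using AM by (simp add: vimage_def)
    ultimately show "emeasure (distr M (F s) (\<lambda>\<omega>. \<omega>)) A * emeasure (distr M borel ?D) B
        = emeasure (distr M (F s \<Otimes>\<^sub>M borel) (\<lambda>\<omega>. (\<omega>, ?D \<omega>))) (A \<times> B)"
      using A B id D by (simp add: emeasure_distr emeasure_eq_measure ennreal_mult'[symmetric])
  qed
  have dD: "distr M borel ?D = gaussian (t - s)"
  proof -
    have "distr M borel ?D = distr M lborel ?D" by (rule distr_cong) auto
    then show ?thesis using dist by (simp add: distributed_def)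
  qed
  have "(\<integral>\<^sup>+\<omega>. \<phi> \<omega> (?D \<omega>) \<partial>M) = (\<integral>\<^sup>+x. (case x of (\<omega>, z) \<Rightarrow> \<phi> \<omega> z) \<partial>distr M (F s \<Otimes>\<^sub>M borel) (\<lambda>\<omega>. (\<omega>, ?D \<omega>)))"
    using id D \<phi> by (subst nn_integral_distr) auto
  also have "\<dots> = (\<integral>\<^sup>+\<omega>. (\<integral>\<^sup>+z. \<phi> \<omega> z \<partial>distr M borel ?D) \<partial>distr M (F s) (\<lambda>\<omega>. \<omega>))"
  proof -
    have m: "(\<lambda>(\<omega>, z). \<phi> \<omega> z) \<in> borel_measurable (distr M (F s) (\<lambda>\<omega>. \<omega>) \<Otimes>\<^sub>M distr M borel ?D)"
      using \<phi> by (simp cong: measurable_cong_sets sets_pair_measure_cong)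
    show ?thesis unfolding prod[symmetric] using D.nn_integral_fst[OF m] by simp
  qed
  also have "\<dots> = (\<integral>\<^sup>+\<omega>. (\<integral>\<^sup>+z. \<phi> \<omega> z \<partial>distr M borel ?D) \<partial>M)"
  proof (rule nn_integral_distr[OF id])
    have m: "(\<lambda>(\<omega>, z). \<phi> \<omega> z) \<in> borel_measurable (F s \<Otimes>\<^sub>M distr M borel ?D)"
      using \<phi> by (simp cong: measurable_cong_sets sets_pair_measure_cong)
    have "(\<lambda>\<omega>. \<integral>\<^sup>+z. \<phi> \<omega> z \<partial>distr M borel ?D) \<in> borel_measurable (F s)"
      by (rule D.borel_measurable_nn_integral[OF m])
    then show "(\<lambda>\<omega>. \<integral>\<^sup>+z. \<phi> \<omega> z \<partial>distr M borel ?D) \<in> borel_measurable (distr M (F s) (\<lambda>\<omega>. \<omega>))"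
      by simp
  qed
  finally show ?thesis unfolding dD .
qed

lemma increment_second_moment:
  fixes u v :: "'m \<Rightarrow> 'a::euclidean_space" and w :: "'m \<Rightarrow> ennreal"
  assumes st: "0 \<le> s" "s < t" and m[measurable]: "u \<in> borel_measurable (F s)" "v \<in> borel_measurable (F s)"
    "w \<in> borel_measurable (F s)"
  shows "(\<integral>\<^sup>+\<omega>. w \<omega> * ennreal ((norm (u \<omega> + (W t \<omega> - W s \<omega>) *\<^sub>R v \<omega>))\<^sup>2) \<partial>M)
     = (\<integral>\<^sup>+\<omega>. w \<omega> * ennreal ((norm (u \<omega>))\<^sup>2 + (t - s) * (norm (v \<omega>))\<^sup>2) \<partial>M)"
proof -
  have "(\<integral>\<^sup>+\<omega>. w \<omega> * ennreal ((norm (u \<omega> + (W t \<omega> - W s \<omega>) *\<^sub>R v \<omega>))\<^sup>2) \<partial>M)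
     = (\<integral>\<^sup>+\<omega>. (\<integral>\<^sup>+z. w \<omega> * ennreal ((norm (u \<omega> + z *\<^sub>R v \<omega>))\<^sup>2) \<partial>gaussian (t - s)) \<partial>M)"
    by (rule increment_integral[OF st]) measurable
  also have "\<dots> = (\<integral>\<^sup>+\<omega>. w \<omega> * ennreal ((norm (u \<omega>))\<^sup>2 + (t - s) * (norm (v \<omega>))\<^sup>2) \<partial>M)"
    using st by (intro nn_integral_cong) (simp add: nn_integral_cmult gaussian_second_moment)
  finally show ?thesis .
qed

lemma increment_powr_dissipative:
  fixes u v :: "'m \<Rightarrow> 'a::euclidean_space" and c b l r :: real and \<kappa> :: "'m \<Rightarrow> real"
  assumes st: "0 \<le> s" "s < t" and m[measurable]: "u \<in> borel_measurable (F s)" "v \<in> borel_measurable (F s)"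
    and r: "0 < r" "r < 1" and l: "l \<ge> 3" and c: "c \<ge> 0" and b: "l * (t - s) \<le> b"
    and \<kappa>: "\<And>\<omega>. c + (norm (u \<omega>))\<^sup>2 + b * (norm (v \<omega>))\<^sup>2 > 0 \<Longrightarrow>
       (1 - l) * (norm (v \<omega>))\<^sup>2 / (c + (norm (u \<omega>))\<^sup>2 + b * (norm (v \<omega>))\<^sup>2)
       - 2 * (u \<omega> \<bullet> v \<omega>)\<^sup>2 / (c + (norm (u \<omega>))\<^sup>2 + b * (norm (v \<omega>))\<^sup>2)\<^sup>2 \<le> \<kappa> \<omega>"
  shows "(\<integral>\<^sup>+\<omega>. ennreal ((c + (norm (u \<omega> + (W t \<omega> - W s \<omega>) *\<^sub>R v \<omega>))\<^sup>2) powr r) \<partial>M)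
     \<le> (\<integral>\<^sup>+\<omega>. ennreal ((c + (norm (u \<omega>))\<^sup>2 + l * (t - s) * (norm (v \<omega>))\<^sup>2) powr r
          * (1 + r * (t - s) * ((1 - r) * \<kappa> \<omega>))) \<partial>M)"
proof -
  have "(\<integral>\<^sup>+\<omega>. ennreal ((c + (norm (u \<omega> + (W t \<omega> - W s \<omega>) *\<^sub>R v \<omega>))\<^sup>2) powr r) \<partial>M)
     = (\<integral>\<^sup>+\<omega>. (\<integral>\<^sup>+z. ennreal ((c + (norm (u \<omega> + z *\<^sub>R v \<omega>))\<^sup>2) powr r) \<partial>gaussian (t - s)) \<partial>M)"
    by (rule increment_integral[OF st]) measurable
  also have "\<dots> \<le> (\<integral>\<^sup>+\<omega>. ennreal ((c + (norm (u \<omega>))\<^sup>2 + l * (t - s) * (norm (v \<omega>))\<^sup>2) powr r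
          * (1 + r * (t - s) * ((1 - r) * \<kappa> \<omega>))) \<partial>M)"
    using st by (intro nn_integral_mono gaussian_powr_dissipative[OF _ r l c b refl refl \<kappa>]) auto
  finally show ?thesis .
qed

end

section \<open>The implicit map and its energy estimates\<close>

text \<open>The growth exponent is a natural number, so that weights multiply and split as ordinary
  powers. (A1) is brought to this form by rounding q up, with \<open>K = 3 * L1\<close>.\<close>

locale bem_coefficients =
  fixes f g :: "'a::euclidean_space \<Rightarrow> 'a" and K c1 c2 c3 l1 l2 :: real and d :: nat
  assumes f_lip: "norm (f x - f y) \<le> K * (1 + norm x + norm y) ^ d * norm (x - y)"
    and pos: "K > 0" "c1 > 0" "c2 > 0" "c3 > 0" "l1 \<ge> 3" "l2 \<ge> 3"
    and coercive: "2 * (x \<bullet> f x) + l1 * (norm (g x))\<^sup>2 \<le> c1 * (norm x)\<^sup>2 + c2"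
    and monotone: "2 * ((x - y) \<bullet> (f x - f y)) + l2 * (norm (g x - g y))\<^sup>2 \<le> c3 * (norm (x - y))\<^sup>2"
begin

text \<open>A sum, so that one constant serves as Lipschitz factor for f (through K) and for g
  (through the square root) and still leaves room for the values at 0 in the growth bounds.\<close>

definition L :: real where "L = norm (f 0) + norm (g 0) + K + sqrt (c3 + 2 * K)"

lemma L_pos: "L > 0" and K_le_L: "K \<le> L" and sqrt_le_L: "sqrt (c3 + 2 * K) \<le> L"
  using pos by (auto simp: L_def add_nonneg_pos add_pos_nonneg)

lemma one_le_weight: "1 \<le> (1 + norm x + norm y) ^ n"
  by (rule one_le_power) (auto simp: add.assoc)

lemma f_lipschitz: "norm (f x - f y) \<le> L * (1 + norm x + norm y) ^ d * norm (x - y)"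
  by (rule order_trans[OF f_lip]) (intro mult_right_mono K_le_L, auto)

text \<open>Monotonicity bounds \<open>l2 * (norm (g x - g y))\<^sup>2\<close> by a multiple of |x -
  y|^2 plus an inner product with f x - f y, so regularity of g is inherited from f by
  Cauchy-Schwarz. The weight arises under a square root and is enlarged to the one of f, being at
  least 1.\<close>

lemma g_lipschitz: "norm (g x - g y) \<le> L * (1 + norm x + norm y) ^ d * norm (x - y)"
proof -
  let ?w = "(1 + norm x + norm y) ^ d" and ?e = "norm (x - y)"
  have m: "l2 * (norm (g x - g y))\<^sup>2 \<le> c3 * ?e\<^sup>2 - 2 * ((x - y) \<bullet> (f x - f y))" using monotone[of x y] by simp
  have cs: "- ((x - y) \<bullet> (f x - f y)) \<le> ?e * norm (f x - f y)"
    using Cauchy_Schwarz_ineq2[of "x - y" "f x - f y"] by linarith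
  have "?e * norm (f x - f y) \<le> ?e * (K * ?w * ?e)" by (intro mult_left_mono f_lip) auto
  with m cs have "l2 * (norm (g x - g y))\<^sup>2 \<le> c3 * ?e\<^sup>2 + 2 * (?e * (K * ?w * ?e))" by linarith
  also have "\<dots> = (c3 * 1 + 2 * K * ?w) * ?e\<^sup>2" by (simp add: power2_eq_square algebra_simps)
  also have "\<dots> \<le> ((c3 + 2 * K) * ?w\<^sup>2) * ?e\<^sup>2"
  proof (intro mult_right_mono)
    have "1 \<le> ?w\<^sup>2" "?w \<le> ?w\<^sup>2" using one_le_weight[of x y d] by (auto intro: one_le_power self_le_power)
    then have "c3 * 1 + 2 * K * ?w \<le> c3 * ?w\<^sup>2 + 2 * K * ?w\<^sup>2" using pos by (intro add_mono mult_left_mono) auto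
    then show "c3 * 1 + 2 * K * ?w \<le> (c3 + 2 * K) * ?w\<^sup>2" by (simp add: algebra_simps)
  qed auto
  finally have *: "l2 * (norm (g x - g y))\<^sup>2 \<le> (c3 + 2 * K) * ?w\<^sup>2 * ?e\<^sup>2" .
  have "1 * (norm (g x - g y))\<^sup>2 \<le> l2 * (norm (g x - g y))\<^sup>2" using pos by (intro mult_right_mono) auto
  with * have "(norm (g x - g y))\<^sup>2 \<le> (c3 + 2 * K) * ?w\<^sup>2 * ?e\<^sup>2" by linarith
  also have "\<dots> = (sqrt (c3 + 2 * K) * ?w * ?e)\<^sup>2" using pos by (simp add: power_mult_distrib)
  finally have "norm (g x - g y) \<le> sqrt (c3 + 2 * K) * ?w * ?e"
    using pos by (elim power2_le_imp_le) auto
  also have "\<dots> \<le> L * ?w * ?e" using sqrt_le_L by (intro mult_right_mono) auto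
  finally show ?thesis .
qed

lemma growth_aux:
  fixes \<phi> :: "'a \<Rightarrow> 'a"
  assumes "\<And>x y. norm (\<phi> x - \<phi> y) \<le> (L - norm (\<phi> 0)) * (1 + norm x + norm y) ^ d * norm (x - y)" "L \<ge> norm (\<phi> 0)"
  shows "norm (\<phi> x) \<le> L * (1 + norm x) ^ Suc d"
proof -
  have "norm (\<phi> x) \<le> norm (\<phi> 0) + norm (\<phi> x - \<phi> 0)" by (metis add.commute diff_add_cancel norm_triangle_ineq)
  also have "\<dots> \<le> norm (\<phi> 0) * 1 + (L - norm (\<phi> 0)) * ((1 + norm x) ^ d * norm x)"
    using assms(1)[of x 0] by (simp add: mult.assoc)
  also have "\<dots> \<le> norm (\<phi> 0) * (1 + norm x) ^ Suc d + (L - norm (\<phi> 0)) * (1 + norm x) ^ Suc d"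
  proof (intro add_mono mult_left_mono)
    show "1 \<le> (1 + norm x) ^ Suc d" by (rule one_le_power) simp
    have "norm x \<le> 1 + norm x" by simp
    then show "(1 + norm x) ^ d * norm x \<le> (1 + norm x) ^ Suc d"
      by (metis mult_left_mono power_Suc2 zero_le_power add_nonneg_nonneg norm_ge_zero zero_le_one)
  qed (use assms(2) in auto)
  finally show ?thesis by (simp add: algebra_simps)
qed

lemma f_growth: "norm (f x) \<le> L * (1 + norm x) ^ Suc d"
proof (rule growth_aux)
  fix x y
  show "norm (f x - f y) \<le> (L - norm (f 0)) * (1 + norm x + norm y) ^ d * norm (x - y)"
    by (rule order_trans[OF f_lip]) (intro mult_right_mono, use pos in \<open>auto simp: L_def\<close>)
qed (use pos in \<open>auto simp: L_def\<close>)

lemma g_growth: "norm (g x) \<le> L * (1 + norm x) ^ Suc d"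
proof -
  have "norm (g x) \<le> norm (g 0) + norm (g x - g 0)" by (metis add.commute diff_add_cancel norm_triangle_ineq)
  moreover have "norm (g x - g 0) \<le> L * (1 + norm x) ^ d * norm x" using g_lipschitz[of x 0] by simp
  moreover have "norm (g 0) \<le> L" using pos by (auto simp: L_def)
  moreover have "L * 1 \<le> L * (1 + norm x) ^ d" using L_pos by (intro mult_left_mono one_le_power) auto
  ultimately have "norm (g x) \<le> L * (1 + norm x) ^ d + L * (1 + norm x) ^ d * norm x" by linarith
  then show ?thesis by (simp add: algebra_simps)
qed

lemma continuous_if_locally_lipschitz:
  fixes \<phi> :: "'a \<Rightarrow> 'a"
  assumes lip: "\<And>x y. norm (\<phi> x - \<phi> y) \<le> L * (1 + norm x + norm y) ^ d * norm (x - y)"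
  shows "continuous_on UNIV \<phi>"
  unfolding continuous_on_eq_continuous_at[OF open_UNIV] isCont_def
proof
  fix x :: 'a
  have "((\<lambda>y. L * (1 + norm y + norm x) ^ d * norm (y - x)) \<longlongrightarrow> L * (1 + norm x + norm x) ^ d * norm (x - x)) (at x)"
    by (intro tendsto_intros)
  then have "((\<lambda>y. L * (1 + norm y + norm x) ^ d * norm (y - x)) \<longlongrightarrow> 0) (at x)" by simp
  then have "((\<lambda>y. \<phi> y - \<phi> x) \<longlongrightarrow> 0) (at x)"
    by (rule Lim_null_comparison[rotated]) (auto intro!: always_eventually lip)
  then show "\<phi> \<midarrow>x\<rightarrow> \<phi> x" by (rule LIM_zero_cancel)
qed

lemma f_cont: "continuous_on UNIV f" and g_cont: "continuous_on UNIV g"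
  by (rule continuous_if_locally_lipschitz, rule f_lipschitz) (rule continuous_if_locally_lipschitz, rule g_lipschitz)

lemma f_borel[measurable]: "f \<in> borel_measurable borel" and g_borel[measurable]: "g \<in> borel_measurable borel"
  by (simp_all add: borel_measurable_continuous_onI f_cont g_cont)

text \<open>The last two conditions keep \<open>1 - c1 * \<tau>\<close> and
  \<open>1 - c3 * \<tau>\<close> at least 1/2; this serves both to solve the implicit equation and
  to bound the factors lost in doing so.\<close>

definition small :: "real \<Rightarrow> bool" where
  "small \<tau> \<longleftrightarrow> 0 < \<tau> \<and> \<tau> \<le> 1 \<and> 2 * c1 * \<tau> \<le> 1 \<and> 2 * c3 * \<tau> \<le> 1"

lemma small_mono: "small h \<Longrightarrow> 0 < \<tau> \<Longrightarrow> \<tau> \<le> h \<Longrightarrow> small \<tau>"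
  using pos mult_left_mono[of \<tau> h "2 * c1"] mult_left_mono[of \<tau> h "2 * c3"] unfolding small_def by linarith

text \<open>Expand the square and drop \<open>\<tau>\<^sup>2 * (norm (f x - f y))\<^sup>2\<close>;
  the cross term is monotonicity. The diffusion surplus with factor l2 is kept on purpose: it
  rebuilds \<open>gap\<close> at the end of the step.\<close>

lemma implicit_expansive:
  assumes "\<tau> \<ge> 0"
  shows "(1 - c3 * \<tau>) * (norm (x - y))\<^sup>2 + l2 * \<tau> * (norm (g x - g y))\<^sup>2 \<le> (norm ((x - \<tau> *\<^sub>R f x) - (y - \<tau> *\<^sub>R f y)))\<^sup>2"
proof -
  have "(norm ((x - \<tau> *\<^sub>R f x) - (y - \<tau> *\<^sub>R f y)))\<^sup>2 = (norm ((x - y) - \<tau> *\<^sub>R (f x - f y)))\<^sup>2"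
    by (simp add: algebra_simps)
  also have "\<dots> = (norm (x - y))\<^sup>2 - \<tau> * (2 * ((x - y) \<bullet> (f x - f y))) + \<tau>\<^sup>2 * (norm (f x - f y))\<^sup>2"
    by (simp only: power2_norm_eq_inner) (simp add: inner_diff_left inner_diff_right inner_commute algebra_simps power2_eq_square)
  also have "\<dots> \<ge> (norm (x - y))\<^sup>2 - \<tau> * (c3 * (norm (x - y))\<^sup>2 - l2 * (norm (g x - g y))\<^sup>2)"
    using monotone[of x y] assms
    by (smt (verit) mult_left_mono mult_nonneg_nonneg zero_le_power2)
  finally show ?thesis by (simp add: algebra_simps)
qed

lemma implicit_coercive:
  assumes "\<tau> \<ge> 0"
  shows "(1 - c1 * \<tau>) * (norm x)\<^sup>2 + l1 * \<tau> * (norm (g x))\<^sup>2 - c2 * \<tau> \<le> (norm (x - \<tau> *\<^sub>R f x))\<^sup>2"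
proof -
  have "(norm (x - \<tau> *\<^sub>R f x))\<^sup>2 = (norm x)\<^sup>2 - \<tau> * (2 * (x \<bullet> f x)) + \<tau>\<^sup>2 * (norm (f x))\<^sup>2"
    by (simp only: power2_norm_eq_inner) (simp add: inner_diff_left inner_diff_right inner_commute algebra_simps power2_eq_square)
  also have "\<dots> \<ge> (norm x)\<^sup>2 - \<tau> * (c1 * (norm x)\<^sup>2 + c2 - l1 * (norm (g x))\<^sup>2)"
    using coercive[of x] assms
    by (smt (verit) mult_left_mono mult_nonneg_nonneg zero_le_power2)
  finally show ?thesis by (simp add: algebra_simps)
qed

lemma implicit_dist:
  assumes "small \<tau>"
  shows "dist x y \<le> 2 * dist (x - \<tau> *\<^sub>R f x) (y - \<tau> *\<^sub>R f y)"
proof -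
  have s: "\<tau> > 0" "2 * c3 * \<tau> \<le> 1" using assms by (auto simp: small_def)
  have "1/2 * (dist x y)\<^sup>2 \<le> (1 - c3 * \<tau>) * (dist x y)\<^sup>2" using s by (intro mult_right_mono) auto
  also have "\<dots> \<le> (dist (x - \<tau> *\<^sub>R f x) (y - \<tau> *\<^sub>R f y))\<^sup>2"
    using implicit_expansive[of \<tau> x y] s pos unfolding dist_norm
    by (smt (verit) mult_nonneg_nonneg zero_le_power2)
  finally have "1/2 * (dist x y)\<^sup>2 \<le> (dist (x - \<tau> *\<^sub>R f x) (y - \<tau> *\<^sub>R f y))\<^sup>2" .
  then have "(dist x y)\<^sup>2 \<le> 4 * (dist (x - \<tau> *\<^sub>R f x) (y - \<tau> *\<^sub>R f y))\<^sup>2"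
    using zero_le_power2[of "dist (x - \<tau> *\<^sub>R f x) (y - \<tau> *\<^sub>R f y)"] by linarith
  also have "\<dots> = (2 * dist (x - \<tau> *\<^sub>R f x) (y - \<tau> *\<^sub>R f y))\<^sup>2" by (simp add: power_mult_distrib)
  finally have "(dist x y)\<^sup>2 \<le> (2 * dist (x - \<tau> *\<^sub>R f x) (y - \<tau> *\<^sub>R f y))\<^sup>2" .
  then show ?thesis by (rule power2_le_imp_le) simp
qed

text \<open>The implicit map is expansive, hence injective with closed range; its range is open by invariance of domain.\<close>

lemma implicit_bij:
  assumes "small \<tau>"
  shows "bij (\<lambda>y. y - \<tau> *\<^sub>R f y)"
proof -
  let ?A = "\<lambda>y. y - \<tau> *\<^sub>R f y"
  note d = implicit_dist[OF assms]
  have inj: "inj ?A" by (rule injI) (use d in \<open>metis dist_eq_0_iff dist_le_zero_iff mult_zero_right\<close>)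
  have cont: "continuous_on UNIV ?A" by (intro continuous_intros f_cont)
  have "open (range ?A)" using cont inj by (intro invariance_of_domain) auto
  moreover have "closed (range ?A)"
    unfolding closed_sequential_limits
  proof (intro allI impI)
    fix b l assume b: "(\<forall>n. b n \<in> range ?A) \<and> b \<longlonglongrightarrow> l"
    then have "\<forall>n. \<exists>a. b n = ?A a" by blast
    then obtain a where a: "\<And>n. b n = ?A (a n)" using choice[of "\<lambda>n a. b n = ?A a"] by blast
    have "Cauchy a"
    proof (rule metric_CauchyI)
      fix e :: real assume "e > 0"
      then obtain N where N: "\<And>m n. m \<ge> N \<Longrightarrow> n \<ge> N \<Longrightarrow> dist (b m) (b n) < e / 2"
        using b LIMSEQ_imp_Cauchy[of b l] metric_CauchyD[of b "e / 2"] by auto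
      show "\<exists>N. \<forall>m\<ge>N. \<forall>n\<ge>N. dist (a m) (a n) < e"
      proof (intro exI allI impI)
        fix m n assume "m \<ge> N" "n \<ge> N"
        then show "dist (a m) (a n) < e" using N[of m n] d[of "a m" "a n"] unfolding a by linarith
      qed
    qed
    then obtain a' where "a \<longlonglongrightarrow> a'" by (metis Cauchy_convergent convergent_def)
    then have "(\<lambda>n. ?A (a n)) \<longlonglongrightarrow> ?A a'"
      using cont continuous_on_tendsto_compose[of UNIV ?A a a'] by simp
    then have "b \<longlonglongrightarrow> ?A a'" by (simp add: a[abs_def, symmetric])
    then have "l = ?A a'" using b LIMSEQ_unique by blast
    then show "l \<in> range ?A" by simp
  qed
  ultimately have "range ?A = UNIV" using clopen[of "range ?A"] by auto
  with inj show ?thesis by (simp add: bij_def)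
qed

definition resolvent :: "real \<Rightarrow> 'a \<Rightarrow> 'a" where
  "resolvent \<tau> = inv (\<lambda>y. y - \<tau> *\<^sub>R f y)"

lemma resolvent_iff: "small \<tau> \<Longrightarrow> y - \<tau> *\<^sub>R f y = z \<longleftrightarrow> y = resolvent \<tau> z"
  unfolding resolvent_def using implicit_bij[of \<tau>]
  by (metis (no_types, lifting) bij_inv_eq_iff)

text \<open>Expansivity makes the resolvent 2-Lipschitz. Adaptedness of the scheme rests on this,
  since the recursion gives each new state only through an equation.\<close>

lemma resolvent_borel[measurable]:
  assumes "small \<tau>" shows "resolvent \<tau> \<in> borel_measurable borel"
proof (rule borel_measurable_continuous_onI)
  have "dist (resolvent \<tau> x) (resolvent \<tau> y) \<le> 2 * dist x y" for x y
    using implicit_dist[OF assms, of "resolvent \<tau> x" "resolvent \<tau> y"] resolvent_iff[OF assms] by metis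
  then have "2-lipschitz_on UNIV (resolvent \<tau>)" by (intro lipschitz_onI) auto
  then show "continuous_on UNIV (resolvent \<tau>)" by (rule lipschitz_on_continuous_on)
qed

text \<open>The value of V in the Gaussian step for \<open>c = D\<close>, \<open>u = y\<close>,
  \<open>v = g y\<close>. Likewise \<open>gap\<close> is V for c = 0 and the differences of two
  states and of their diffusion coefficients.\<close>

definition Lyap :: "real \<Rightarrow> real \<Rightarrow> 'a \<Rightarrow> real" where
  "Lyap D \<tau> y = D + (norm y)\<^sup>2 + l1 * \<tau> * (norm (g y))\<^sup>2"

definition gap :: "real \<Rightarrow> 'a \<Rightarrow> 'a \<Rightarrow> real" where
  "gap \<tau> x y = (norm (x - y))\<^sup>2 + l2 * \<tau> * (norm (g x - g y))\<^sup>2"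

text \<open>The factor \<open>1 - c1 * \<tau>\<close> stems from the |y|^2 part. Pulling it out of
  the whole functional is harmless, as it is at most 1, and allows a power to be taken of a single
  product.\<close>

lemma Lyap_implicit:
  assumes \<tau>: "small \<tau>" and D: "D \<ge> 0"
  shows "(1 - c1 * \<tau>) * Lyap D \<tau> y \<le> D + c2 * \<tau> + (norm (y - \<tau> *\<^sub>R f y))\<^sup>2"
proof -
  have t: "0 < \<tau>" "c1 * \<tau> \<ge> 0" using \<tau> pos by (auto simp: small_def)
  have "(1 - c1 * \<tau>) * D + (1 - c1 * \<tau>) * (l1 * \<tau> * (norm (g y))\<^sup>2) \<le> D + l1 * \<tau> * (norm (g y))\<^sup>2"
    using t D pos by (intro add_mono mult_left_le_one_le mult_nonneg_nonneg) (use \<tau> in \<open>auto simp: small_def\<close>)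
  moreover have "(1 - c1 * \<tau>) * (norm y)\<^sup>2 + l1 * \<tau> * (norm (g y))\<^sup>2 - c2 * \<tau> \<le> (norm (y - \<tau> *\<^sub>R f y))\<^sup>2"
    using t by (intro implicit_coercive) auto
  moreover have "(1 - c1 * \<tau>) * Lyap D \<tau> y = (1 - c1 * \<tau>) * D + (1 - c1 * \<tau>) * (l1 * \<tau> * (norm (g y))\<^sup>2) + (1 - c1 * \<tau>) * (norm y)\<^sup>2"
    by (simp add: Lyap_def algebra_simps)
  ultimately show ?thesis by linarith
qed

lemma gap_implicit:
  assumes \<tau>: "small \<tau>"
  shows "(1 - c3 * \<tau>) * gap \<tau> x y \<le> (norm ((x - \<tau> *\<^sub>R f x) - (y - \<tau> *\<^sub>R f y)))\<^sup>2"
proof -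
  have t: "0 < \<tau>" "c3 * \<tau> \<ge> 0" using \<tau> pos by (auto simp: small_def)
  have "(1 - c3 * \<tau>) * (l2 * \<tau> * (norm (g x - g y))\<^sup>2) \<le> l2 * \<tau> * (norm (g x - g y))\<^sup>2"
    using t pos by (intro mult_left_le_one_le mult_nonneg_nonneg) (use \<tau> in \<open>auto simp: small_def\<close>)
  moreover have "(1 - c3 * \<tau>) * gap \<tau> x y = (1 - c3 * \<tau>) * (l2 * \<tau> * (norm (g x - g y))\<^sup>2) + (1 - c3 * \<tau>) * (norm (x - y))\<^sup>2"
    by (simp add: gap_def algebra_simps)
  ultimately show ?thesis using implicit_expansive[of \<tau> x y] t by linarith
qed

text \<open>The left side is the conditional mean of the next energy, since the implicit image of
  the next state is y plus the increment times g y. Coercivity alone thus limits the mean growth to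
  a factor 1 + O(\<tau>) per step.\<close>

lemma one_step_energy:
  assumes \<tau>: "small \<tau>"
  shows "1 + (norm y)\<^sup>2 + \<tau> * (norm (g y))\<^sup>2 \<le> (1 + 2 * (c1 + c2) * \<tau>) * (1 + (norm (y - \<tau> *\<^sub>R f y))\<^sup>2)"
proof -
  let ?z = "(norm (y - \<tau> *\<^sub>R f y))\<^sup>2"
  have t: "0 < \<tau>" "c1 * \<tau> \<ge> 0" "2 * c1 * \<tau> \<le> 1" using \<tau> pos by (auto simp: small_def)
  have "1 * (\<tau> * (norm (g y))\<^sup>2) \<le> l1 * (\<tau> * (norm (g y))\<^sup>2)"
    using pos t by (intro mult_right_mono) auto
  then have "(norm y)\<^sup>2 + \<tau> * (norm (g y))\<^sup>2 \<le> Lyap 0 \<tau> y"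
    by (simp add: Lyap_def mult.assoc)
  also have "\<dots> \<le> (1 + 2 * c1 * \<tau>) * (c2 * \<tau> + ?z)"
  proof -
    have "0 \<le> c1 * \<tau> * (1 - 2 * c1 * \<tau>)" using t pos by (intro mult_nonneg_nonneg) auto
    then have "1 \<le> (1 + 2 * c1 * \<tau>) * (1 - c1 * \<tau>)" by (simp add: algebra_simps power2_eq_square)
    moreover have "Lyap 0 \<tau> y \<ge> 0" using pos t by (simp add: Lyap_def)
    ultimately have "Lyap 0 \<tau> y \<le> (1 + 2 * c1 * \<tau>) * (1 - c1 * \<tau>) * Lyap 0 \<tau> y"
      by (metis mult_1 mult_right_mono)
    also have "\<dots> \<le> (1 + 2 * c1 * \<tau>) * (0 + c2 * \<tau> + ?z)"
      unfolding mult.assoc[of _ "1 - c1 * \<tau>"]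
      using t pos by (intro mult_left_mono) (use Lyap_implicit[OF \<tau>, of 0 y] in auto)
    finally show ?thesis by simp
  qed
  also have "\<dots> \<le> 2 * c2 * \<tau> + (1 + 2 * c1 * \<tau>) * ?z"
    using mult_right_mono[OF t(3), of "c2 * \<tau>"] pos t by (simp add: algebra_simps)
  finally have "1 + (norm y)\<^sup>2 + \<tau> * (norm (g y))\<^sup>2 \<le> 1 + 2 * c2 * \<tau> + (1 + 2 * c1 * \<tau>) * ?z" by simp
  also have "\<dots> \<le> (1 + 2 * (c1 + c2) * \<tau>) * (1 + ?z)"
  proof -
    have "(1 + 2 * (c1 + c2) * \<tau>) * (1 + ?z) - (1 + 2 * c2 * \<tau> + (1 + 2 * c1 * \<tau>) * ?z) = 2 * (c1 * \<tau>) + 2 * (c2 * \<tau> * ?z)"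
      by (simp add: algebra_simps)
    moreover have "0 \<le> c2 * \<tau> * ?z" using t pos by auto
    ultimately show ?thesis using t by linarith
  qed
  finally show ?thesis .
qed

text \<open>Leads from the energy back to the states, so that running maxima of the energy control
  every polynomial weight.\<close>

lemma norm_le_implicit:
  assumes \<tau>: "small \<tau>"
  shows "1 + norm y \<le> (3 + 2 * (c1 + c2)) * sqrt (1 + (norm (y - \<tau> *\<^sub>R f y))\<^sup>2)"
proof -
  let ?z = "1 + (norm (y - \<tau> *\<^sub>R f y))\<^sup>2" and ?c = "c1 + c2"
  have t: "0 < \<tau>" "\<tau> \<le> 1" using \<tau> pos by (auto simp: small_def)
  have "(norm y)\<^sup>2 \<le> 1 + (norm y)\<^sup>2 + \<tau> * (norm (g y))\<^sup>2" using t by simp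
  also have "\<dots> \<le> (1 + 2 * ?c * \<tau>) * ?z" by (rule one_step_energy[OF \<tau>])
  also have "\<dots> \<le> (1 + 2 * ?c * 1) * ?z"
    using t pos by (intro mult_right_mono add_left_mono mult_left_mono) auto
  also have "\<dots> \<le> (1 + 2 * ?c)\<^sup>2 * ?z"
    using pos by (intro mult_right_mono) (auto simp: power2_eq_square algebra_simps)
  also have "\<dots> = ((1 + 2 * ?c) * sqrt ?z)\<^sup>2" by (simp add: power_mult_distrib)
  finally have "norm y \<le> (1 + 2 * ?c) * sqrt ?z" using pos by (elim power2_le_imp_le) auto
  moreover have "1 \<le> sqrt ?z" by simp
  ultimately have "1 + norm y \<le> 2 * sqrt ?z + (1 + 2 * ?c) * sqrt ?z" by linarith
  then show ?thesis by (simp add: algebra_simps)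
qed

section \<open>Polynomial weights and the one-step error inequality\<close>

definition weight :: "'a \<Rightarrow> 'a \<Rightarrow> real" where
  "weight x y = (1 + norm x + norm y) ^ Suc d"

text \<open>The first part pays for passing from A - B to e, the second for the term
  \<open>\<tau>\<^sup>2 * (norm (f A - f B))\<^sup>2\<close> and for the pairing of r with the
  drift.\<close>

definition Ca :: real where "Ca = 2 * (c3 + 1) + 4 * L\<^sup>2"

lemma Ca_pos: "Ca > 0" using pos L_pos by (auto simp: Ca_def add_pos_nonneg)

lemma weight_ge_1: "1 \<le> weight x y" by (simp add: weight_def one_le_weight del: power_Suc)

lemma weight_borel[measurable]: "(\<lambda>\<omega>. weight (A \<omega>) (B \<omega>)) \<in> borel_measurable N"
  if [measurable]: "A \<in> borel_measurable N" "B \<in> borel_measurable N"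
  unfolding weight_def by measurable

lemma growth_weight: "norm (f x) \<le> L * weight x y" "norm (f y) \<le> L * weight x y"
  "norm (g x) \<le> L * weight x y" "norm (g y) \<le> L * weight x y"
proof -
  have "(1 + norm x) ^ Suc d \<le> weight x y" "(1 + norm y) ^ Suc d \<le> weight x y"
    unfolding weight_def by (auto intro!: power_mono simp del: power_Suc)
  then show "norm (f x) \<le> L * weight x y" "norm (f y) \<le> L * weight x y"
    "norm (g x) \<le> L * weight x y" "norm (g y) \<le> L * weight x y"
    using L_pos f_growth g_growth by (meson mult_left_mono order_trans less_imp_le)+
qed

text \<open>Monotonicity applies to the states A and B, whereas the explicitly driven error e
  differs from A - B by r. The pairing of r with f A - f B is estimated by Young's inequality and
  the Lipschitz weight, so r enters only squared and multiplied by a polynomial in the states. This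
  becomes the source of the recursion.\<close>

lemma error_step:
  fixes A B e r :: 'a
  assumes \<tau>: "\<tau> > 0" and e: "e = A - B + r"
  shows "(norm (e + \<tau> *\<^sub>R (f A - f B)))\<^sup>2 + \<tau> * (norm (g A - g B))\<^sup>2
    \<le> (1 + 2 * (c3 + 1) * \<tau>) * ((norm e)\<^sup>2 + \<tau> * (Ca * (weight A B)\<^sup>2 * ((norm r)\<^sup>2 + \<tau>)))"
proof -
  let ?D = "f A - f B" and ?G = "g A - g B" and ?w = "weight A B" and ?\<phi> = "(1 + norm A + norm B) ^ d"
  have AB: "A - B = e - r" using e by simp
  have "(norm (e + \<tau> *\<^sub>R ?D))\<^sup>2 = (norm e)\<^sup>2 + \<tau> * (2 * (e \<bullet> ?D)) + \<tau>\<^sup>2 * (norm ?D)\<^sup>2"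
    by (simp only: power2_norm_eq_inner) (simp add: inner_add_left inner_add_right inner_commute algebra_simps power2_eq_square)
  moreover have "2 * (e \<bullet> ?D) = 2 * ((A - B) \<bullet> ?D) + 2 * (r \<bullet> ?D)"
    unfolding e by (simp add: inner_add_left)
  moreover have "2 * ((A - B) \<bullet> ?D) + (norm ?G)\<^sup>2 \<le> c3 * (norm (A - B))\<^sup>2"
  proof -
    have "1 * (norm ?G)\<^sup>2 \<le> l2 * (norm ?G)\<^sup>2" using pos by (intro mult_right_mono) auto
    then show ?thesis using monotone[of A B] by linarith
  qed
  moreover have "2 * (r \<bullet> ?D) \<le> (norm (A - B))\<^sup>2 + (L * ?\<phi> * norm r)\<^sup>2"
  proof -
    have "r \<bullet> ?D \<le> norm r * norm ?D" by (rule norm_cauchy_schwarz)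
    also have "\<dots> \<le> norm r * (L * ?\<phi> * norm (A - B))" by (intro mult_left_mono f_lipschitz) auto
    finally have "2 * (r \<bullet> ?D) \<le> 2 * (L * ?\<phi> * norm r) * norm (A - B)" by (simp add: mult_ac)
    also have "\<dots> \<le> (norm (A - B))\<^sup>2 + (L * ?\<phi> * norm r)\<^sup>2"
      using sum_squares_bound[of "L * ?\<phi> * norm r" "norm (A - B)"] by (simp add: add.commute)
    finally show ?thesis .
  qed
  moreover have "(norm (A - B))\<^sup>2 \<le> 2 * (norm e)\<^sup>2 + 2 * (norm r)\<^sup>2"
  proof -
    have "(norm (A - B))\<^sup>2 \<le> (norm e + norm r)\<^sup>2" unfolding AB by (intro power_mono norm_triangle_ineq4) auto
    also have "\<dots> \<le> 2 * (norm e)\<^sup>2 + 2 * (norm r)\<^sup>2"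
      using sum_squares_bound[of "norm e" "norm r"] by (simp add: power2_sum)
    finally show ?thesis .
  qed
  moreover have "(norm ?D)\<^sup>2 \<le> 4 * L\<^sup>2 * ?w\<^sup>2"
  proof -
    have "norm ?D \<le> L * ?w + L * ?w"
      by (rule order_trans[OF norm_triangle_ineq4]) (intro add_mono growth_weight)
    then have "(norm ?D)\<^sup>2 \<le> (2 * L * ?w)\<^sup>2" by (intro power_mono) (auto simp: mult_ac)
    then show ?thesis by (simp add: power_mult_distrib)
  qed
  moreover have "(L * ?\<phi> * norm r)\<^sup>2 \<le> L\<^sup>2 * ?w\<^sup>2 * (norm r)\<^sup>2"
  proof -
    have "?\<phi> \<le> ?w" unfolding weight_def by (rule power_increasing) auto
    then have "(L * ?\<phi> * norm r)\<^sup>2 \<le> (L * ?w * norm r)\<^sup>2"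
      using L_pos by (intro power_mono mult_right_mono mult_left_mono) auto
    then show ?thesis by (simp add: power_mult_distrib)
  qed
  ultimately have main: "(norm (e + \<tau> *\<^sub>R ?D))\<^sup>2 + \<tau> * (norm ?G)\<^sup>2
     \<le> (norm e)\<^sup>2 + \<tau> * ((c3 + 1) * (2 * (norm e)\<^sup>2 + 2 * (norm r)\<^sup>2) + L\<^sup>2 * ?w\<^sup>2 * (norm r)\<^sup>2) + \<tau>\<^sup>2 * (4 * L\<^sup>2 * ?w\<^sup>2)"
  proof -
    assume 1: "(norm (e + \<tau> *\<^sub>R ?D))\<^sup>2 = (norm e)\<^sup>2 + \<tau> * (2 * (e \<bullet> ?D)) + \<tau>\<^sup>2 * (norm ?D)\<^sup>2"
      and 2: "2 * (e \<bullet> ?D) = 2 * ((A - B) \<bullet> ?D) + 2 * (r \<bullet> ?D)"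
      and 3: "2 * ((A - B) \<bullet> ?D) + (norm ?G)\<^sup>2 \<le> c3 * (norm (A - B))\<^sup>2"
      and 4: "2 * (r \<bullet> ?D) \<le> (norm (A - B))\<^sup>2 + (L * ?\<phi> * norm r)\<^sup>2"
      and 5: "(norm (A - B))\<^sup>2 \<le> 2 * (norm e)\<^sup>2 + 2 * (norm r)\<^sup>2"
      and 6: "(norm ?D)\<^sup>2 \<le> 4 * L\<^sup>2 * ?w\<^sup>2"
      and 7: "(L * ?\<phi> * norm r)\<^sup>2 \<le> L\<^sup>2 * ?w\<^sup>2 * (norm r)\<^sup>2"
    have "(c3 + 1) * (norm (A - B))\<^sup>2 \<le> (c3 + 1) * (2 * (norm e)\<^sup>2 + 2 * (norm r)\<^sup>2)"
      using 5 pos by (intro mult_left_mono) auto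
    then have "2 * (e \<bullet> ?D) + (norm ?G)\<^sup>2 \<le> (c3 + 1) * (2 * (norm e)\<^sup>2 + 2 * (norm r)\<^sup>2) + L\<^sup>2 * ?w\<^sup>2 * (norm r)\<^sup>2"
      using 2 3 4 7 by (simp add: algebra_simps)
    then have "\<tau> * (2 * (e \<bullet> ?D) + (norm ?G)\<^sup>2) \<le> \<tau> * ((c3 + 1) * (2 * (norm e)\<^sup>2 + 2 * (norm r)\<^sup>2) + L\<^sup>2 * ?w\<^sup>2 * (norm r)\<^sup>2)"
      using \<tau> by (intro mult_left_mono) auto
    moreover have "\<tau>\<^sup>2 * (norm ?D)\<^sup>2 \<le> \<tau>\<^sup>2 * (4 * L\<^sup>2 * ?w\<^sup>2)" using 6 by (intro mult_left_mono) auto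
    ultimately show ?thesis unfolding 1 by (simp add: distrib_left)
  qed
  have "1 \<le> ?w\<^sup>2" using weight_ge_1 by (simp add: one_le_power)
  then have r1: "2 * (c3 + 1) * (norm r)\<^sup>2 * 1 \<le> 2 * (c3 + 1) * (norm r)\<^sup>2 * ?w\<^sup>2"
    using pos by (intro mult_left_mono) auto
  have "(norm e)\<^sup>2 + \<tau> * ((c3 + 1) * (2 * (norm e)\<^sup>2 + 2 * (norm r)\<^sup>2) + L\<^sup>2 * ?w\<^sup>2 * (norm r)\<^sup>2) + \<tau>\<^sup>2 * (4 * L\<^sup>2 * ?w\<^sup>2)
    = (1 + 2 * (c3 + 1) * \<tau>) * (norm e)\<^sup>2 + \<tau> * (2 * (c3 + 1) * (norm r)\<^sup>2 * 1 + L\<^sup>2 * ?w\<^sup>2 * (norm r)\<^sup>2 + 4 * L\<^sup>2 * ?w\<^sup>2 * \<tau>)"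
    by (simp add: algebra_simps power2_eq_square)
  also have "\<dots> \<le> (1 + 2 * (c3 + 1) * \<tau>) * (norm e)\<^sup>2 + \<tau> * (Ca * ?w\<^sup>2 * ((norm r)\<^sup>2 + \<tau>))"
  proof (intro add_left_mono mult_left_mono)
    have "0 \<le> 3 * (L\<^sup>2 * ?w\<^sup>2 * (norm r)\<^sup>2)" "0 \<le> 2 * (c3 + 1) * ?w\<^sup>2 * \<tau>" using pos \<tau> by auto
    moreover have "Ca * ?w\<^sup>2 * ((norm r)\<^sup>2 + \<tau>) = 2 * (c3 + 1) * (norm r)\<^sup>2 * ?w\<^sup>2 + L\<^sup>2 * ?w\<^sup>2 * (norm r)\<^sup>2 + 4 * L\<^sup>2 * ?w\<^sup>2 * \<tau>
      + (3 * (L\<^sup>2 * ?w\<^sup>2 * (norm r)\<^sup>2) + 2 * (c3 + 1) * ?w\<^sup>2 * \<tau>)"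
      unfolding Ca_def by algebra
    ultimately show "2 * (c3 + 1) * (norm r)\<^sup>2 * 1 + L\<^sup>2 * ?w\<^sup>2 * (norm r)\<^sup>2 + 4 * L\<^sup>2 * ?w\<^sup>2 * \<tau> \<le> Ca * ?w\<^sup>2 * ((norm r)\<^sup>2 + \<tau>)"
      using r1 by linarith
  qed (use \<tau> in auto)
  \<comment> \<open>The source is put under the growth factor too, to match the form
    \<open>c * (Y i + a i)\<close> of the abstract recursions.\<close>
  also have "\<dots> \<le> (1 + 2 * (c3 + 1) * \<tau>) * ((norm e)\<^sup>2 + \<tau> * (Ca * ?w\<^sup>2 * ((norm r)\<^sup>2 + \<tau>)))"
  proof -
    have "0 \<le> (2 * (c3 + 1) * \<tau>) * (\<tau> * (Ca * ?w\<^sup>2 * ((norm r)\<^sup>2 + \<tau>)))"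
      using pos \<tau> Ca_pos by (intro mult_nonneg_nonneg) auto
    then show ?thesis by (simp add: algebra_simps)
  qed
  finally show ?thesis using main by linarith
qed

end

section \<open>Chains of the backward Euler scheme\<close>

text \<open>From \<open>ln y \<le> y - 1\<close> at y = 1 / (1 - a). It writes the cost of inverting
  the implicit step as an exponential, so that its rate can be added to the Gaussian one.\<close>

lemma one_minus_powr_le_exp:
  fixes a r :: real
  assumes "a < 1" "r \<ge> 0"
  shows "(1 - a) powr (- r) \<le> exp (r * (a / (1 - a)))"
proof -
  have "- ln (1 - a) = ln (1 / (1 - a))" using assms by (simp add: ln_div)
  also have "\<dots> \<le> 1 / (1 - a) - 1" using assms by (intro ln_le_minus_one) auto
  also have "\<dots> = a / (1 - a)" using assms by (simp add: field_simps)
  finally have "r * - ln (1 - a) \<le> r * (a / (1 - a))" using assms by (intro mult_left_mono) auto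
  then show ?thesis using assms by (simp add: powr_def)
qed

text \<open>\<open>C * (1 + \<rho>) / \<rho>\<close> dominates the fixed point because \<open>1 -
  exp (- \<rho> * \<tau>) \<ge> \<rho> * \<tau> / (1 + \<rho>)\<close> for \<tau> \<le> 1, so the
  bound is free of \<tau>. It serves per time step for the moments and, with \<tau> = 1, per window
  for the errors.\<close>

lemma affine_recursion_bounded:
  fixes a :: "nat \<Rightarrow> ennreal" and \<rho> \<tau> C :: real
  assumes "\<rho> > 0" "0 < \<tau>" "\<tau> \<le> 1" "C \<ge> 0"
    and step: "\<And>n. a (Suc n) \<le> ennreal (exp (- \<rho> * \<tau>)) * a n + ennreal (C * \<tau>)"
  shows "a n \<le> a 0 + ennreal (C * (1 + \<rho>) / \<rho>)"
proof (induction n)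
  case (Suc n)
  let ?B = "C * (1 + \<rho>) / \<rho>" and ?e = "exp (- \<rho> * \<tau>)"
  have "?e = inverse (exp (\<rho> * \<tau>))" by (simp add: exp_minus)
  also have "\<dots> \<le> inverse (1 + \<rho> * \<tau>)"
    using assms exp_ge_add_one_self[of "\<rho> * \<tau>"] by (intro le_imp_inverse_le) (auto simp: add_pos_nonneg)
  also have "inverse (1 + \<rho> * \<tau>) = 1 - \<rho> * \<tau> / (1 + \<rho> * \<tau>)"
  proof -
    have "1 + \<rho> * \<tau> > 0" using assms by (simp add: add_pos_nonneg)
    then show ?thesis by (simp add: field_simps)
  qed
  finally have "1 - ?e \<ge> \<rho> * \<tau> / (1 + \<rho> * \<tau>)" by simp
  moreover have "\<rho> * \<tau> / (1 + \<rho> * \<tau>) \<ge> \<rho> * \<tau> / (1 + \<rho>)"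
    using assms by (intro divide_left_mono) (auto simp: add_pos_nonneg)
  ultimately have "\<rho> * \<tau> / (1 + \<rho>) \<le> 1 - ?e" by linarith
  then have "\<rho> * \<tau> / (1 + \<rho>) * ?B \<le> (1 - ?e) * ?B" using assms by (intro mult_right_mono) auto
  moreover have "\<rho> * \<tau> / (1 + \<rho>) * ?B = C * \<tau>"
  proof -
    have "1 + \<rho> > 0" using assms by simp
    then show ?thesis using assms by simp
  qed
  moreover have "(1 - ?e) * x = x - ?e * x" for x by (simp add: algebra_simps)
  ultimately have *: "?e * ?B + C * \<tau> \<le> ?B" by (metis add.commute le_diff_eq)
  have "a (Suc n) \<le> ennreal ?e * (a 0 + ennreal ?B) + ennreal (C * \<tau>)"
    by (rule order_trans[OF step]) (intro add_right_mono mult_left_mono Suc.IH, simp)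
  also have "\<dots> \<le> ennreal 1 * a 0 + (ennreal ?e * ennreal ?B + ennreal (C * \<tau>))"
    unfolding distrib_left add.assoc using assms by (intro add_right_mono mult_right_mono ennreal_leI) auto
  also have "ennreal ?e * ennreal ?B + ennreal (C * \<tau>) = ennreal (?e * ?B + C * \<tau>)"
  proof -
    have "0 \<le> ?B" "0 \<le> ?e" "0 \<le> C * \<tau>" using assms by auto
    then show ?thesis by (simp only: ennreal_mult[symmetric] ennreal_plus[symmetric] mult_nonneg_nonneg)
  qed
  also have "\<dots> \<le> ennreal ?B" using * by (rule ennreal_leI)
  finally show ?case by (simp add: add_left_mono)
qed simp

locale bem = brownian M F W + bem_coefficients f g K c1 c2 c3 l1 l2 d
  for M :: "'m measure" and F :: "real \<Rightarrow> 'm measure" and W :: "real \<Rightarrow> 'm \<Rightarrow> real"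
    and f g :: "'a::euclidean_space \<Rightarrow> 'a" and K c1 c2 c3 l1 l2 :: real and d :: nat
begin

text \<open>Start time and random starting value are free, as the scheme will be restarted at other
  processes. Measurability is demanded of the starting value only and propagates from there.\<close>

definition chain :: "real \<Rightarrow> real \<Rightarrow> (nat \<Rightarrow> 'm \<Rightarrow> 'a) \<Rightarrow> bool" where
  "chain t0 \<tau> Y \<longleftrightarrow> Y 0 \<in> borel_measurable (F t0) \<and>
     (\<forall>k. \<forall>\<omega>\<in>space M. Y (Suc k) \<omega> = Y k \<omega> + \<tau> *\<^sub>R f (Y (Suc k) \<omega>)
        + (W (t0 + real (Suc k) * \<tau>) \<omega> - W (t0 + real k * \<tau>) \<omega>) *\<^sub>R g (Y k \<omega>))"

lemma grid_filtration: "0 \<le> \<tau> \<Longrightarrow> discrete_filtration M (\<lambda>i. F (t0 + real i * \<tau>))"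
  by unfold_locales (rule space_F sets_F sets_F_mono; simp add: mult_right_mono)+

lemma chain_implicit:
  assumes "chain t0 \<tau> Y" "\<omega> \<in> space M"
  shows "Y (Suc k) \<omega> - \<tau> *\<^sub>R f (Y (Suc k) \<omega>) =
    Y k \<omega> + (W (t0 + real (Suc k) * \<tau>) \<omega> - W (t0 + real k * \<tau>) \<omega>) *\<^sub>R g (Y k \<omega>)"
proof -
  have "a = b + c + e \<Longrightarrow> a - c = b + e" for a b c e :: 'a by simp
  then show ?thesis using assms unfolding chain_def by blast
qed

lemma chain_adapted:
  assumes Y: "chain t0 \<tau> Y" and \<tau>: "small \<tau>" and t0: "t0 \<ge> 0"
  shows "Y k \<in> borel_measurable (F (t0 + real k * \<tau>))"
proof (induction k)
  case 0 then show ?case using Y by (simp add: chain_def)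
next
  case (Suc k)
  let ?t = "t0 + real k * \<tau>" and ?t' = "t0 + real (Suc k) * \<tau>"
  have t: "0 \<le> ?t" "?t \<le> ?t'" using \<tau> t0 by (auto simp: small_def intro: mult_right_mono)
  have [measurable]: "Y k \<in> borel_measurable (F ?t')" by (rule F_mono[OF Suc.IH t(2)])
  have [measurable]: "(\<lambda>\<omega>. W ?t' \<omega> - W ?t \<omega>) \<in> borel_measurable (F ?t')" by (rule increment_measurable[OF t])
  note [measurable] = resolvent_borel[OF \<tau>]
  have "(\<lambda>\<omega>. resolvent \<tau> (Y k \<omega> + (W ?t' \<omega> - W ?t \<omega>) *\<^sub>R g (Y k \<omega>))) \<in> borel_measurable (F ?t')"
    by measurable
  moreover have "Y (Suc k) \<omega> = resolvent \<tau> (Y k \<omega> + (W ?t' \<omega> - W ?t \<omega>) *\<^sub>R g (Y k \<omega>))" if "\<omega> \<in> space (F ?t')" for \<omega>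
    using chain_implicit[OF Y, of \<omega> k] that by (simp add: resolvent_iff[OF \<tau>] space_F)
  ultimately show ?case by (subst measurable_cong) auto
qed

lemma chain_measurable:
  "chain t0 \<tau> Y \<Longrightarrow> small \<tau> \<Longrightarrow> t0 \<ge> 0 \<Longrightarrow> Y k \<in> borel_measurable M"
  using chain_adapted F_M by blast

lemma chain_exists:
  assumes \<tau>: "small \<tau>" and \<xi>: "\<xi> \<in> borel_measurable (F t0)"
  shows "\<exists>Y. chain t0 \<tau> Y \<and> Y 0 = \<xi>"
proof -
  define Y where "Y = rec_nat \<xi> (\<lambda>k y \<omega>. resolvent \<tau> (y \<omega> + (W (t0 + real (Suc k) * \<tau>) \<omega> - W (t0 + real k * \<tau>) \<omega>) *\<^sub>R g (y \<omega>)))"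
  have "Y (Suc k) \<omega> = resolvent \<tau> (Y k \<omega> + (W (t0 + real (Suc k) * \<tau>) \<omega> - W (t0 + real k * \<tau>) \<omega>) *\<^sub>R g (Y k \<omega>))" for k \<omega>
    by (simp add: Y_def)
  then have eq: "Y (Suc k) \<omega> - \<tau> *\<^sub>R f (Y (Suc k) \<omega>) = Y k \<omega> + (W (t0 + real (Suc k) * \<tau>) \<omega> - W (t0 + real k * \<tau>) \<omega>) *\<^sub>R g (Y k \<omega>)" for k \<omega>
    by (subst resolvent_iff[OF \<tau>])
  have "a - c = b + e \<Longrightarrow> a = b + c + e" for a b c e :: 'a by (simp add: algebra_simps)
  then have "chain t0 \<tau> Y" using \<xi> eq unfolding chain_def by (auto simp: Y_def)
  then show ?thesis by (auto simp: Y_def)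
qed

lemma chain_shift:
  assumes "chain t0 \<tau> Y" "small \<tau>" "t0 \<ge> 0"
  shows "chain (t0 + real n * \<tau>) \<tau> (\<lambda>i. Y (n + i))"
proof -
  have eq: "t0 + real n * \<tau> + real k * \<tau> = t0 + real (n + k) * \<tau>" for k by (simp add: algebra_simps)
  have "Y (Suc (n + k)) \<omega> = Y (n + k) \<omega> + \<tau> *\<^sub>R f (Y (Suc (n + k)) \<omega>)
      + (W (t0 + real (Suc (n + k)) * \<tau>) \<omega> - W (t0 + real (n + k) * \<tau>) \<omega>) *\<^sub>R g (Y (n + k) \<omega>)" if "\<omega> \<in> space M" for k \<omega>
    using assms(1) that unfolding chain_def by blast
  then show ?thesis
    using chain_adapted[OF assms, of n] unfolding chain_def eq by (simp del: of_nat_Suc of_nat_add)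
qed

text \<open>Inverting the implicit map costs \<open>(1 - c3 * \<tau>) powr (- r)\<close>, and the
  Gaussian step contributes \<open>1 + r * \<tau> * ((1 - r) * k2)\<close>. Both are bounded by
  exponentials, and \<open>rate\<close> bounds the sum of the two exponents.\<close>

lemma gap_contraction:
  assumes X: "chain t0 \<tau> X" and Y: "chain t0 \<tau> Y" and \<tau>: "small \<tau>" and t0: "t0 \<ge> 0"
    and r: "0 < r" "r < 1" and b: "l2 * \<tau> \<le> b"
    and k2: "\<And>y z. y \<noteq> z \<Longrightarrow> (1 - l2) * (norm (g y - g z))\<^sup>2 / ((norm (y - z))\<^sup>2 + b * (norm (g y - g z))\<^sup>2)
          - 2 * ((y - z) \<bullet> (g y - g z))\<^sup>2 / ((norm (y - z))\<^sup>2 + b * (norm (g y - g z))\<^sup>2)\<^sup>2 \<le> k2"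
    and rate: "r * ((1 - r) * k2 + c3 / (1 - c3 * \<tau>)) \<le> - \<rho>"
  shows "(\<integral>\<^sup>+\<omega>. ennreal (gap \<tau> (X (Suc k) \<omega>) (Y (Suc k) \<omega>) powr r) \<partial>M)
    \<le> ennreal (exp (- \<rho> * \<tau>)) * (\<integral>\<^sup>+\<omega>. ennreal (gap \<tau> (X k \<omega>) (Y k \<omega>) powr r) \<partial>M)"
proof -
  let ?t = "t0 + real k * \<tau>" and ?t' = "t0 + real (Suc k) * \<tau>"
  have tau: "0 < \<tau>" "c3 * \<tau> < 1" using \<tau> by (auto simp: small_def)
  have t: "0 \<le> ?t" "?t < ?t'" "?t' - ?t = \<tau>" using tau t0 by (auto simp: algebra_simps)
  have [measurable]: "X k \<in> borel_measurable (F ?t)" "Y k \<in> borel_measurable (F ?t)"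
    using chain_adapted[OF X \<tau> t0] chain_adapted[OF Y \<tau> t0] by auto
  have [measurable]: "X k \<in> borel_measurable M" "Y k \<in> borel_measurable M"
    using chain_measurable[OF X \<tau> t0] chain_measurable[OF Y \<tau> t0] by auto
  have tM: "0 \<le> t0 + real k * \<tau>" "t0 + real k * \<tau> \<le> t0 + real (Suc k) * \<tau>" using t by auto
  note [measurable] = increment_measurable_M[OF tM]
  let ?Z = "\<lambda>\<omega>. (X k \<omega> - Y k \<omega>) + (W ?t' \<omega> - W ?t \<omega>) *\<^sub>R (g (X k \<omega>) - g (Y k \<omega>))"
  have "(\<integral>\<^sup>+\<omega>. ennreal (gap \<tau> (X (Suc k) \<omega>) (Y (Suc k) \<omega>) powr r) \<partial>M)
    \<le> (\<integral>\<^sup>+\<omega>. ennreal ((1 - c3 * \<tau>) powr (- r)) * ennreal ((0 + (norm (?Z \<omega>))\<^sup>2) powr r) \<partial>M)"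
  proof (rule nn_integral_mono)
    fix \<omega> assume \<omega>: "\<omega> \<in> space M"
    let ?U = "gap \<tau> (X (Suc k) \<omega>) (Y (Suc k) \<omega>)"
    have "(1 - c3 * \<tau>) * ?U \<le> (norm ((X (Suc k) \<omega> - \<tau> *\<^sub>R f (X (Suc k) \<omega>)) - (Y (Suc k) \<omega> - \<tau> *\<^sub>R f (Y (Suc k) \<omega>))))\<^sup>2"
      by (rule gap_implicit[OF \<tau>])
    also have "\<dots> = (norm (?Z \<omega>))\<^sup>2"
      unfolding chain_implicit[OF X \<omega>] chain_implicit[OF Y \<omega>] by (simp add: algebra_simps)
    finally have "((1 - c3 * \<tau>) * ?U) powr r \<le> (norm (?Z \<omega>))\<^sup>2 powr r"
      using r tau pos by (intro powr_mono2 mult_nonneg_nonneg) (auto simp: gap_def)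
    then have "?U powr r \<le> (1 - c3 * \<tau>) powr (- r) * (norm (?Z \<omega>))\<^sup>2 powr r"
      using r tau pos by (subst (asm) powr_mult) (auto simp: gap_def powr_minus field_simps)
    then show "ennreal (?U powr r) \<le> ennreal ((1 - c3 * \<tau>) powr (- r)) * ennreal ((0 + (norm (?Z \<omega>))\<^sup>2) powr r)"
      by (simp add: ennreal_mult[symmetric] ennreal_leI)
  qed
  also have "\<dots> = ennreal ((1 - c3 * \<tau>) powr (- r)) * (\<integral>\<^sup>+\<omega>. ennreal ((0 + (norm (?Z \<omega>))\<^sup>2) powr r) \<partial>M)"
    by (rule nn_integral_cmult) measurable
  also have "\<dots> \<le> ennreal ((1 - c3 * \<tau>) powr (- r)) * (\<integral>\<^sup>+\<omega>. ennreal (gap \<tau> (X k \<omega>) (Y k \<omega>) powr r * (1 + r * \<tau> * ((1 - r) * k2))) \<partial>M)"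
  proof (rule mult_left_mono)
    have "(\<integral>\<^sup>+\<omega>. ennreal ((0 + (norm (?Z \<omega>))\<^sup>2) powr r) \<partial>M)
      \<le> (\<integral>\<^sup>+\<omega>. ennreal ((0 + (norm (X k \<omega> - Y k \<omega>))\<^sup>2 + l2 * (?t' - ?t) * (norm (g (X k \<omega>) - g (Y k \<omega>)))\<^sup>2) powr r
          * (1 + r * (?t' - ?t) * ((1 - r) * k2))) \<partial>M)"
    proof (rule increment_powr_dissipative[where b = b])
      fix \<omega> assume "0 < 0 + (norm (X k \<omega> - Y k \<omega>))\<^sup>2 + b * (norm (g (X k \<omega>) - g (Y k \<omega>)))\<^sup>2"
      \<comment> \<open>With c = 0, positivity of V leaves out equal states, which is just what (A4)
        requires.\<close>
      then have "X k \<omega> \<noteq> Y k \<omega>" by auto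
      from k2[OF this] show "(1 - l2) * (norm (g (X k \<omega>) - g (Y k \<omega>)))\<^sup>2 / (0 + (norm (X k \<omega> - Y k \<omega>))\<^sup>2 + b * (norm (g (X k \<omega>) - g (Y k \<omega>)))\<^sup>2) -
         2 * ((X k \<omega> - Y k \<omega>) \<bullet> (g (X k \<omega>) - g (Y k \<omega>)))\<^sup>2 / (0 + (norm (X k \<omega> - Y k \<omega>))\<^sup>2 + b * (norm (g (X k \<omega>) - g (Y k \<omega>)))\<^sup>2)\<^sup>2 \<le> k2"
        by simp
    qed (use t r pos b in \<open>auto simp: \<open>?t' - ?t = \<tau>\<close>\<close>)
    then show "(\<integral>\<^sup>+\<omega>. ennreal ((0 + (norm (?Z \<omega>))\<^sup>2) powr r) \<partial>M)
      \<le> (\<integral>\<^sup>+\<omega>. ennreal (gap \<tau> (X k \<omega>) (Y k \<omega>) powr r * (1 + r * \<tau> * ((1 - r) * k2))) \<partial>M)"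
      unfolding t(3) gap_def by simp
  qed simp
  also have "\<dots> \<le> (\<integral>\<^sup>+\<omega>. ennreal (exp (- \<rho> * \<tau>)) * ennreal (gap \<tau> (X k \<omega>) (Y k \<omega>) powr r) \<partial>M)"
    unfolding gap_def
  proof (subst nn_integral_cmult[symmetric], measurable, rule nn_integral_mono, fold gap_def)
    fix \<omega>
    let ?G = "gap \<tau> (X k \<omega>) (Y k \<omega>) powr r"
    have "(1 - c3 * \<tau>) powr (- r) * (1 + r * \<tau> * ((1 - r) * k2)) \<le> exp (r * (c3 * \<tau> / (1 - c3 * \<tau>))) * exp (r * \<tau> * ((1 - r) * k2))"
    proof (rule order_trans[OF mult_left_mono mult_right_mono])
      show "1 + r * \<tau> * ((1 - r) * k2) \<le> exp (r * \<tau> * ((1 - r) * k2))" by (rule exp_ge_add_one_self)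
      show "(1 - c3 * \<tau>) powr (- r) \<le> exp (r * (c3 * \<tau> / (1 - c3 * \<tau>)))"
        using tau r by (intro one_minus_powr_le_exp) auto
    qed auto
    also have "\<dots> = exp (\<tau> * (r * ((1 - r) * k2 + c3 / (1 - c3 * \<tau>))))" by (simp add: exp_add[symmetric] algebra_simps)
    also have "\<dots> \<le> exp (\<tau> * - \<rho>)" using rate tau by (intro iffD2[OF exp_le_cancel_iff] mult_left_mono) auto
    finally have "(1 - c3 * \<tau>) powr (- r) * (1 + r * \<tau> * ((1 - r) * k2)) * ?G \<le> exp (- \<rho> * \<tau>) * ?G"
      by (intro mult_right_mono) (auto simp: mult.commute)
    then show "ennreal ((1 - c3 * \<tau>) powr (- r)) * ennreal (?G * (1 + r * \<tau> * ((1 - r) * k2))) \<le> ennreal (exp (- \<rho> * \<tau>)) * ennreal ?G"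
      by (simp add: ennreal_mult'[symmetric] ennreal_leI mult_ac)
  qed
  also have "\<dots> = ennreal (exp (- \<rho> * \<tau>)) * (\<integral>\<^sup>+\<omega>. ennreal (gap \<tau> (X k \<omega>) (Y k \<omega>) powr r) \<partial>M)"
    unfolding gap_def by (rule nn_integral_cmult) measurable
  finally show ?thesis .
qed

text \<open>The rate \<kappa> varies with the state; hypothesis \<open>k\<close> trades it for a
  constant rate at the price of the additive C. The other additive part stems from c2 and is made
  proportional to \<tau> by a tangent at a point \<ge> D, which is where D > 0 enters.\<close>

lemma Lyap_step:
  fixes \<kappa> :: "'a \<Rightarrow> real"
  assumes Y: "chain t0 \<tau> Y" and \<tau>: "small \<tau>" and t0: "t0 \<ge> 0"
    and r: "0 < r" "r < 1" and b: "l1 * \<tau> \<le> b" and D: "D > 0" and C: "C \<ge> 0"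
    and \<kappa>: "\<And>y. (1 - l1) * (norm (g y))\<^sup>2 / (D + (norm y)\<^sup>2 + b * (norm (g y))\<^sup>2)
          - 2 * (y \<bullet> g y)\<^sup>2 / (D + (norm y)\<^sup>2 + b * (norm (g y))\<^sup>2)\<^sup>2 \<le> \<kappa> y"
    and k: "\<And>y. Lyap D \<tau> y powr r * \<kappa> y \<le> k * Lyap D \<tau> y powr r + C"
    and rate: "r * ((1 - r) * k + c1 / (1 - c1 * \<tau>)) \<le> - \<rho>"
  shows "(\<integral>\<^sup>+\<omega>. ennreal (Lyap D \<tau> (Y (Suc n) \<omega>) powr r) \<partial>M)
    \<le> ennreal (exp (- \<rho> * \<tau>)) * (\<integral>\<^sup>+\<omega>. ennreal (Lyap D \<tau> (Y n \<omega>) powr r) \<partial>M)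
      + ennreal (2 * (C + D powr (r - 1) * c2) * \<tau>)"
proof -
  let ?t = "t0 + real n * \<tau>" and ?t' = "t0 + real (Suc n) * \<tau>" and ?q = "1 - c1 * \<tau>"
  have tau: "0 < \<tau>" "2 * c1 * \<tau> \<le> 1" using \<tau> by (auto simp: small_def)
  then have q: "0 < ?q" "1/2 \<le> ?q" by auto
  have t: "0 \<le> ?t" "?t < ?t'" "?t' - ?t = \<tau>" using tau t0 by (auto simp: algebra_simps)
  have [measurable]: "Y n \<in> borel_measurable (F ?t)" by (rule chain_adapted[OF Y \<tau> t0])
  have [measurable]: "Y n \<in> borel_measurable M" by (rule chain_measurable[OF Y \<tau> t0])
  have tM: "0 \<le> t0 + real n * \<tau>" "t0 + real n * \<tau> \<le> t0 + real (Suc n) * \<tau>" using t by auto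
  note [measurable] = increment_measurable_M[OF tM]
  let ?Z = "\<lambda>\<omega>. Y n \<omega> + (W ?t' \<omega> - W ?t \<omega>) *\<^sub>R g (Y n \<omega>)"
  let ?V = "\<lambda>\<omega>. Lyap D \<tau> (Y n \<omega>) powr r"
  have [measurable]: "?V \<in> borel_measurable M" unfolding Lyap_def by measurable
  \<comment> \<open>For the additive terms only, where a fixed factor 2 is affordable; in front of
    the moment the same factor must be kept in exponential form.\<close>
  have qr: "?q powr (- r) \<le> 2"
  proof -
    have "?q powr (- r) \<le> (1/2) powr (- r)" using q r by (intro powr_mono2') auto
    also have "\<dots> = 2 powr r" by (simp add: powr_minus powr_divide)
    also have "\<dots> \<le> 2 powr 1" using r by (intro powr_mono) auto
    finally show ?thesis by simp
  qed
  define c where "c = D powr (r - 1) * c2 * \<tau>"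
  have c: "c \<ge> 0" using pos tau by (simp add: c_def)
  have "(\<integral>\<^sup>+\<omega>. ennreal (Lyap D \<tau> (Y (Suc n) \<omega>) powr r) \<partial>M)
    \<le> (\<integral>\<^sup>+\<omega>. ennreal (?q powr (- r)) * (ennreal ((D + (norm (?Z \<omega>))\<^sup>2) powr r) + ennreal c) \<partial>M)"
  proof (rule nn_integral_mono)
    fix \<omega> assume \<omega>: "\<omega> \<in> space M"
    let ?U = "Lyap D \<tau> (Y (Suc n) \<omega>)" and ?z = "D + (norm (?Z \<omega>))\<^sup>2"
    have U: "?U \<ge> 0" using D pos tau by (simp add: Lyap_def)
    have z: "?z \<ge> D" "?z > 0" using D by (auto simp: add_pos_nonneg)
    have "?q * ?U \<le> ?z + c2 * \<tau>"
      using Lyap_implicit[OF \<tau>, of D "Y (Suc n) \<omega>"] D unfolding chain_implicit[OF Y \<omega>] by simp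
    then have "(?q * ?U) powr r \<le> (?z + c2 * \<tau>) powr r"
      using r q U by (intro powr_mono2 mult_nonneg_nonneg) auto
    also have "\<dots> \<le> ?z powr r + r * ?z powr (r - 1) * ((?z + c2 * \<tau>) - ?z)"
      using r z pos tau by (intro powr_le_tangent_at) auto
    also have "r * ?z powr (r - 1) * ((?z + c2 * \<tau>) - ?z) \<le> 1 * D powr (r - 1) * (c2 * \<tau>)"
      using r z pos tau D by (intro mult_mono powr_mono2') auto
    finally have "?q powr r * ?U powr r \<le> ?z powr r + c"
      using q U by (simp add: powr_mult c_def mult_ac)
    then have "?U powr r \<le> ?q powr (- r) * (?z powr r + c)"
      using q by (simp add: powr_minus field_simps)
    then show "ennreal (?U powr r) \<le> ennreal (?q powr (- r)) * (ennreal (?z powr r) + ennreal c)"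
      using c by (simp add: ennreal_mult'[symmetric] ennreal_plus[symmetric] ennreal_leI del: ennreal_plus)
  qed
  also have "\<dots> = ennreal (?q powr (- r)) * ((\<integral>\<^sup>+\<omega>. ennreal ((D + (norm (?Z \<omega>))\<^sup>2) powr r) \<partial>M) + ennreal c)"
    by (subst nn_integral_cmult, measurable, subst nn_integral_add, measurable) (simp add: emeasure_space_1)
  also have "\<dots> \<le> ennreal (?q powr (- r)) * ((ennreal (exp (r * \<tau> * ((1 - r) * k))) * (\<integral>\<^sup>+\<omega>. ennreal (?V \<omega>) \<partial>M) + ennreal (C * \<tau>)) + ennreal c)"
  proof (intro mult_left_mono add_right_mono)
    have "(\<integral>\<^sup>+\<omega>. ennreal ((D + (norm (?Z \<omega>))\<^sup>2) powr r) \<partial>M)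
      \<le> (\<integral>\<^sup>+\<omega>. ennreal ((D + (norm (Y n \<omega>))\<^sup>2 + l1 * (?t' - ?t) * (norm (g (Y n \<omega>)))\<^sup>2) powr r
          * (1 + r * (?t' - ?t) * ((1 - r) * \<kappa> (Y n \<omega>)))) \<partial>M)"
      by (rule increment_powr_dissipative[where b = b]) (use t r pos b D \<kappa> in \<open>auto simp: \<open>?t' - ?t = \<tau>\<close>\<close>)
    also have "\<dots> \<le> (\<integral>\<^sup>+\<omega>. ennreal (exp (r * \<tau> * ((1 - r) * k))) * ennreal (?V \<omega>) + ennreal (C * \<tau>) \<partial>M)"
      unfolding t(3) Lyap_def[symmetric]
    proof (rule nn_integral_mono)
      fix \<omega>
      have "?V \<omega> * (1 + r * \<tau> * ((1 - r) * \<kappa> (Y n \<omega>))) = ?V \<omega> + r * \<tau> * (1 - r) * (?V \<omega> * \<kappa> (Y n \<omega>))"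
        by (simp add: algebra_simps)
      also have "\<dots> \<le> ?V \<omega> + r * \<tau> * (1 - r) * (k * ?V \<omega> + C)"
        using r tau by (intro add_left_mono mult_left_mono k) auto
      also have "\<dots> = (1 + r * \<tau> * ((1 - r) * k)) * ?V \<omega> + (r * (1 - r)) * (C * \<tau>)" by (simp add: algebra_simps)
      also have "\<dots> \<le> exp (r * \<tau> * ((1 - r) * k)) * ?V \<omega> + C * \<tau>"
      proof (intro add_mono mult_right_mono exp_ge_add_one_self)
        have "r * (1 - r) \<le> 1" using r by (intro mult_le_one) auto
        then show "r * (1 - r) * (C * \<tau>) \<le> C * \<tau>" using C tau r by (intro mult_left_le_one_le) auto
      qed simp
      finally show "ennreal (?V \<omega> * (1 + r * \<tau> * ((1 - r) * \<kappa> (Y n \<omega>)))) \<le> ennreal (exp (r * \<tau> * ((1 - r) * k))) * ennreal (?V \<omega>) + ennreal (C * \<tau>)"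
        using C tau by (simp add: ennreal_mult'[symmetric] ennreal_plus[symmetric] ennreal_leI del: ennreal_plus)
    qed
    also have "\<dots> = ennreal (exp (r * \<tau> * ((1 - r) * k))) * (\<integral>\<^sup>+\<omega>. ennreal (?V \<omega>) \<partial>M) + ennreal (C * \<tau>)"
      by (subst nn_integral_add, measurable, subst nn_integral_cmult, measurable) (simp add: emeasure_space_1)
    finally show "(\<integral>\<^sup>+\<omega>. ennreal ((D + (norm (?Z \<omega>))\<^sup>2) powr r) \<partial>M) \<le> ennreal (exp (r * \<tau> * ((1 - r) * k))) * (\<integral>\<^sup>+\<omega>. ennreal (?V \<omega>) \<partial>M) + ennreal (C * \<tau>)" .
  qed simp
  also have "\<dots> = ennreal (?q powr (- r) * exp (r * \<tau> * ((1 - r) * k))) * (\<integral>\<^sup>+\<omega>. ennreal (?V \<omega>) \<partial>M) + ennreal (?q powr (- r) * (C * \<tau> + c))"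
    using C tau c by (simp add: distrib_left ennreal_mult ennreal_plus mult.assoc add.assoc)
  also have "\<dots> \<le> ennreal (exp (- \<rho> * \<tau>)) * (\<integral>\<^sup>+\<omega>. ennreal (?V \<omega>) \<partial>M) + ennreal (2 * (C + D powr (r - 1) * c2) * \<tau>)"
  proof (intro add_mono mult_right_mono ennreal_leI)
    have "?q powr (- r) * exp (r * \<tau> * ((1 - r) * k)) \<le> exp (r * (c1 * \<tau> / ?q)) * exp (r * \<tau> * ((1 - r) * k))"
      using q r by (intro mult_right_mono one_minus_powr_le_exp) auto
    also have "\<dots> = exp (\<tau> * (r * ((1 - r) * k + c1 / ?q)))" by (simp add: exp_add[symmetric] algebra_simps)
    also have "\<dots> \<le> exp (\<tau> * - \<rho>)" using rate tau by (intro iffD2[OF exp_le_cancel_iff] mult_left_mono) auto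
    finally show "?q powr (- r) * exp (r * \<tau> * ((1 - r) * k)) \<le> exp (- \<rho> * \<tau>)" by (simp add: mult.commute)
    have "?q powr (- r) * (C * \<tau> + c) \<le> 2 * (C * \<tau> + c)" using qr C tau c by (intro mult_right_mono) auto
    then show "?q powr (- r) * (C * \<tau> + c) \<le> 2 * (C + D powr (r - 1) * c2) * \<tau>" by (simp add: c_def algebra_simps)
  qed simp
  finally show ?thesis .
qed

text \<open>Taken at the implicit image because that quantity has an explicit update: its next value
  is the present state plus the Brownian increment times g, whose conditional second moment is known
  exactly.\<close>

definition energy :: "real \<Rightarrow> 'a \<Rightarrow> real" where
  "energy \<tau> y = 1 + (norm (y - \<tau> *\<^sub>R f y))\<^sup>2"

text \<open>Energy divided by its growth factor is a positive supermartingale, so the maximal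
  inequality for powers below 1 applies. The constant depends on the elapsed time and not on the
  number of steps.\<close>

lemma chain_sup_moment:
  assumes Y: "chain t0 \<tau> Y" and \<tau>: "small \<tau>" and t0: "t0 \<ge> 0" and r: "0 < r" "r < 1"
  shows "(\<integral>\<^sup>+\<omega>. ennreal (running_max (\<lambda>i \<omega>. energy \<tau> (Y i \<omega>)) n \<omega> powr r) \<partial>M)
    \<le> ennreal (exp (2 * (c1 + c2) * (real n * \<tau>)) / (1 - r)) * (\<integral>\<^sup>+\<omega>. ennreal (energy \<tau> (Y 0 \<omega>) powr r) \<partial>M)"
proof -
  interpret discrete_filtration M "\<lambda>i. F (t0 + real i * \<tau>)"
    using \<tau> by (intro grid_filtration) (auto simp: small_def)
  have tau: "0 < \<tau>" using \<tau> by (auto simp: small_def)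
  let ?c = "1 + 2 * (c1 + c2) * \<tau>"
  have c: "?c \<ge> 1" using pos tau by simp
  have Ym: "Y i \<in> borel_measurable (F (t0 + real i * \<tau>))" for i by (rule chain_adapted[OF Y \<tau> t0])
  have "(\<integral>\<^sup>+\<omega>. ennreal (running_max (\<lambda>i \<omega>. energy \<tau> (Y i \<omega>)) n \<omega> powr r) \<partial>M)
    \<le> ennreal (?c ^ n / (1 - r)) * (\<integral>\<^sup>+\<omega>. ennreal (energy \<tau> (Y 0 \<omega>) powr r) \<partial>M)"
  proof (rule running_max_powr_growth)
    fix i
    show "(\<lambda>\<omega>. energy \<tau> (Y i \<omega>)) \<in> borel_measurable (F (t0 + real i * \<tau>))"
      unfolding energy_def using Ym[of i] by measurable
    show "energy \<tau> (Y i \<omega>) > 0" for \<omega> by (simp add: energy_def add_pos_nonneg)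
    fix v :: "'m \<Rightarrow> ennreal" assume v[measurable]: "v \<in> borel_measurable (F (t0 + real i * \<tau>))"
    let ?t = "t0 + real i * \<tau>" and ?t' = "t0 + real (Suc i) * \<tau>"
    have t: "0 \<le> ?t" "?t < ?t'" "?t' - ?t = \<tau>" using tau t0 by (auto simp: algebra_simps)
    note Ym[of i, measurable]
    have [measurable]: "Y i \<in> borel_measurable M" "v \<in> borel_measurable M"
      using F_M[OF v] F_M[OF Ym[of i]] by auto
    have tM: "0 \<le> t0 + real i * \<tau>" "t0 + real i * \<tau> \<le> t0 + real (Suc i) * \<tau>" using t by auto
    note [measurable] = increment_measurable_M[OF tM]
    have "(\<integral>\<^sup>+\<omega>. v \<omega> * ennreal (energy \<tau> (Y (Suc i) \<omega>)) \<partial>M)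
      = (\<integral>\<^sup>+\<omega>. v \<omega> + v \<omega> * ennreal ((norm (Y i \<omega> + (W ?t' \<omega> - W ?t \<omega>) *\<^sub>R g (Y i \<omega>)))\<^sup>2) \<partial>M)"
      by (intro nn_integral_cong) (simp add: energy_def chain_implicit[OF Y] ennreal_plus distrib_left del: of_nat_Suc)
    also have "\<dots> = (\<integral>\<^sup>+\<omega>. v \<omega> \<partial>M) + (\<integral>\<^sup>+\<omega>. v \<omega> * ennreal ((norm (Y i \<omega> + (W ?t' \<omega> - W ?t \<omega>) *\<^sub>R g (Y i \<omega>)))\<^sup>2) \<partial>M)"
      by (rule nn_integral_add) measurable
    also have "\<dots> = (\<integral>\<^sup>+\<omega>. v \<omega> \<partial>M) + (\<integral>\<^sup>+\<omega>. v \<omega> * ennreal ((norm (Y i \<omega>))\<^sup>2 + \<tau> * (norm (g (Y i \<omega>)))\<^sup>2) \<partial>M)"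
      using increment_second_moment[OF t(1,2), of "Y i" "\<lambda>\<omega>. g (Y i \<omega>)" v] t(3) by simp
    also have "\<dots> = (\<integral>\<^sup>+\<omega>. v \<omega> + v \<omega> * ennreal ((norm (Y i \<omega>))\<^sup>2 + \<tau> * (norm (g (Y i \<omega>)))\<^sup>2) \<partial>M)"
      by (rule nn_integral_add[symmetric]) measurable
    also have "\<dots> \<le> (\<integral>\<^sup>+\<omega>. ennreal ?c * (v \<omega> * ennreal (energy \<tau> (Y i \<omega>))) \<partial>M)"
    proof (rule nn_integral_mono)
      fix \<omega>
      have "v \<omega> + v \<omega> * ennreal ((norm (Y i \<omega>))\<^sup>2 + \<tau> * (norm (g (Y i \<omega>)))\<^sup>2)
        = v \<omega> * ennreal (1 + (norm (Y i \<omega>))\<^sup>2 + \<tau> * (norm (g (Y i \<omega>)))\<^sup>2)"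
        using tau by (simp add: ennreal_plus distrib_left add.assoc)
      also have "\<dots> \<le> v \<omega> * ennreal (?c * energy \<tau> (Y i \<omega>))"
        unfolding energy_def by (intro mult_left_mono ennreal_leI one_step_energy[OF \<tau>]) auto
      also have "\<dots> = ennreal ?c * (v \<omega> * ennreal (energy \<tau> (Y i \<omega>)))"
      proof -
        have "ennreal (?c * x) = ennreal ?c * ennreal x" for x by (rule ennreal_mult') (use c in simp)
        then show ?thesis by (simp only: mult.left_commute)
      qed
      finally show "v \<omega> + v \<omega> * ennreal ((norm (Y i \<omega>))\<^sup>2 + \<tau> * (norm (g (Y i \<omega>)))\<^sup>2) \<le> ennreal ?c * (v \<omega> * ennreal (energy \<tau> (Y i \<omega>)))" .
    qed
    also have "\<dots> = ennreal ?c * (\<integral>\<^sup>+\<omega>. v \<omega> * ennreal (energy \<tau> (Y i \<omega>)) \<partial>M)"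
      unfolding energy_def by (rule nn_integral_cmult) measurable
    finally show "(\<integral>\<^sup>+\<omega>. v \<omega> * ennreal (energy \<tau> (Y (Suc i) \<omega>)) \<partial>M) \<le> ennreal ?c * (\<integral>\<^sup>+\<omega>. v \<omega> * ennreal (energy \<tau> (Y i \<omega>)) \<partial>M)" .
  qed (use c r in auto)
  also have "\<dots> \<le> ennreal (exp (2 * (c1 + c2) * (real n * \<tau>)) / (1 - r)) * (\<integral>\<^sup>+\<omega>. ennreal (energy \<tau> (Y 0 \<omega>) powr r) \<partial>M)"
  proof (intro mult_right_mono ennreal_leI divide_right_mono)
    have "?c ^ n \<le> exp (2 * (c1 + c2) * \<tau>) ^ n"
      using c by (intro power_mono exp_ge_add_one_self) auto
    then show "?c ^ n \<le> exp (2 * (c1 + c2) * (real n * \<tau>))" by (simp add: exp_of_nat_mult[symmetric] mult_ac)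
  qed (use r in auto)
  finally show ?thesis .
qed

text \<open>Stated for abstract A, B and e because it drives two comparisons: fine against coarse
  scheme, and exact solution against scheme.\<close>

lemma error_process_step:
  fixes A B e :: "'m \<Rightarrow> 'a" and v :: "'m \<Rightarrow> ennreal"
  assumes st: "0 \<le> s" "s < t" and m[measurable]: "A \<in> borel_measurable (F s)" "B \<in> borel_measurable (F s)" "e \<in> borel_measurable (F s)"
    and v[measurable]: "v \<in> borel_measurable (F s)"
    and e': "\<And>\<omega>. \<omega> \<in> space M \<Longrightarrow> e' \<omega> = e \<omega> + (t - s) *\<^sub>R (f (A \<omega>) - f (B \<omega>)) + (W t \<omega> - W s \<omega>) *\<^sub>R (g (A \<omega>) - g (B \<omega>))"
  shows "(\<integral>\<^sup>+\<omega>. v \<omega> * ennreal ((norm (e' \<omega>))\<^sup>2) \<partial>M)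
    \<le> ennreal (1 + 2 * (c3 + 1) * (t - s)) * (\<integral>\<^sup>+\<omega>. v \<omega> * ennreal ((norm (e \<omega>))\<^sup>2
        + (t - s) * (Ca * (weight (A \<omega>) (B \<omega>))\<^sup>2 * ((norm (e \<omega> - (A \<omega> - B \<omega>)))\<^sup>2 + (t - s)))) \<partial>M)"
proof -
  have [measurable]: "A \<in> borel_measurable M" "B \<in> borel_measurable M" "e \<in> borel_measurable M" "v \<in> borel_measurable M"
    by (rule F_M, rule m v)+
  let ?c = "1 + 2 * (c3 + 1) * (t - s)"
  have c: "?c \<ge> 0" using st pos by simp
  have "(\<integral>\<^sup>+\<omega>. v \<omega> * ennreal ((norm (e' \<omega>))\<^sup>2) \<partial>M)
    = (\<integral>\<^sup>+\<omega>. v \<omega> * ennreal ((norm ((e \<omega> + (t - s) *\<^sub>R (f (A \<omega>) - f (B \<omega>))) + (W t \<omega> - W s \<omega>) *\<^sub>R (g (A \<omega>) - g (B \<omega>))))\<^sup>2) \<partial>M)"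
    by (intro nn_integral_cong) (simp add: e')
  also have "\<dots> = (\<integral>\<^sup>+\<omega>. v \<omega> * ennreal ((norm (e \<omega> + (t - s) *\<^sub>R (f (A \<omega>) - f (B \<omega>))))\<^sup>2 + (t - s) * (norm (g (A \<omega>) - g (B \<omega>)))\<^sup>2) \<partial>M)"
    by (rule increment_second_moment[OF st]) measurable
  also have "\<dots> \<le> (\<integral>\<^sup>+\<omega>. ennreal ?c * (v \<omega> * ennreal ((norm (e \<omega>))\<^sup>2
        + (t - s) * (Ca * (weight (A \<omega>) (B \<omega>))\<^sup>2 * ((norm (e \<omega> - (A \<omega> - B \<omega>)))\<^sup>2 + (t - s))))) \<partial>M)"
  proof (rule nn_integral_mono)
    fix \<omega>
    let ?a = "(norm (e \<omega>))\<^sup>2 + (t - s) * (Ca * (weight (A \<omega>) (B \<omega>))\<^sup>2 * ((norm (e \<omega> - (A \<omega> - B \<omega>)))\<^sup>2 + (t - s)))"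
    have "v \<omega> * ennreal ((norm (e \<omega> + (t - s) *\<^sub>R (f (A \<omega>) - f (B \<omega>))))\<^sup>2 + (t - s) * (norm (g (A \<omega>) - g (B \<omega>)))\<^sup>2)
      \<le> v \<omega> * ennreal (?c * ?a)"
      using st by (intro mult_left_mono ennreal_leI error_step) auto
    also have "\<dots> = ennreal ?c * (v \<omega> * ennreal ?a)"
      using c by (simp add: ennreal_mult' mult_ac)
    finally show "v \<omega> * ennreal ((norm (e \<omega> + (t - s) *\<^sub>R (f (A \<omega>) - f (B \<omega>))))\<^sup>2 + (t - s) * (norm (g (A \<omega>) - g (B \<omega>)))\<^sup>2) \<le> ennreal ?c * (v \<omega> * ennreal ?a)" .
  qed
  also have "\<dots> = ennreal ?c * (\<integral>\<^sup>+\<omega>. v \<omega> * ennreal ((norm (e \<omega>))\<^sup>2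
        + (t - s) * (Ca * (weight (A \<omega>) (B \<omega>))\<^sup>2 * ((norm (e \<omega> - (A \<omega> - B \<omega>)))\<^sup>2 + (t - s)))) \<partial>M)"
    by (rule nn_integral_cmult) measurable
  finally show ?thesis .
qed

end

section \<open>Strong error on a bounded time window\<close>

lemma mult_le_sum_squares:
  fixes x y :: real
  assumes "x \<ge> 0" "y \<ge> 0"
  shows "x * y \<le> x\<^sup>2 + y\<^sup>2"
  using sum_squares_bound[of x y] mult_nonneg_nonneg[OF assms] unfolding mult.assoc by linarith

context bem
begin

lemma energy_ge_1: "1 \<le> energy \<tau> y"
  by (simp add: energy_def)

definition Cw :: real where "Cw = (3 + 2 * (c1 + c2)) ^ (8 * Suc d)"

lemma Cw_ge_1: "1 \<le> Cw"
  unfolding Cw_def using pos by (intro one_le_power) auto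

text \<open>\<open>1 + a + b \<le> (1 + a) * (1 + b)\<close> separates the two chains, whose step
  sizes and hence energies differ. The fourth power occurs because the source contains the squared
  weight once from the error step and once from the remainder.\<close>

lemma weight_le_energy:
  assumes "small \<tau>" "small h"
  shows "weight x y ^ 4 \<le> Cw * (energy \<tau> x * energy h y) ^ (2 * Suc d)"
proof -
  let ?c = "3 + 2 * (c1 + c2)"
  have "1 + norm x + norm y \<le> (1 + norm x) * (1 + norm y)" by (simp add: algebra_simps)
  also have "\<dots> \<le> (?c * sqrt (energy \<tau> x)) * (?c * sqrt (energy h y))"
    using norm_le_implicit assms pos unfolding energy_def by (intro mult_mono) auto
  also have "\<dots> = ?c\<^sup>2 * sqrt (energy \<tau> x * energy h y)" by (simp add: real_sqrt_mult power2_eq_square)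
  finally have "(1 + norm x + norm y) ^ (4 * Suc d) \<le> (?c\<^sup>2 * sqrt (energy \<tau> x * energy h y)) ^ (4 * Suc d)"
    by (intro power_mono) auto
  also have "\<dots> = Cw * ((sqrt (energy \<tau> x * energy h y))\<^sup>2) ^ (2 * Suc d)"
  proof -
    have "4 * Suc d = 2 * (2 * Suc d)" "8 * Suc d = 2 * (4 * Suc d)" by simp_all
    then show ?thesis unfolding Cw_def by (metis power_mult power_mult_distrib)
  qed
  also have "(sqrt (energy \<tau> x * energy h y))\<^sup>2 = energy \<tau> x * energy h y"
    by (simp add: energy_def)
  finally show ?thesis unfolding weight_def by (simp add: power_mult[symmetric] mult.commute del: power_Suc)
qed

lemma energy_growth:
  assumes "small \<tau>"
  shows "energy \<tau> y \<le> (2 + L)\<^sup>2 * (1 + norm y) ^ (2 * Suc d)"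
proof -
  have t: "0 < \<tau>" "\<tau> \<le> 1" using assms by (auto simp: small_def)
  let ?w = "(1 + norm y) ^ Suc d"
  have w: "1 \<le> ?w" by (rule one_le_power) simp
  have y: "norm y \<le> ?w"
  proof -
    have "norm y \<le> (1 + norm y) ^ 1" by simp
    also have "\<dots> \<le> ?w" by (rule power_increasing) auto
    finally show ?thesis .
  qed
  have "norm (y - \<tau> *\<^sub>R f y) \<le> norm y + \<tau> * norm (f y)"
    using norm_triangle_ineq4[of y "\<tau> *\<^sub>R f y"] t by simp
  also have "\<tau> * norm (f y) \<le> 1 * (L * ?w)" using t f_growth by (intro mult_mono) auto
  finally have n: "norm (y - \<tau> *\<^sub>R f y) \<le> (1 + L) * ?w" using y by (simp add: algebra_simps)
  have "energy \<tau> y \<le> (1 + norm (y - \<tau> *\<^sub>R f y))\<^sup>2" by (simp add: energy_def power2_sum)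
  also have "\<dots> \<le> ((2 + L) * ?w)\<^sup>2" using n w by (intro power_mono) (auto simp: algebra_simps)
  also have "\<dots> = (2 + L)\<^sup>2 * (1 + norm y) ^ (2 * Suc d)"
    by (simp only: power_mult_distrib power_mult[symmetric] mult.commute)
  finally show ?thesis .
qed

lemma increment_variance:
  assumes "0 \<le> s" "s \<le> t"
  shows "(\<integral>\<^sup>+\<omega>. ennreal ((W t \<omega> - W s \<omega>)\<^sup>2) \<partial>M) = ennreal (t - s)"
proof (cases "s = t")
  case False
  then show ?thesis
    using increment_second_moment[of s t "\<lambda>_. 0 :: real" "\<lambda>_. 1" "\<lambda>_. 1"] assms by (simp add: emeasure_space_1)
qed simp

text \<open>\<open>coarse h \<tau> m t0 X i\<close> interpolates \<open>X k - h f (X k)\<close>, which unlike \<open>X\<close> itself is driven explicitly, to the fine grid.\<close>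

definition coarse :: "real \<Rightarrow> real \<Rightarrow> nat \<Rightarrow> real \<Rightarrow> (nat \<Rightarrow> 'm \<Rightarrow> 'a) \<Rightarrow> nat \<Rightarrow> 'm \<Rightarrow> 'a" where
  "coarse h \<tau> m t0 X i \<omega> = X (i div m) \<omega> - h *\<^sub>R f (X (i div m) \<omega>) + (real (i mod m) * \<tau>) *\<^sub>R f (X (i div m) \<omega>)
     + (W (t0 + real i * \<tau>) \<omega> - W (t0 + real (i div m) * h) \<omega>) *\<^sub>R g (X (i div m) \<omega>)"

text \<open>At the end of a coarse cell \<open>i div m\<close> jumps, and the scheme equation says
  that the interpolation arrives exactly at the implicit image of the new state. So the increment
  formula has no exception at coarse grid points.\<close>

lemma coarse_Suc:
  assumes X: "chain t0 h X" and m: "m > 0" and h: "h = real m * \<tau>" and \<omega>: "\<omega> \<in> space M"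
  shows "coarse h \<tau> m t0 X (Suc i) \<omega> = coarse h \<tau> m t0 X i \<omega> + \<tau> *\<^sub>R f (X (i div m) \<omega>)
     + (W (t0 + real (Suc i) * \<tau>) \<omega> - W (t0 + real i * \<tau>) \<omega>) *\<^sub>R g (X (i div m) \<omega>)"
proof (cases "Suc (i mod m) = m")
  case True
  then have d: "Suc i div m = Suc (i div m)" "Suc i mod m = 0" by (simp_all add: div_Suc mod_Suc)
  have "Suc i = Suc (i div m) * m" using d by (metis add.right_neutral div_mult_mod_eq)
  then have t: "real (Suc i) * \<tau> = real (Suc (i div m)) * h" unfolding h by (metis mult.assoc of_nat_mult)
  have "real (Suc (i mod m)) * \<tau> = h" using True h by simp
  then have hm: "h = real (i mod m) * \<tau> + \<tau>" by (simp add: algebra_simps)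
  have 1: "coarse h \<tau> m t0 X (Suc i) \<omega> = X (Suc (i div m)) \<omega> - h *\<^sub>R f (X (Suc (i div m)) \<omega>)"
    unfolding coarse_def d t by simp
  also have "\<dots> = X (i div m) \<omega> + (W (t0 + real (Suc i) * \<tau>) \<omega> - W (t0 + real (i div m) * h) \<omega>) *\<^sub>R g (X (i div m) \<omega>)"
    unfolding chain_implicit[OF X \<omega>] t ..
  finally show ?thesis
    unfolding coarse_def by (simp add: hm algebra_simps)
next
  case False
  then have d: "Suc i div m = i div m" "Suc i mod m = Suc (i mod m)" by (simp_all add: div_Suc mod_Suc)
  show ?thesis unfolding coarse_def d by (simp add: algebra_simps)
qed

text \<open>The difference consists of f at the two states, each with a factor at most h, and of g
  times the Brownian increment w since the last coarse time. With h \<le> 1 its square is therefore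
  a squared weight times h + w^2.\<close>

lemma coarse_remainder:
  assumes m: "m > 0" and h: "h = real m * \<tau>" and \<tau>: "0 < \<tau>" and h1: "h \<le> 1"
    and w_def: "w = W (t0 + real i * \<tau>) \<omega> - W (t0 + real (i div m) * h) \<omega>"
  shows "(norm ((y - \<tau> *\<^sub>R f y - coarse h \<tau> m t0 X i \<omega>) - (y - X (i div m) \<omega>)))\<^sup>2
    \<le> 6 * L\<^sup>2 * (weight y (X (i div m) \<omega>))\<^sup>2 * (h + w\<^sup>2)"
proof -
  let ?x = "X (i div m) \<omega>" and ?l = "real (i mod m) * \<tau>"
  let ?K = "L * weight y ?x"
  have th: "\<tau> \<le> h" using m \<tau> unfolding h by (simp add: mult_le_cancel_right1)
  have l: "0 \<le> h - ?l" "h - ?l \<le> h"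
    using m \<tau> mult_right_mono[of "real (i mod m)" "real m" \<tau>] unfolding h by (auto simp: less_imp_le)
  have "(y - \<tau> *\<^sub>R f y - coarse h \<tau> m t0 X i \<omega>) - (y - ?x) = (h - ?l) *\<^sub>R f ?x + (- (w *\<^sub>R g ?x)) + (- (\<tau> *\<^sub>R f y))"
    unfolding coarse_def w_def by (simp add: algebra_simps)
  also have "norm \<dots> \<le> norm ((h - ?l) *\<^sub>R f ?x) + norm (- (w *\<^sub>R g ?x)) + norm (- (\<tau> *\<^sub>R f y))"
    by (intro order_trans[OF norm_triangle_ineq] add_right_mono norm_triangle_ineq)
  also have "\<dots> = (h - ?l) * norm (f ?x) + \<bar>w\<bar> * norm (g ?x) + \<tau> * norm (f y)"
    using l \<tau> by simp
  also have "\<dots> \<le> h * ?K + \<bar>w\<bar> * ?K + h * ?K"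
    using l \<tau> th by (intro add_mono mult_mono growth_weight) auto
  finally have "norm ((y - \<tau> *\<^sub>R f y - coarse h \<tau> m t0 X i \<omega>) - (y - ?x)) \<le> ?K * (2 * h + \<bar>w\<bar>)"
    by (simp add: algebra_simps)
  then have "(norm ((y - \<tau> *\<^sub>R f y - coarse h \<tau> m t0 X i \<omega>) - (y - ?x)))\<^sup>2 \<le> (?K * (2 * h + \<bar>w\<bar>))\<^sup>2"
    by (intro power_mono) auto
  also have "\<dots> = ?K\<^sup>2 * (2 * h + \<bar>w\<bar>)\<^sup>2" by (rule power_mult_distrib)
  also have "\<dots> \<le> ?K\<^sup>2 * (6 * (h + w\<^sup>2))"
  proof (rule mult_left_mono)
    have "(2 * h + u)\<^sup>2 \<le> 6 * (h + u\<^sup>2)" for u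
    proof -
      have 1: "2 * (h * u) \<le> h\<^sup>2 + u\<^sup>2" using sum_squares_bound[of h u] by (simp add: mult.assoc)
      have 2: "h\<^sup>2 \<le> h" using h1 th \<tau> by (simp add: power2_eq_square mult_left_le)
      have 3: "(2 * h + u)\<^sup>2 = 4 * h\<^sup>2 + 4 * (h * u) + u\<^sup>2" by (simp add: power2_eq_square algebra_simps)
      show ?thesis unfolding 3 using 1 2 zero_le_power2[of u] unfolding distrib_left by linarith
    qed
    from this[of "\<bar>w\<bar>"] show "(2 * h + \<bar>w\<bar>)\<^sup>2 \<le> 6 * (h + w\<^sup>2)" by simp
  qed simp
  also have "\<dots> = 6 * L\<^sup>2 * (weight y ?x)\<^sup>2 * (h + w\<^sup>2)" by (simp only: power_mult_distrib mult_ac)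
  finally show ?thesis .
qed

text \<open>C is chosen before m, N, t0 and the chains; uniformity in m is what allows the fine grid
  to be refined up to the solution. The moment exponent 16 (d + 1)^2 s is the product of the power q
  = 8 (d + 1) s of the maximal energies used below and of the degree 2 (d + 1) of the energy in the
  state.\<close>

lemma window_error:
  assumes s: "0 < s" "16 * real (Suc d) ^ 2 * s \<le> 1" and T: "T \<ge> 0" and Bm: "Bm \<ge> 0"
  shows "\<exists>C\<ge>0. \<forall>t0 h \<tau> m N X Y. t0 \<ge> 0 \<longrightarrow> small h \<longrightarrow> m > 0 \<longrightarrow> h = real m * \<tau> \<longrightarrow> real N * h \<le> T \<longrightarrow>
     chain t0 h X \<longrightarrow> chain t0 \<tau> Y \<longrightarrow> X 0 = Y 0 \<longrightarrow>
     (\<integral>\<^sup>+\<omega>. ennreal ((1 + norm (Y 0 \<omega>)) powr (16 * real (Suc d) ^ 2 * s)) \<partial>M) \<le> ennreal Bm \<longrightarrow>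
     (\<integral>\<^sup>+\<omega>. ennreal (gap h (Y (N * m) \<omega>) (X N \<omega>) powr s) \<partial>M) \<le> ennreal (C * h powr s)"
proof -
  let ?D = "real (Suc d)"
  \<comment> \<open>\<open>P\<close> below is the 2 (d + 1)-th power of a product of two maximal
    energies; its 2s-th power splits by \<open>x * y \<le> x\<^sup>2 + y\<^sup>2\<close> into the
    q-th powers of the two factors.\<close>
  define q where "q = 8 * ?D * s"
  have D1: "?D \<ge> 1" by simp
  have q: "0 < q" "q \<le> 1/2" "2 * s \<le> 1" "s < 1"
  proof -
    have "?D * (16 * s) \<le> ?D * (?D * (16 * s))" using s D1 by (intro mult_left_mono) (auto simp: mult_le_cancel_right1)
    also have "\<dots> \<le> 1" using s by (simp add: power2_eq_square mult_ac)
    finally have *: "?D * (16 * s) \<le> 1" .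
    have "q = ?D * (16 * s) / 2" by (simp add: q_def)
    with * show "q \<le> 1/2" by linarith
    have "1 * (16 * s) \<le> ?D * (16 * s)" using s D1 by (intro mult_right_mono) auto
    then show "2 * s \<le> 1" "s < 1" using * s by linarith+
    show "0 < q" using s by (simp add: q_def)
  qed
  \<comment> \<open>\<open>C1\<close> gathers the shift h, the initial error and the accumulated
    source; \<open>C2\<close> is what the passage from e to \<open>gap\<close> adds;
    \<open>Cg\<close> is the domination constant and \<open>Ce\<close> bounds the q-th moments of
    the maximal energies.\<close>
  define C1 where "C1 = 1 + L\<^sup>2 * Cw + Ca * (6 * L\<^sup>2 + 1) * Cw"
  define C2 where "C2 = (12 * L\<^sup>2 + 4 * l2 * L\<^sup>2) * Cw"
  define Cg where "Cg = exp (2 * (c3 + 1) * T) / s + 1"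
  define Ce where "Ce = exp (2 * (c1 + c2) * T) / (1 - q) * ((2 + L) powr (2 * q) * Bm)"
  define C where "C = 2 * (Cg * (C1 powr s * (2 * Ce + 2 + 2 * T))) + (1 + C2) * (2 * Ce)"
  have C1: "C1 \<ge> 1" using L_pos Ca_pos Cw_ge_1 by (auto simp: C1_def)
  have C2: "C2 \<ge> 0" using pos Cw_ge_1 by (auto simp: C2_def)
  have Cg: "Cg \<ge> 0" using s by (auto simp: Cg_def)
  have Ce: "Ce \<ge> 0" using q Bm by (auto simp: Ce_def)
  have C: "C \<ge> 0" using C1 C2 Cg Ce T by (auto simp: C_def)
  show ?thesis
  proof (intro exI[of _ C] conjI C allI impI)
    fix t0 h \<tau> :: real and m N :: nat and X Y :: "nat \<Rightarrow> 'm \<Rightarrow> 'a"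
    assume t0: "t0 \<ge> 0" and sh: "small h" and m: "m > 0" and h: "h = real m * \<tau>" and N: "real N * h \<le> T"
      and X: "chain t0 h X" and Y: "chain t0 \<tau> Y" and XY0: "X 0 = Y 0"
      and mom: "(\<integral>\<^sup>+\<omega>. ennreal ((1 + norm (Y 0 \<omega>)) powr (16 * ?D ^ 2 * s)) \<partial>M) \<le> ennreal Bm"
    have h0: "0 < h" "h \<le> 1" using sh by (auto simp: small_def)
    then have \<tau>0: "0 < \<tau>" using m by (auto simp: h zero_less_mult_iff)
    have \<tau>h: "\<tau> \<le> h" using m \<tau>0 unfolding h by (simp add: mult_le_cancel_right1)
    have st: "small \<tau>" by (rule small_mono[OF sh \<tau>0 \<tau>h])
    interpret discrete_filtration M "\<lambda>i. F (t0 + real i * \<tau>)" using \<tau>0 by (intro grid_filtration) auto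
    define n where "n = N * m"
    have n\<tau>: "real n * \<tau> = real N * h" by (simp add: n_def h)
    define B where "B i = X (i div m)" for i
    \<comment> \<open>The difference of the two explicitly driven quantities. Below, w is the
      Brownian increment since the last coarse time and a the source of the one-step
      inequality.\<close>
    define e where "e i \<omega> = Y i \<omega> - \<tau> *\<^sub>R f (Y i \<omega>) - coarse h \<tau> m t0 X i \<omega>" for i \<omega>
    define w where "w i \<omega> = W (t0 + real i * \<tau>) \<omega> - W (t0 + real (i div m) * h) \<omega>" for i \<omega>
    define a where "a i \<omega> = \<tau> * (Ca * (weight (Y i \<omega>) (B i \<omega>))\<^sup>2 * ((norm (e i \<omega> - (Y i \<omega> - B i \<omega>)))\<^sup>2 + \<tau>))" for i \<omega>
    have grid_le: "real (i div m) * h \<le> real i * \<tau>" for i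
    proof -
      have "real (i div m * m) \<le> real i" by (intro of_nat_mono) simp
      from mult_right_mono[OF this, of \<tau>] show ?thesis using \<tau>0 by (simp add: h mult.assoc)
    qed
    have Ym: "Y i \<in> borel_measurable (F (t0 + real i * \<tau>))" for i by (rule chain_adapted[OF Y st t0])
    have Bm': "B i \<in> borel_measurable (F (t0 + real i * \<tau>))" for i
      unfolding B_def by (rule F_mono[OF chain_adapted[OF X sh t0]]) (simp add: grid_le)
    have wm: "w i \<in> borel_measurable (F (t0 + real i * \<tau>))" for i
      unfolding w_def using t0 h0 \<tau>0 by (intro increment_measurable) (auto simp: grid_le)
    have em: "e i \<in> borel_measurable (F (t0 + real i * \<tau>))" for i
      unfolding e_def coarse_def B_def[symmetric] w_def[symmetric] using Ym[of i] Bm'[of i] wm[of i] by measurable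
    have am: "a i \<in> borel_measurable (F (t0 + real i * \<tau>))" for i
      unfolding a_def using Ym[of i] Bm'[of i] em[of i] by measurable
    note M[measurable] = G_M[OF Ym] G_M[OF Bm'] G_M[OF wm] G_M[OF em] G_M[OF am]
    have a0: "a i \<omega> \<ge> 0" for i \<omega> unfolding a_def using \<tau>0 Ca_pos by simp
    let ?c = "1 + 2 * (c3 + 1) * \<tau>"
    \<comment> \<open>The free shift \<delta> of the domination is taken equal to h, the order of
      the accumulated source.\<close>
    have dom: "(\<integral>\<^sup>+\<omega>. ennreal ((norm (e n \<omega>))\<^sup>2 powr s) \<partial>M) \<le>
      ennreal (?c ^ n / s + 1) * (\<integral>\<^sup>+\<omega>. ennreal ((h + (norm (e 0 \<omega>))\<^sup>2 + (\<Sum>l<n. a l \<omega>)) powr s) \<partial>M)"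
    proof (rule powr_domination)
      show "(\<lambda>\<omega>. (norm (e 0 \<omega>))\<^sup>2) \<in> borel_measurable (F (t0 + real 0 * \<tau>))" using em[of 0] by measurable
      fix i :: nat and v :: "'m \<Rightarrow> ennreal"
      show "(\<lambda>\<omega>. (norm (e i \<omega>))\<^sup>2) \<in> borel_measurable M" by measurable
      assume v: "v \<in> borel_measurable (F (t0 + real i * \<tau>))"
      have ts: "t0 + real (Suc i) * \<tau> - (t0 + real i * \<tau>) = \<tau>" by (simp add: algebra_simps)
      have "(\<integral>\<^sup>+\<omega>. v \<omega> * ennreal ((norm (e (Suc i) \<omega>))\<^sup>2) \<partial>M)
        \<le> ennreal (1 + 2 * (c3 + 1) * (t0 + real (Suc i) * \<tau> - (t0 + real i * \<tau>))) * (\<integral>\<^sup>+\<omega>. v \<omega> * ennreal ((norm (e i \<omega>))\<^sup>2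
        + (t0 + real (Suc i) * \<tau> - (t0 + real i * \<tau>)) * (Ca * (weight (Y i \<omega>) (B i \<omega>))\<^sup>2 * ((norm (e i \<omega> - (Y i \<omega> - B i \<omega>)))\<^sup>2 + (t0 + real (Suc i) * \<tau> - (t0 + real i * \<tau>))))) \<partial>M)"
      proof (rule error_process_step[OF _ _ Ym Bm' em v])
        fix \<omega> assume \<omega>: "\<omega> \<in> space M"
        show "e (Suc i) \<omega> = e i \<omega> + (t0 + real (Suc i) * \<tau> - (t0 + real i * \<tau>)) *\<^sub>R (f (Y i \<omega>) - f (B i \<omega>))
           + (W (t0 + real (Suc i) * \<tau>) \<omega> - W (t0 + real i * \<tau>) \<omega>) *\<^sub>R (g (Y i \<omega>) - g (B i \<omega>))"
          unfolding ts e_def coarse_Suc[OF X m h \<omega>] chain_implicit[OF Y \<omega>] B_def by (simp add: algebra_simps)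
      qed (use t0 \<tau>0 in \<open>auto simp: algebra_simps\<close>)
      then show "(\<integral>\<^sup>+\<omega>. v \<omega> * ennreal ((norm (e (Suc i) \<omega>))\<^sup>2) \<partial>M)
        \<le> ennreal ?c * (\<integral>\<^sup>+\<omega>. v \<omega> * ennreal ((norm (e i \<omega>))\<^sup>2 + a i \<omega>) \<partial>M)"
        unfolding ts a_def .
    qed (use am a0 pos \<tau>0 s q h0 in auto)
    define R where "R = running_max (\<lambda>i \<omega>. energy \<tau> (Y i \<omega>)) n"
    define Q where "Q = running_max (\<lambda>i \<omega>. energy h (X i \<omega>)) N"
    \<comment> \<open>The weights vary along the window; one random factor built from both running
      maxima bounds them all and can be taken out of the sum.\<close>
    define P where "P \<omega> = (R \<omega> * Q \<omega>) ^ (2 * Suc d)" for \<omega>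
    have RQ1: "R \<omega> \<ge> 1" "Q \<omega> \<ge> 1" for \<omega>
      unfolding R_def Q_def
    using running_max_ge[of 0 n "\<lambda>i \<omega>. energy \<tau> (Y i \<omega>)" \<omega>] energy_ge_1[of \<tau> "Y 0 \<omega>"]
      running_max_ge[of 0 N "\<lambda>i \<omega>. energy h (X i \<omega>)" \<omega>] energy_ge_1[of h "X 0 \<omega>"] by auto
    have P1: "P \<omega> \<ge> 1" for \<omega>
    proof -
      have "1 * 1 \<le> R \<omega> * Q \<omega>" using RQ1[of \<omega>] by (intro mult_mono) auto
      then show ?thesis unfolding P_def by (intro one_le_power) simp
    qed
    have mom_max: "(\<integral>\<^sup>+\<omega>. ennreal (R \<omega> powr q) \<partial>M) \<le> ennreal Ce" "(\<integral>\<^sup>+\<omega>. ennreal (Q \<omega> powr q) \<partial>M) \<le> ennreal Ce"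
    proof -
      have *: "(\<integral>\<^sup>+\<omega>. ennreal (running_max (\<lambda>i \<omega>. energy u (Z i \<omega>)) k \<omega> powr q) \<partial>M) \<le> ennreal Ce"
        if Z: "chain t0 u Z" and u: "small u" and k: "real k * u \<le> T" and Z0: "Z 0 = Y 0" for Z u k
      proof -
        have [measurable]: "Z 0 \<in> borel_measurable M" using chain_measurable[OF Z u t0] .
        have "(\<integral>\<^sup>+\<omega>. ennreal (energy u (Z 0 \<omega>) powr q) \<partial>M)
          \<le> (\<integral>\<^sup>+\<omega>. ennreal ((2 + L) powr (2 * q)) * ennreal ((1 + norm (Z 0 \<omega>)) powr (16 * ?D ^ 2 * s)) \<partial>M)"
        proof (rule nn_integral_mono)
          fix \<omega>
          let ?y = "1 + norm (Z 0 \<omega>)"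
          have y: "?y > 0" by (simp add: add_pos_nonneg)
          have "energy u (Z 0 \<omega>) powr q \<le> ((2 + L)\<^sup>2 * ?y ^ (2 * Suc d)) powr q"
            using energy_growth[OF u] energy_ge_1[of u "Z 0 \<omega>"] q by (intro powr_mono2) auto
          also have "\<dots> = (2 + L) powr (2 * q) * ?y powr (16 * ?D ^ 2 * s)"
          proof -
            have pp: "(x ^ k) powr q = x powr (real k * q)" if "x > 0" for x :: real and k
              using that by (simp add: powr_realpow[symmetric] powr_powr)
            have ex: "real (2 * Suc d) * q = 16 * ?D ^ 2 * s" by (simp add: q_def power2_eq_square algebra_simps)
            have "((2 + L)\<^sup>2 * ?y ^ (2 * Suc d)) powr q = (2 + L)\<^sup>2 powr q * (?y ^ (2 * Suc d)) powr q"
              using y L_pos by (intro powr_mult)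
            then show ?thesis using pp[OF y, of "2 * Suc d"] pp[of "2 + L" 2] L_pos ex by simp
          qed
          finally show "ennreal (energy u (Z 0 \<omega>) powr q) \<le> ennreal ((2 + L) powr (2 * q)) * ennreal (?y powr (16 * ?D ^ 2 * s))"
            by (simp add: ennreal_mult[symmetric] ennreal_leI)
        qed
        also have "\<dots> = ennreal ((2 + L) powr (2 * q)) * (\<integral>\<^sup>+\<omega>. ennreal ((1 + norm (Z 0 \<omega>)) powr (16 * ?D ^ 2 * s)) \<partial>M)"
          by (rule nn_integral_cmult) measurable
        also have "\<dots> \<le> ennreal ((2 + L) powr (2 * q)) * ennreal Bm"
          using mom unfolding Z0 by (intro mult_left_mono) auto
        finally have E0: "(\<integral>\<^sup>+\<omega>. ennreal (energy u (Z 0 \<omega>) powr q) \<partial>M) \<le> ennreal ((2 + L) powr (2 * q) * Bm)"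
          using Bm by (simp add: ennreal_mult)
        have "(\<integral>\<^sup>+\<omega>. ennreal (running_max (\<lambda>i \<omega>. energy u (Z i \<omega>)) k \<omega> powr q) \<partial>M)
           \<le> ennreal (exp (2 * (c1 + c2) * (real k * u)) / (1 - q)) * (\<integral>\<^sup>+\<omega>. ennreal (energy u (Z 0 \<omega>) powr q) \<partial>M)"
          using q by (intro chain_sup_moment[OF Z u t0]) auto
        also have "\<dots> \<le> ennreal (exp (2 * (c1 + c2) * T) / (1 - q)) * ennreal ((2 + L) powr (2 * q) * Bm)"
          using q k pos by (intro mult_mono E0 ennreal_leI divide_right_mono iffD2[OF exp_le_cancel_iff] mult_left_mono) auto
        also have "\<dots> = ennreal Ce" unfolding Ce_def using q Bm by (simp add: ennreal_mult[symmetric])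
        finally show ?thesis .
      qed
      show "(\<integral>\<^sup>+\<omega>. ennreal (R \<omega> powr q) \<partial>M) \<le> ennreal Ce" unfolding R_def by (rule *[OF Y st]) (use n\<tau> N in auto)
      show "(\<integral>\<^sup>+\<omega>. ennreal (Q \<omega> powr q) \<partial>M) \<le> ennreal Ce" unfolding Q_def by (rule *[OF X sh N XY0])
    qed
    have wP: "weight (Y i \<omega>) (B i \<omega>) ^ 4 \<le> Cw * P \<omega>" if "i \<le> n" for i \<omega>
    proof -
      have "i div m \<le> N" using that m unfolding n_def by (metis div_le_mono nonzero_mult_div_cancel_right less_numeral_extra(3))
      then have "energy \<tau> (Y i \<omega>) \<le> R \<omega>" "energy h (B i \<omega>) \<le> Q \<omega>"
        unfolding R_def Q_def B_def using that
        using running_max_ge[of i n "\<lambda>i \<omega>. energy \<tau> (Y i \<omega>)" \<omega>] running_max_ge[of "i div m" N "\<lambda>i \<omega>. energy h (X i \<omega>)" \<omega>] by auto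
      then have "(energy \<tau> (Y i \<omega>) * energy h (B i \<omega>)) ^ (2 * Suc d) \<le> P \<omega>"
        unfolding P_def using energy_ge_1 RQ1 by (intro power_mono mult_mono) (meson order_trans zero_le_one mult_nonneg_nonneg)+
      then have "Cw * (energy \<tau> (Y i \<omega>) * energy h (B i \<omega>)) ^ (2 * Suc d) \<le> Cw * P \<omega>"
        using Cw_ge_1 by (intro mult_left_mono) auto
      with weight_le_energy[OF st sh] show ?thesis by (rule order_trans)
    qed
    have wP2: "weight (Y i \<omega>) (B i \<omega>) ^ 2 \<le> Cw * P \<omega>" if "i \<le> n" for i \<omega>
    proof -
      have "weight (Y i \<omega>) (B i \<omega>) ^ 2 \<le> weight (Y i \<omega>) (B i \<omega>) ^ 4"
        by (rule power_increasing) (simp_all add: weight_ge_1)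
      then show ?thesis using wP[OF that] by (rule order_trans)
    qed
    have rem: "(norm (e i \<omega> - (Y i \<omega> - B i \<omega>)))\<^sup>2 \<le> 6 * L\<^sup>2 * (weight (Y i \<omega>) (B i \<omega>))\<^sup>2 * (h + (w i \<omega>)\<^sup>2)" for i \<omega>
      unfolding e_def B_def w_def by (rule coarse_remainder[OF m h \<tau>0 h0(2) refl])
    have a_le: "a i \<omega> \<le> \<tau> * (Ca * (6 * L\<^sup>2 + 1) * Cw * P \<omega> * (h + (w i \<omega>)\<^sup>2))" if "i \<le> n" for i \<omega>
    proof -
      let ?w = "weight (Y i \<omega>) (B i \<omega>)" and ?h = "h + (w i \<omega>)\<^sup>2"
      have h': "0 \<le> ?h" using h0 by simp
      have w1: "1 \<le> ?w\<^sup>2" using weight_ge_1 by (simp add: one_le_power)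
      have "\<tau> \<le> 1 * ?h" using \<tau>h by (simp add: add_increasing2)
      also have "\<dots> \<le> ?w\<^sup>2 * ?h" using w1 h' by (intro mult_right_mono) auto
      finally have "(norm (e i \<omega> - (Y i \<omega> - B i \<omega>)))\<^sup>2 + \<tau> \<le> (6 * L\<^sup>2 + 1) * ?w\<^sup>2 * ?h"
        using rem[of i \<omega>] by (simp add: algebra_simps)
      then have "a i \<omega> \<le> \<tau> * (Ca * ?w\<^sup>2 * ((6 * L\<^sup>2 + 1) * ?w\<^sup>2 * ?h))"
        unfolding a_def using \<tau>0 Ca_pos by (intro mult_left_mono) auto
      also have "\<dots> = \<tau> * (Ca * (6 * L\<^sup>2 + 1) * ?h) * ?w ^ 4" by algebra
      also have "\<dots> \<le> \<tau> * (Ca * (6 * L\<^sup>2 + 1) * ?h) * (Cw * P \<omega>)"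
        using \<tau>0 Ca_pos h' by (intro mult_left_mono wP that mult_nonneg_nonneg) auto
      finally show ?thesis by (simp add: mult_ac)
    qed
    \<comment> \<open>The shifted total source is at most \<open>C1 * P * (h * H)\<close>. H
      collects the squared increments normalised by h, so its mean is bounded independently of
      m.\<close>
    define H where "H \<omega> = 1 + real n * \<tau> + \<tau> * (\<Sum>l<n. (w l \<omega>)\<^sup>2) / h" for \<omega>
    have H0: "H \<omega> \<ge> 0" for \<omega> unfolding H_def using \<tau>0 h0 by (intro add_nonneg_nonneg divide_nonneg_nonneg mult_nonneg_nonneg sum_nonneg) auto
    have e0: "(norm (e 0 \<omega>))\<^sup>2 \<le> h * L\<^sup>2 * (Cw * P \<omega>)" for \<omega>
    proof -
      have "e 0 \<omega> = (h - \<tau>) *\<^sub>R f (Y 0 \<omega>)" unfolding e_def coarse_def using XY0 by (simp add: algebra_simps)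
      then have "norm (e 0 \<omega>) = (h - \<tau>) * norm (f (Y 0 \<omega>))" using \<tau>h by simp
      also have "\<dots> \<le> h * (L * weight (Y 0 \<omega>) (B 0 \<omega>))"
        using \<tau>h \<tau>0 h0 by (intro mult_mono growth_weight) auto
      finally have "(norm (e 0 \<omega>))\<^sup>2 \<le> (h * (L * weight (Y 0 \<omega>) (B 0 \<omega>)))\<^sup>2" by (intro power_mono) auto
      also have "\<dots> = h\<^sup>2 * (L\<^sup>2 * (weight (Y 0 \<omega>) (B 0 \<omega>))\<^sup>2)" by (simp add: power_mult_distrib)
      also have "\<dots> \<le> h * (L\<^sup>2 * (Cw * P \<omega>))"
        using h0 by (intro mult_mono mult_left_mono wP2) (auto simp: power2_eq_square mult_left_le)
      finally show ?thesis by (simp add: mult_ac)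
    qed
    have S_le: "h + (norm (e 0 \<omega>))\<^sup>2 + (\<Sum>l<n. a l \<omega>) \<le> C1 * P \<omega> * (h * H \<omega>)" for \<omega>
    proof -
      have "(\<Sum>l<n. a l \<omega>) \<le> (\<Sum>l<n. \<tau> * (Ca * (6 * L\<^sup>2 + 1) * Cw * P \<omega> * (h + (w l \<omega>)\<^sup>2)))"
        by (intro sum_mono a_le) auto
      also have "\<dots> = Ca * (6 * L\<^sup>2 + 1) * Cw * P \<omega> * (h * (H \<omega> - 1))"
        using h0 by (simp add: H_def sum_distrib_left sum.distrib algebra_simps sum_divide_distrib)
      finally have 1: "(\<Sum>l<n. a l \<omega>) \<le> Ca * (6 * L\<^sup>2 + 1) * Cw * P \<omega> * (h * (H \<omega> - 1))" .
      have H1: "1 \<le> H \<omega>" unfolding H_def using \<tau>0 h0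
        by (simp add: add.assoc) (intro add_nonneg_nonneg divide_nonneg_nonneg mult_nonneg_nonneg sum_nonneg, auto)
      have 2: "h * L\<^sup>2 * (Cw * P \<omega>) \<le> L\<^sup>2 * Cw * P \<omega> * (h * H \<omega>)"
      proof -
        have "(h * L\<^sup>2 * (Cw * P \<omega>)) * 1 \<le> (h * L\<^sup>2 * (Cw * P \<omega>)) * H \<omega>"
          using H1 h0 Cw_ge_1 P1[of \<omega>] by (intro mult_left_mono mult_nonneg_nonneg) auto
        then show ?thesis by (simp add: mult_ac)
      qed
      have 3: "h \<le> 1 * P \<omega> * (h * H \<omega>)"
      proof -
        have "1 * (h * 1) \<le> P \<omega> * (h * H \<omega>)" using H1 h0 P1[of \<omega>] by (intro mult_mono) auto
        then show ?thesis by simp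
      qed
      have 4: "Ca * (6 * L\<^sup>2 + 1) * Cw * P \<omega> * (h * (H \<omega> - 1)) \<le> Ca * (6 * L\<^sup>2 + 1) * Cw * P \<omega> * (h * H \<omega>)"
        using h0 Cw_ge_1 P1[of \<omega>] Ca_pos by (intro mult_left_mono mult_nonneg_nonneg) auto
      show ?thesis using 1 2 3 4 e0[of \<omega>] unfolding C1_def distrib_right by linarith
    qed
    have P_pow: "P \<omega> powr (2 * s) \<le> R \<omega> powr q + Q \<omega> powr q" for \<omega>
    proof -
      have R0: "R \<omega> > 0" "Q \<omega> > 0" using RQ1[of \<omega>] by auto
      have "P \<omega> powr (2 * s) = R \<omega> powr (q / 2) * Q \<omega> powr (q / 2)"
      proof -
        have "real (2 * Suc d) * (2 * s) = q / 2" by (simp add: q_def algebra_simps)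
        moreover have "P \<omega> powr (2 * s) = (R \<omega> * Q \<omega>) powr (real (2 * Suc d) * (2 * s))"
          unfolding P_def using R0 by (simp only: powr_powr[symmetric] powr_realpow mult_pos_pos)
        ultimately have "P \<omega> powr (2 * s) = (R \<omega> * Q \<omega>) powr (q / 2)" by (simp only:)
        then show ?thesis using R0 by (simp add: powr_mult)
      qed
      also have "\<dots> \<le> (R \<omega> powr (q / 2))\<^sup>2 + (Q \<omega> powr (q / 2))\<^sup>2"
        by (intro mult_le_sum_squares) auto
      also have "\<dots> = R \<omega> powr q + Q \<omega> powr q"
        using R0 by (simp add: power2_eq_square powr_add[symmetric])
      finally show ?thesis .
    qed
    have S_pow: "(h + (norm (e 0 \<omega>))\<^sup>2 + (\<Sum>l<n. a l \<omega>)) powr s \<le> C1 powr s * h powr s * (R \<omega> powr q + Q \<omega> powr q + 1 + H \<omega>)" for \<omega>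
    proof -
      have Ppos: "P \<omega> > 0" using P1[of \<omega>] by linarith
      have "(h + (norm (e 0 \<omega>))\<^sup>2 + (\<Sum>l<n. a l \<omega>)) powr s \<le> (C1 * P \<omega> * (h * H \<omega>)) powr s"
        using S_le s h0 a0 by (intro powr_mono2 add_nonneg_nonneg sum_nonneg) auto
      also have "\<dots> = C1 powr s * h powr s * (P \<omega> powr s * H \<omega> powr s)"
        using C1 Ppos h0 H0[of \<omega>] by (simp add: powr_mult mult_ac)
      \<comment> \<open>Decoupling: P and H are dependent, and only small moments of P are
        available. Since 2 s \<le> 1, the factor H then needs no more than its mean.\<close>
      also have "P \<omega> powr s * H \<omega> powr s \<le> P \<omega> powr (2 * s) + H \<omega> powr (2 * s)"
      proof -
        have "P \<omega> powr s * H \<omega> powr s \<le> (P \<omega> powr s)\<^sup>2 + (H \<omega> powr s)\<^sup>2"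
          by (intro mult_le_sum_squares) auto
        then show ?thesis by (simp add: power2_eq_square powr_add[symmetric])
      qed
      also have "H \<omega> powr (2 * s) \<le> 1 + H \<omega>"
      proof -
        have "H \<omega> powr (2 * s) \<le> 1 + 2 * s * (H \<omega> - 1)" using s q H0 by (intro powr_le_tangent) auto
        also have "\<dots> \<le> 1 + H \<omega>" using s q H0[of \<omega>] mult_left_le_one_le[of "H \<omega>" "2 * s"] by (simp add: algebra_simps)
        finally show ?thesis .
      qed
      finally have "(h + (norm (e 0 \<omega>))\<^sup>2 + (\<Sum>l<n. a l \<omega>)) powr s \<le> C1 powr s * h powr s * (P \<omega> powr (2 * s) + (1 + H \<omega>))"
        by (simp add: mult_left_mono)
      also have "\<dots> \<le> C1 powr s * h powr s * ((R \<omega> powr q + Q \<omega> powr q) + (1 + H \<omega>))"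
        by (intro mult_left_mono add_right_mono P_pow) auto
      finally show ?thesis by (simp only: add.assoc)
    qed
    have [measurable]: "R \<in> borel_measurable M" "Q \<in> borel_measurable M"
    proof -
      show "R \<in> borel_measurable M" unfolding R_def
        by (rule G_M[OF running_max_measurable]) (use Ym in \<open>simp add: energy_def\<close>)
      interpret H: discrete_filtration M "\<lambda>i. F (t0 + real i * h)" using h0 by (intro grid_filtration) auto
      show "Q \<in> borel_measurable M" unfolding Q_def
        by (rule H.G_M[OF H.running_max_measurable]) (use chain_adapted[OF X sh t0] in \<open>simp add: energy_def\<close>)
    qed
    have [measurable]: "H \<in> borel_measurable M" unfolding H_def[abs_def] by measurable
    have EH: "(\<integral>\<^sup>+\<omega>. ennreal (H \<omega>) \<partial>M) \<le> ennreal (1 + 2 * T)"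
    proof -
      have "(\<integral>\<^sup>+\<omega>. ennreal (H \<omega>) \<partial>M) = (\<integral>\<^sup>+\<omega>. ennreal (1 + real n * \<tau>) + (\<Sum>l<n. ennreal (\<tau> / h) * ennreal ((w l \<omega>)\<^sup>2)) \<partial>M)"
      proof (rule nn_integral_cong)
        fix \<omega>
        have "H \<omega> = (1 + real n * \<tau>) + (\<Sum>l<n. \<tau> / h * (w l \<omega>)\<^sup>2)" by (simp add: H_def sum_distrib_left sum_divide_distrib)
        then show "ennreal (H \<omega>) = ennreal (1 + real n * \<tau>) + (\<Sum>l<n. ennreal (\<tau> / h) * ennreal ((w l \<omega>)\<^sup>2))"
          using \<tau>0 h0 by (simp add: ennreal_plus sum_nonneg ennreal_mult[symmetric] sum_ennreal)
      qed
      also have "\<dots> = ennreal (1 + real n * \<tau>) + (\<Sum>l<n. ennreal (\<tau> / h) * (\<integral>\<^sup>+\<omega>. ennreal ((w l \<omega>)\<^sup>2) \<partial>M))"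
        by (subst nn_integral_add, measurable, subst nn_integral_sum, measurable, subst nn_integral_cmult, measurable) (simp add: emeasure_space_1)
      also have "\<dots> \<le> ennreal (1 + real n * \<tau>) + (\<Sum>l<n. ennreal (\<tau> / h) * ennreal h)"
      proof (intro add_left_mono sum_mono mult_left_mono)
        fix l
        have "t0 + real l * \<tau> - (t0 + real (l div m) * h) \<le> h"
        proof -
          have "real l * \<tau> = real (l div m) * h + real (l mod m) * \<tau>"
            unfolding h by (metis (no_types, lifting) div_mult_mod_eq distrib_right mult.assoc of_nat_add of_nat_mult)
          moreover have "real (l mod m) * \<tau> \<le> real m * \<tau>" using m \<tau>0 by (intro mult_right_mono) (auto simp: less_imp_le)
          ultimately show ?thesis by (simp add: h)
        qed
        then show "(\<integral>\<^sup>+\<omega>. ennreal ((w l \<omega>)\<^sup>2) \<partial>M) \<le> ennreal h"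
          unfolding w_def using t0 h0 by (subst increment_variance) (auto simp: grid_le intro: ennreal_leI)
      qed simp
      also have "\<dots> = ennreal (1 + 2 * (real n * \<tau>))"
        using h0 \<tau>0 by (simp add: ennreal_mult[symmetric] sum_ennreal ennreal_of_nat_eq_real_of_nat ennreal_plus[symmetric] del: ennreal_plus)
      also have "\<dots> \<le> ennreal (1 + 2 * T)" using n\<tau> N by (intro ennreal_leI) simp
      finally show ?thesis .
    qed
    have RQint: "(\<integral>\<^sup>+\<omega>. ennreal (R \<omega> powr q) + ennreal (Q \<omega> powr q) \<partial>M) \<le> ennreal (2 * Ce)"
    proof -
      have "(\<integral>\<^sup>+\<omega>. ennreal (R \<omega> powr q) + ennreal (Q \<omega> powr q) \<partial>M) = (\<integral>\<^sup>+\<omega>. ennreal (R \<omega> powr q) \<partial>M) + (\<integral>\<^sup>+\<omega>. ennreal (Q \<omega> powr q) \<partial>M)"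
        by (rule nn_integral_add) measurable
      also have "\<dots> \<le> ennreal Ce + ennreal Ce" by (intro add_mono mom_max)
      finally show ?thesis using Ce by (simp add: ennreal_plus[symmetric] del: ennreal_plus)
    qed
    have ES: "(\<integral>\<^sup>+\<omega>. ennreal ((h + (norm (e 0 \<omega>))\<^sup>2 + (\<Sum>l<n. a l \<omega>)) powr s) \<partial>M) \<le> ennreal (C1 powr s * h powr s * (2 * Ce + 2 + 2 * T))"
    proof -
      have "(\<integral>\<^sup>+\<omega>. ennreal ((h + (norm (e 0 \<omega>))\<^sup>2 + (\<Sum>l<n. a l \<omega>)) powr s) \<partial>M)
        \<le> (\<integral>\<^sup>+\<omega>. ennreal (C1 powr s * h powr s) * ((ennreal (R \<omega> powr q) + ennreal (Q \<omega> powr q)) + (1 + ennreal (H \<omega>))) \<partial>M)"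
      proof (rule nn_integral_mono)
        fix \<omega>
        have "ennreal ((h + (norm (e 0 \<omega>))\<^sup>2 + (\<Sum>l<n. a l \<omega>)) powr s) \<le> ennreal (C1 powr s * h powr s * (R \<omega> powr q + Q \<omega> powr q + 1 + H \<omega>))"
          by (rule ennreal_leI[OF S_pow])
        also have "\<dots> = ennreal (C1 powr s * h powr s) * ((ennreal (R \<omega> powr q) + ennreal (Q \<omega> powr q)) + (1 + ennreal (H \<omega>)))"
          using H0[of \<omega>] by (simp add: ennreal_mult ennreal_plus add.assoc)
        finally show "ennreal ((h + (norm (e 0 \<omega>))\<^sup>2 + (\<Sum>l<n. a l \<omega>)) powr s) \<le> \<dots>" .
      qed
      also have "\<dots> = ennreal (C1 powr s * h powr s) * ((\<integral>\<^sup>+\<omega>. ennreal (R \<omega> powr q) + ennreal (Q \<omega> powr q) \<partial>M) + (1 + (\<integral>\<^sup>+\<omega>. ennreal (H \<omega>) \<partial>M)))"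
        by (subst nn_integral_cmult, measurable, subst nn_integral_add, measurable, subst (2) nn_integral_add, measurable) (simp add: emeasure_space_1)
      also have "\<dots> \<le> ennreal (C1 powr s * h powr s) * (ennreal (2 * Ce) + (1 + ennreal (1 + 2 * T)))"
        by (intro mult_left_mono add_mono RQint EH order_refl) auto
      also have "\<dots> = ennreal (C1 powr s * h powr s * (2 * Ce + 2 + 2 * T))"
      proof -
        have eq: "ennreal (2 * Ce) + (1 + ennreal (1 + 2 * T)) = ennreal (2 * Ce + 2 + 2 * T)"
          using Ce T by (simp add: ennreal_plus[symmetric] ennreal_1[symmetric] del: ennreal_plus ennreal_1)
        show ?thesis unfolding eq by (rule ennreal_mult[symmetric]) (use Ce T in auto)
      qed
      finally show ?thesis .
    qed
    have Ee: "(\<integral>\<^sup>+\<omega>. ennreal ((norm (e n \<omega>))\<^sup>2 powr s) \<partial>M) \<le> ennreal (Cg * (C1 powr s * h powr s * (2 * Ce + 2 + 2 * T)))"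
    proof -
      have "?c ^ n \<le> exp (2 * (c3 + 1) * \<tau>) ^ n" using pos \<tau>0 by (intro power_mono exp_ge_add_one_self) auto
      also have "\<dots> = exp (2 * (c3 + 1) * (real n * \<tau>))" by (simp add: exp_of_nat_mult[symmetric] mult_ac)
      also have "\<dots> \<le> exp (2 * (c3 + 1) * T)" using pos n\<tau> N by (intro iffD2[OF exp_le_cancel_iff] mult_left_mono) auto
      finally have "?c ^ n / s + 1 \<le> Cg" unfolding Cg_def using s by (intro add_right_mono divide_right_mono) auto
      then have "ennreal (?c ^ n / s + 1) * (\<integral>\<^sup>+\<omega>. ennreal ((h + (norm (e 0 \<omega>))\<^sup>2 + (\<Sum>l<n. a l \<omega>)) powr s) \<partial>M)
         \<le> ennreal Cg * ennreal (C1 powr s * h powr s * (2 * Ce + 2 + 2 * T))"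
        by (intro mult_mono ES ennreal_leI) auto
      then show ?thesis using dom Cg by (simp add: ennreal_mult')
    qed
    have gap_le: "gap h (Y n \<omega>) (X N \<omega>) powr s \<le> 2 * (norm (e n \<omega>))\<^sup>2 powr s + (1 + C2) * h powr s * (R \<omega> powr q + Q \<omega> powr q)" for \<omega>
    proof -
      have nm: "n div m = N" using m by (simp add: n_def)
      \<comment> \<open>n is the index of a coarse grid time, so no Brownian increment is pending
        and the squared remainder is of order h up to weights.\<close>
      have "w n \<omega> = 0" unfolding w_def nm n\<tau> by simp
      then have r: "(norm (e n \<omega> - (Y n \<omega> - X N \<omega>)))\<^sup>2 \<le> 6 * L\<^sup>2 * (weight (Y n \<omega>) (X N \<omega>))\<^sup>2 * h"
        using rem[of n \<omega>] unfolding B_def nm by simp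
      have w2: "(weight (Y n \<omega>) (X N \<omega>))\<^sup>2 \<le> Cw * P \<omega>" using wP2[of n \<omega>] unfolding B_def nm by simp
      have g: "(norm (g (Y n \<omega>) - g (X N \<omega>)))\<^sup>2 \<le> 4 * L\<^sup>2 * (weight (Y n \<omega>) (X N \<omega>))\<^sup>2"
      proof -
        have "norm (g (Y n \<omega>) - g (X N \<omega>)) \<le> L * weight (Y n \<omega>) (X N \<omega>) + L * weight (Y n \<omega>) (X N \<omega>)"
          by (rule order_trans[OF norm_triangle_ineq4]) (intro add_mono growth_weight)
        then have "(norm (g (Y n \<omega>) - g (X N \<omega>)))\<^sup>2 \<le> (2 * L * weight (Y n \<omega>) (X N \<omega>))\<^sup>2" by (intro power_mono) auto
        then show ?thesis by (simp add: power_mult_distrib)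
      qed
      have t: "(norm (Y n \<omega> - X N \<omega>))\<^sup>2 \<le> 2 * (norm (e n \<omega>))\<^sup>2 + 2 * (norm (e n \<omega> - (Y n \<omega> - X N \<omega>)))\<^sup>2"
      proof -
        have "norm (Y n \<omega> - X N \<omega>) \<le> norm (e n \<omega>) + norm (e n \<omega> - (Y n \<omega> - X N \<omega>))"
          using norm_triangle_ineq4[of "e n \<omega>" "e n \<omega> - (Y n \<omega> - X N \<omega>)"] by simp
        then have "(norm (Y n \<omega> - X N \<omega>))\<^sup>2 \<le> (norm (e n \<omega>) + norm (e n \<omega> - (Y n \<omega> - X N \<omega>)))\<^sup>2" by (intro power_mono) auto
        also have "\<dots> \<le> 2 * (norm (e n \<omega>))\<^sup>2 + 2 * (norm (e n \<omega> - (Y n \<omega> - X N \<omega>)))\<^sup>2"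
          using sum_squares_bound[of "norm (e n \<omega>)" "norm (e n \<omega> - (Y n \<omega> - X N \<omega>))"] by (simp add: power2_sum)
        finally show ?thesis .
      qed
      have "l2 * h * (norm (g (Y n \<omega>) - g (X N \<omega>)))\<^sup>2 \<le> l2 * h * (4 * L\<^sup>2 * (weight (Y n \<omega>) (X N \<omega>))\<^sup>2)"
        using g pos h0 by (intro mult_left_mono) auto
      then have "gap h (Y n \<omega>) (X N \<omega>) \<le> 2 * (norm (e n \<omega>))\<^sup>2 + (12 * L\<^sup>2 + 4 * l2 * L\<^sup>2) * h * (weight (Y n \<omega>) (X N \<omega>))\<^sup>2"
        using r t unfolding gap_def by (simp add: algebra_simps)
      also have "\<dots> \<le> 2 * (norm (e n \<omega>))\<^sup>2 + (12 * L\<^sup>2 + 4 * l2 * L\<^sup>2) * h * (Cw * P \<omega>)"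
        using pos h0 by (intro add_left_mono mult_left_mono w2 mult_nonneg_nonneg) auto
      finally have "gap h (Y n \<omega>) (X N \<omega>) \<le> 2 * (norm (e n \<omega>))\<^sup>2 + C2 * h * P \<omega>" by (simp add: C2_def mult_ac)
      then have "gap h (Y n \<omega>) (X N \<omega>) powr s \<le> (2 * (norm (e n \<omega>))\<^sup>2 + C2 * h * P \<omega>) powr s"
        using s pos h0 by (intro powr_mono2) (auto simp: gap_def)
      also have "\<dots> \<le> (2 * (norm (e n \<omega>))\<^sup>2) powr s + (C2 * h * P \<omega>) powr s"
        using s q C2 h0 P1[of \<omega>] by (intro powr_add_le mult_nonneg_nonneg) auto
      also have "(2 * (norm (e n \<omega>))\<^sup>2) powr s \<le> 2 * (norm (e n \<omega>))\<^sup>2 powr s"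
      proof -
        have "2 powr s \<le> (2 :: real) powr 1" using q by (intro powr_mono) auto
        then have "2 powr s * (norm (e n \<omega>))\<^sup>2 powr s \<le> 2 * (norm (e n \<omega>))\<^sup>2 powr s" by (intro mult_right_mono) auto
        then show ?thesis by (simp add: powr_mult)
      qed
      also have "(C2 * h * P \<omega>) powr s \<le> (1 + C2) * h powr s * P \<omega> powr (2 * s)"
      proof -
        have "(C2 * h * P \<omega>) powr s = C2 powr s * h powr s * P \<omega> powr s"
          using C2 h0 P1[of \<omega>] by (simp add: powr_mult)
        also have "\<dots> \<le> (1 + C2) * h powr s * P \<omega> powr (2 * s)"
        proof (intro mult_mono)
          show "C2 powr s \<le> 1 + C2"
            using powr_le_tangent[of C2 s] s q C2 mult_left_le_one_le[of C2 s] by (simp add: algebra_simps)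
          show "P \<omega> powr s \<le> P \<omega> powr (2 * s)" using s P1[of \<omega>] by (intro powr_mono) auto
        qed (use C2 in auto)
        finally show ?thesis .
      qed
      also have "\<dots> \<le> (1 + C2) * h powr s * (R \<omega> powr q + Q \<omega> powr q)"
        using C2 by (intro mult_left_mono P_pow) auto
      finally show ?thesis by (simp add: add_left_mono add_right_mono)
    qed
    have "(\<integral>\<^sup>+\<omega>. ennreal (gap h (Y (N * m) \<omega>) (X N \<omega>) powr s) \<partial>M)
      \<le> (\<integral>\<^sup>+\<omega>. ennreal 2 * ennreal ((norm (e n \<omega>))\<^sup>2 powr s) + ennreal ((1 + C2) * h powr s) * (ennreal (R \<omega> powr q) + ennreal (Q \<omega> powr q)) \<partial>M)"
    proof (rule nn_integral_mono)
      fix \<omega>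
      have "ennreal (gap h (Y (N * m) \<omega>) (X N \<omega>) powr s) \<le> ennreal (2 * (norm (e n \<omega>))\<^sup>2 powr s + (1 + C2) * h powr s * (R \<omega> powr q + Q \<omega> powr q))"
        using gap_le[of \<omega>] unfolding n_def by (rule ennreal_leI)
      also have "\<dots> = ennreal 2 * ennreal ((norm (e n \<omega>))\<^sup>2 powr s) + ennreal ((1 + C2) * h powr s) * (ennreal (R \<omega> powr q) + ennreal (Q \<omega> powr q))"
        using C2 by (simp add: ennreal_plus ennreal_mult del: ennreal_numeral)
      finally show "ennreal (gap h (Y (N * m) \<omega>) (X N \<omega>) powr s) \<le> \<dots>" .
    qed
    also have "\<dots> = ennreal 2 * (\<integral>\<^sup>+\<omega>. ennreal ((norm (e n \<omega>))\<^sup>2 powr s) \<partial>M) + ennreal ((1 + C2) * h powr s) * (\<integral>\<^sup>+\<omega>. ennreal (R \<omega> powr q) + ennreal (Q \<omega> powr q) \<partial>M)"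
      by (subst nn_integral_add, measurable, subst nn_integral_cmult, measurable, subst nn_integral_cmult, measurable)
    also have "\<dots> \<le> ennreal 2 * ennreal (Cg * (C1 powr s * h powr s * (2 * Ce + 2 + 2 * T))) + ennreal ((1 + C2) * h powr s) * ennreal (2 * Ce)"
      by (intro add_mono mult_left_mono Ee RQint) auto
    also have "\<dots> = ennreal (2 * (Cg * (C1 powr s * h powr s * (2 * Ce + 2 + 2 * T))) + (1 + C2) * h powr s * (2 * Ce))"
      using C2 Cg Ce T by (simp add: ennreal_plus ennreal_mult del: ennreal_numeral)
    also have "2 * (Cg * (C1 powr s * h powr s * (2 * Ce + 2 + 2 * T))) + (1 + C2) * h powr s * (2 * Ce) = C * h powr s"
      unfolding C_def by (simp add: algebra_simps)
    finally show "(\<integral>\<^sup>+\<omega>. ennreal (gap h (Y (N * m) \<omega>) (X N \<omega>) powr s) \<partial>M) \<le> ennreal (C * h powr s)" .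
  qed
qed

end

section \<open>Estimates uniform in time\<close>

text \<open>The excess \<open>c\<^sup>2 * \<tau> / (1 - c * \<tau>)\<close> over c is at most
  \<open>2 * c\<^sup>2 * \<tau>\<close> as \<open>1 - c * \<tau> \<ge> 1/2\<close>; small steps use
  up only half of a given margin \<delta>.\<close>

lemma implicit_rate_bound:
  fixes c \<tau> \<delta> :: real
  assumes "c > 0" "0 < \<tau>" "2 * c * \<tau> \<le> 1" "4 * c\<^sup>2 * \<tau> \<le> \<delta>"
  shows "c / (1 - c * \<tau>) \<le> c + \<delta> / 2"
proof -
  have "c \<le> c + \<delta> / 2 - c * (c * \<tau>) - \<delta> / 2 * (c * \<tau>)"
  proof -
    have "\<delta> \<ge> 0" using assms by (smt (verit) mult_nonneg_nonneg zero_le_power2)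
    have "\<delta> * (c * \<tau>) \<le> \<delta> * (1/2)" using assms \<open>\<delta> \<ge> 0\<close> by (intro mult_left_mono) auto
    moreover have "c * (c * \<tau>) \<le> \<delta> / 4" using assms by (simp add: power2_eq_square mult_ac)
    ultimately show ?thesis by (simp add: field_simps)
  qed
  then show ?thesis using assms by (simp add: pos_divide_le_eq algebra_simps)
qed

context bem
begin

text \<open>\<open>gap\<close> is the squared distance of the images under x \<mapsto> (x, sqrt (l2
  \<tau>) g x), and a power 2 s \<le> 1 of a metric still obeys the triangle inequality.\<close>

lemma gap_triangle:
  assumes s: "0 < s" "2 * s \<le> 1" and \<tau>: "\<tau> \<ge> 0"
  shows "gap \<tau> x z powr s \<le> gap \<tau> x y powr s + gap \<tau> y z powr s"
proof -
  define \<Phi> where "\<Phi> x = (x, sqrt (l2 * \<tau>) *\<^sub>R g x)" for x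
  have gap: "gap \<tau> x y = (norm (\<Phi> x - \<Phi> y))\<^sup>2" for x y
  proof -
    have "norm (sqrt (l2 * \<tau>) *\<^sub>R g x - sqrt (l2 * \<tau>) *\<^sub>R g y) = sqrt (l2 * \<tau>) * norm (g x - g y)"
      using \<tau> pos by (simp flip: scaleR_diff_right)
    then show ?thesis using \<tau> pos unfolding gap_def \<Phi>_def norm_Pair minus_prod_def
      by (simp add: power_mult_distrib)
  qed
  have powr: "gap \<tau> x y powr s = norm (\<Phi> x - \<Phi> y) powr (2 * s)" for x y
    unfolding gap by (cases "norm (\<Phi> x - \<Phi> y) = 0") (simp_all add: powr_powr flip: powr_numeral)
  have "norm (\<Phi> x - \<Phi> z) \<le> norm (\<Phi> x - \<Phi> y) + norm (\<Phi> y - \<Phi> z)"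
    using norm_triangle_ineq[of "\<Phi> x - \<Phi> y" "\<Phi> y - \<Phi> z"] by simp
  then have "norm (\<Phi> x - \<Phi> z) powr (2 * s) \<le> (norm (\<Phi> x - \<Phi> y) + norm (\<Phi> y - \<Phi> z)) powr (2 * s)"
    using s by (intro powr_mono2) auto
  also have "\<dots> \<le> norm (\<Phi> x - \<Phi> y) powr (2 * s) + norm (\<Phi> y - \<Phi> z) powr (2 * s)"
    using s by (intro powr_add_le) auto
  finally show ?thesis unfolding powr .
qed

lemma gap_contraction_iterated:
  assumes X: "chain t0 \<tau> X" and Y: "chain t0 \<tau> Y" and \<tau>: "small \<tau>" and t0: "t0 \<ge> 0"
    and r: "0 < r" "r < 1" and b: "l2 * \<tau> \<le> b"
    and k2: "\<And>y z. y \<noteq> z \<Longrightarrow> (1 - l2) * (norm (g y - g z))\<^sup>2 / ((norm (y - z))\<^sup>2 + b * (norm (g y - g z))\<^sup>2)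
          - 2 * ((y - z) \<bullet> (g y - g z))\<^sup>2 / ((norm (y - z))\<^sup>2 + b * (norm (g y - g z))\<^sup>2)\<^sup>2 \<le> k2"
    and rate: "r * ((1 - r) * k2 + c3 / (1 - c3 * \<tau>)) \<le> - \<rho>"
  shows "(\<integral>\<^sup>+\<omega>. ennreal (gap \<tau> (X n \<omega>) (Y n \<omega>) powr r) \<partial>M)
    \<le> ennreal (exp (- \<rho> * (real n * \<tau>))) * (\<integral>\<^sup>+\<omega>. ennreal (gap \<tau> (X 0 \<omega>) (Y 0 \<omega>) powr r) \<partial>M)"
proof (induction n)
  case (Suc n)
  let ?I = "\<lambda>n. \<integral>\<^sup>+\<omega>. ennreal (gap \<tau> (X n \<omega>) (Y n \<omega>) powr r) \<partial>M"
  have "?I (Suc n) \<le> ennreal (exp (- \<rho> * \<tau>)) * ?I n"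
    by (rule gap_contraction[OF X Y \<tau> t0 r b k2 rate])
  also have "\<dots> \<le> ennreal (exp (- \<rho> * \<tau>)) * (ennreal (exp (- \<rho> * (real n * \<tau>))) * ?I 0)"
    by (intro mult_left_mono Suc.IH) simp
  also have "\<dots> = ennreal (exp (- \<rho> * \<tau>) * exp (- \<rho> * (real n * \<tau>))) * ?I 0"
    by (simp add: ennreal_mult mult.assoc)
  also have "exp (- \<rho> * \<tau>) * exp (- \<rho> * (real n * \<tau>)) = exp (- \<rho> * (real (Suc n) * \<tau>))"
    by (simp add: exp_add[symmetric] algebra_simps)
  finally show ?case .
qed simp

text \<open>Half of the margin in \<open>rate\<close> is spent on implicitness, the other half is
  the decay rate; the affine recursion turns decay and a source of order \<tau> into a bound free of
  both n and \<tau>.\<close>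

lemma uniform_moment:
  fixes \<kappa> :: "'a \<Rightarrow> real"
  assumes r: "0 < r" "r < 1" and b: "b > 0" and D: "D > 0" and C: "C \<ge> 0"
    and \<kappa>: "\<And>y. (1 - l1) * (norm (g y))\<^sup>2 / (D + (norm y)\<^sup>2 + b * (norm (g y))\<^sup>2)
          - 2 * (y \<bullet> g y)\<^sup>2 / (D + (norm y)\<^sup>2 + b * (norm (g y))\<^sup>2)\<^sup>2 \<le> \<kappa> y"
    and k: "\<And>\<tau> y. 0 < \<tau> \<Longrightarrow> l1 * \<tau> \<le> b \<Longrightarrow> Lyap D \<tau> y powr r * \<kappa> y \<le> k * Lyap D \<tau> y powr r + C"
    and rate: "(1 - r) * k + c1 < 0"
  shows "\<exists>h0>0. \<exists>B\<ge>0. \<forall>\<tau> Y n. small \<tau> \<longrightarrow> \<tau> < h0 \<longrightarrow> chain 0 \<tau> Y \<longrightarrow> (\<forall>\<omega>\<in>space M. Y 0 \<omega> = x0) \<longrightarrow>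
     (\<integral>\<^sup>+\<omega>. ennreal ((1 + norm (Y n \<omega>)) powr (2 * r)) \<partial>M) \<le> ennreal B"
proof -
  define \<delta> where "\<delta> = - ((1 - r) * k + c1)"
  define \<rho> where "\<rho> = r * (\<delta> / 2)"
  \<comment> \<open>The first entry ensures \<open>l1 * \<tau> \<le> b\<close>, the second keeps the
    implicitness correction below \<delta> / 2.\<close>
  define h0 where "h0 = min (b / l1) (\<delta> / (4 * c1\<^sup>2))"
  define C' where "C' = 2 * (C + D powr (r - 1) * c2)"
  \<comment> \<open>The prefactor comes from
    \<open>(1 + norm y)\<^sup>2 \<le> (2 + 2 / D) * Lyap D \<tau> y\<close>; the initial functional
    is bounded by its value for step size 1.\<close>
  define B where "B = (2 + 2 / D) powr r * (Lyap D 1 x0 powr r + C' * (1 + \<rho>) / \<rho>)"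
  have \<delta>: "\<delta> > 0" using rate by (simp add: \<delta>_def)
  have \<rho>: "\<rho> > 0" using \<delta> r by (simp add: \<rho>_def)
  have h0: "h0 > 0" using b pos \<delta> by (simp add: h0_def)
  have C': "C' \<ge> 0" using C pos by (simp add: C'_def)
  have B: "B \<ge> 0" using C' \<rho> by (simp add: B_def)
  show ?thesis
  proof (rule exI[of _ h0], rule conjI[OF h0], rule exI[of _ B], rule conjI[OF B], intro allI impI)
    fix \<tau> Y n assume \<tau>: "small \<tau>" and \<tau>h: "\<tau> < h0" and Y: "chain 0 \<tau> Y" and Y0: "\<forall>\<omega>\<in>space M. Y 0 \<omega> = x0"
    have tau: "0 < \<tau>" "\<tau> \<le> 1" "2 * c1 * \<tau> \<le> 1" using \<tau> by (auto simp: small_def)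
    have b': "l1 * \<tau> \<le> b" using \<tau>h pos by (simp add: h0_def field_simps)
    have "4 * c1\<^sup>2 * \<tau> \<le> \<delta>" using \<tau>h pos by (simp add: h0_def field_simps)
    then have "c1 / (1 - c1 * \<tau>) \<le> c1 + \<delta> / 2" using pos tau by (intro implicit_rate_bound) auto
    moreover have "(1 - r) * k = - c1 - \<delta>" by (simp add: \<delta>_def)
    ultimately have "(1 - r) * k + c1 / (1 - c1 * \<tau>) \<le> - (\<delta> / 2)" by linarith
    then have rate': "r * ((1 - r) * k + c1 / (1 - c1 * \<tau>)) \<le> - \<rho>"
      using mult_left_mono[of "(1 - r) * k + c1 / (1 - c1 * \<tau>)" "- (\<delta> / 2)" r] r by (simp add: \<rho>_def)
    have [measurable]: "Y n \<in> borel_measurable M" by (rule chain_measurable[OF Y \<tau>]) simp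
    have "(\<integral>\<^sup>+\<omega>. ennreal (Lyap D \<tau> (Y n \<omega>) powr r) \<partial>M) \<le> (\<integral>\<^sup>+\<omega>. ennreal (Lyap D \<tau> (Y 0 \<omega>) powr r) \<partial>M) + ennreal (C' * (1 + \<rho>) / \<rho>)"
    proof (rule affine_recursion_bounded[OF \<rho> tau(1,2) C'])
      show "(\<integral>\<^sup>+\<omega>. ennreal (Lyap D \<tau> (Y (Suc i) \<omega>) powr r) \<partial>M) \<le>
        ennreal (exp (- \<rho> * \<tau>)) * (\<integral>\<^sup>+\<omega>. ennreal (Lyap D \<tau> (Y i \<omega>) powr r) \<partial>M) + ennreal (C' * \<tau>)" for i
        unfolding C'_def by (rule Lyap_step[OF Y \<tau> order_refl r b' D C \<kappa> k[OF tau(1) b'] rate'])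
    qed
    also have "(\<integral>\<^sup>+\<omega>. ennreal (Lyap D \<tau> (Y 0 \<omega>) powr r) \<partial>M) = (\<integral>\<^sup>+\<omega>. ennreal (Lyap D \<tau> x0 powr r) \<partial>M)"
      by (intro nn_integral_cong) (simp add: Y0)
    also have "\<dots> = ennreal (Lyap D \<tau> x0 powr r)" by (simp add: emeasure_space_1)
    also have "\<dots> \<le> ennreal (Lyap D 1 x0 powr r)"
    proof (intro ennreal_leI powr_mono2)
      have "l1 * \<tau> * (norm (g x0))\<^sup>2 \<le> l1 * 1 * (norm (g x0))\<^sup>2"
        using tau pos by (intro mult_right_mono mult_left_mono) auto
      then show "Lyap D \<tau> x0 \<le> Lyap D 1 x0" by (simp add: Lyap_def)
    qed (use r D tau pos in \<open>auto simp: Lyap_def\<close>)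
    finally have V: "(\<integral>\<^sup>+\<omega>. ennreal (Lyap D \<tau> (Y n \<omega>) powr r) \<partial>M) \<le> ennreal (Lyap D 1 x0 powr r) + ennreal (C' * (1 + \<rho>) / \<rho>)"
      by (simp add: add_right_mono)
    have "(\<integral>\<^sup>+\<omega>. ennreal ((1 + norm (Y n \<omega>)) powr (2 * r)) \<partial>M) \<le> (\<integral>\<^sup>+\<omega>. ennreal ((2 + 2 / D) powr r) * ennreal (Lyap D \<tau> (Y n \<omega>) powr r) \<partial>M)"
    proof (rule nn_integral_mono)
      fix \<omega>
      let ?y = "Y n \<omega>"
      have y: "1 + norm ?y > 0" by (simp add: add_pos_nonneg)
      have "(1 + norm ?y)\<^sup>2 \<le> 2 * (1 + (norm ?y)\<^sup>2)"
        using sum_squares_bound[of 1 "norm ?y"] by (simp add: power2_sum)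
      also have "\<dots> \<le> 2 * ((1 + 1 / D) * (D + (norm ?y)\<^sup>2))"
        using D by (intro mult_left_mono) (simp_all add: field_simps)
      also have "\<dots> \<le> 2 * ((1 + 1 / D) * Lyap D \<tau> ?y)"
        using D tau pos by (intro mult_left_mono) (auto simp: Lyap_def)
      finally have "(1 + norm ?y)\<^sup>2 \<le> (2 + 2 / D) * Lyap D \<tau> ?y" by (simp add: algebra_simps)
      then have "(1 + norm ?y)\<^sup>2 powr r \<le> ((2 + 2 / D) * Lyap D \<tau> ?y) powr r"
        using r by (intro powr_mono2) auto
      also have "\<dots> = (2 + 2 / D) powr r * Lyap D \<tau> ?y powr r"
        using D tau pos by (intro powr_mult)
      also have "(1 + norm ?y)\<^sup>2 powr r = (1 + norm ?y) powr (2 * r)"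
        using y by (simp add: powr_powr flip: powr_numeral)
      finally show "ennreal ((1 + norm ?y) powr (2 * r)) \<le> ennreal ((2 + 2 / D) powr r) * ennreal (Lyap D \<tau> ?y powr r)"
        by (simp add: ennreal_mult[symmetric] ennreal_leI)
    qed
    also have "\<dots> = ennreal ((2 + 2 / D) powr r) * (\<integral>\<^sup>+\<omega>. ennreal (Lyap D \<tau> (Y n \<omega>) powr r) \<partial>M)"
      unfolding Lyap_def by (rule nn_integral_cmult) measurable
    also have "\<dots> \<le> ennreal ((2 + 2 / D) powr r) * (ennreal (Lyap D 1 x0 powr r) + ennreal (C' * (1 + \<rho>) / \<rho>))"
      by (intro mult_left_mono V) auto
    also have "\<dots> = ennreal ((2 + 2 / D) powr r) * ennreal (Lyap D 1 x0 powr r + C' * (1 + \<rho>) / \<rho>)"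
      using C' \<rho> by (subst ennreal_plus) auto
    also have "\<dots> = ennreal B" unfolding B_def by (rule ennreal_mult[symmetric]) (use C' \<rho> in auto)
    finally show "(\<integral>\<^sup>+\<omega>. ennreal ((1 + norm (Y n \<omega>)) powr (2 * r)) \<partial>M) \<le> ennreal B" .
  qed
qed

text \<open>On time windows of length about one, restart the coarse scheme at the fine one: the restarted scheme is
  close to the fine scheme by the finite-time estimate and to the coarse scheme by contraction.\<close>

lemma uniform_error:
  assumes s: "0 < s" "16 * real (Suc d) ^ 2 * s \<le> 1" "16 * real (Suc d) ^ 2 * s \<le> \<theta>" and b: "b > 0"
    and k2: "\<And>y z. y \<noteq> z \<Longrightarrow> (1 - l2) * (norm (g y - g z))\<^sup>2 / ((norm (y - z))\<^sup>2 + b * (norm (g y - g z))\<^sup>2)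
          - 2 * ((y - z) \<bullet> (g y - g z))\<^sup>2 / ((norm (y - z))\<^sup>2 + b * (norm (g y - g z))\<^sup>2)\<^sup>2 \<le> k2"
    and rate: "(1 - s) * k2 + c3 < 0"
    and h1: "h1 > 0" and Bm: "Bm \<ge> 0"
    and mom: "\<And>\<tau> Y n. small \<tau> \<Longrightarrow> \<tau> < h1 \<Longrightarrow> chain 0 \<tau> Y \<Longrightarrow> (\<forall>\<omega>\<in>space M. Y 0 \<omega> = x0) \<Longrightarrow>
      (\<integral>\<^sup>+\<omega>. ennreal ((1 + norm (Y n \<omega>)) powr \<theta>) \<partial>M) \<le> ennreal Bm"
  shows "\<exists>h0>0. \<exists>C\<ge>0. \<forall>h \<tau> m X Y j. 0 < h \<longrightarrow> h < h0 \<longrightarrow> m > 0 \<longrightarrow> h = real m * \<tau> \<longrightarrow>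
     small h \<and> (chain 0 h X \<longrightarrow> chain 0 \<tau> Y \<longrightarrow> X 0 = Y 0 \<longrightarrow> (\<forall>\<omega>\<in>space M. Y 0 \<omega> = x0) \<longrightarrow>
     (\<integral>\<^sup>+\<omega>. ennreal (norm (Y (j * m) \<omega> - X j \<omega>) powr (2 * s)) \<partial>M) \<le> ennreal (C * h powr s))"
proof -
  have s2: "2 * s \<le> 1" "s < 1"
  proof -
    have "1 * (16 * s) \<le> real (Suc d) ^ 2 * (16 * s)" using s by (intro mult_right_mono one_le_power) auto
    also have "\<dots> = 16 * real (Suc d) ^ 2 * s" by (simp only: mult_ac)
    finally show "2 * s \<le> 1" "s < 1" using s by linarith+
  qed
  obtain Cw' where Cw': "Cw' \<ge> 0" and window: "\<And>t0 h \<tau> m N X Y. t0 \<ge> 0 \<Longrightarrow> small h \<Longrightarrow> m > 0 \<Longrightarrow> h = real m * \<tau> \<Longrightarrow> real N * h \<le> 2 \<Longrightarrow>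
     chain t0 h X \<Longrightarrow> chain t0 \<tau> Y \<Longrightarrow> X 0 = Y 0 \<Longrightarrow>
     (\<integral>\<^sup>+\<omega>. ennreal ((1 + norm (Y 0 \<omega>)) powr (16 * real (Suc d) ^ 2 * s)) \<partial>M) \<le> ennreal Bm \<Longrightarrow>
     (\<integral>\<^sup>+\<omega>. ennreal (gap h (Y (N * m) \<omega>) (X N \<omega>) powr s) \<partial>M) \<le> ennreal (Cw' * h powr s)"
    using window_error[OF s(1,2), of 2 Bm] Bm by (auto simp del: of_nat_Suc)
  define \<delta> where "\<delta> = - ((1 - s) * k2 + c3)"
  define \<rho> where "\<rho> = s * (\<delta> / 2)"
  \<comment> \<open>The second entry gives \<open>l2 * h \<le> b\<close>, the third pays for
    implicitness, the last three make h \<open>small\<close>.\<close>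
  define h0 where "h0 = Min {h1, b / l2, \<delta> / (4 * c3\<^sup>2), 1, 1 / (2 * c1), 1 / (2 * c3)}"
  \<comment> \<open>Bound for the recursion over full windows plus the error of one last incomplete
    window.\<close>
  define C where "C = Cw' * (1 + \<rho>) / \<rho> + Cw'"
  have \<delta>: "\<delta> > 0" using rate by (simp add: \<delta>_def)
  have \<rho>: "\<rho> > 0" using \<delta> s by (simp add: \<rho>_def)
  have h0: "h0 > 0" using h1 b pos \<delta> by (simp add: h0_def)
  have C: "C \<ge> 0" using Cw' \<rho> by (simp add: C_def)
  show ?thesis
  proof (rule exI[of _ h0], rule conjI[OF h0], rule exI[of _ C], rule conjI[OF C], intro allI impI conjI)
    fix h \<tau> :: real and m j :: nat and X Y
    assume h: "0 < h" "h < h0" and m: "m > 0" and hm: "h = real m * \<tau>"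
    have hb: "h < h1" "h < b / l2" "h < \<delta> / (4 * c3\<^sup>2)" "h < 1" "h < 1 / (2 * c1)" "h < 1 / (2 * c3)"
      using h by (auto simp: h0_def)
    show sh: "small h" using h hb pos by (auto simp: small_def field_simps)
    assume X: "chain 0 h X" and Y: "chain 0 \<tau> Y" and XY0: "X 0 = Y 0" and Y0: "\<forall>\<omega>\<in>space M. Y 0 \<omega> = x0"
    have \<tau>0: "0 < \<tau>" using m h by (auto simp: hm zero_less_mult_iff)
    have \<tau>h: "\<tau> \<le> h" using m \<tau>0 unfolding hm by (simp add: mult_le_cancel_right1)
    have st: "small \<tau>" by (rule small_mono[OF sh \<tau>0 \<tau>h])
    have b': "l2 * h \<le> b" using hb pos by (simp add: field_simps)
    have "4 * c3\<^sup>2 * h \<le> \<delta>" using hb pos by (simp add: field_simps)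
    then have "c3 / (1 - c3 * h) \<le> c3 + \<delta> / 2" using pos sh by (intro implicit_rate_bound) (auto simp: small_def)
    moreover have "(1 - s) * k2 = - c3 - \<delta>" by (simp add: \<delta>_def)
    ultimately have "(1 - s) * k2 + c3 / (1 - c3 * h) \<le> - (\<delta> / 2)" by linarith
    then have rate': "s * ((1 - s) * k2 + c3 / (1 - c3 * h)) \<le> - \<rho>"
      using mult_left_mono[of "(1 - s) * k2 + c3 / (1 - c3 * h)" "- (\<delta> / 2)" s] s by (simp add: \<rho>_def)
    define u where "u k = (\<integral>\<^sup>+\<omega>. ennreal (gap h (Y (k * m) \<omega>) (X k \<omega>) powr s) \<partial>M)" for k
    have step: "u (k + n) \<le> ennreal (exp (- \<rho> * (real n * h))) * u k + ennreal (Cw' * h powr s)" if n: "real n * h \<le> 2" for k n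
    proof -
      let ?t = "real k * h"
      have t: "?t \<ge> 0" using h by simp
      have tk: "real (k * m) * \<tau> = ?t" by (simp add: hm)
      have Yk: "chain ?t \<tau> (\<lambda>i. Y (k * m + i))" using chain_shift[OF Y st, of "k * m"] unfolding tk by simp
      have Xk: "chain ?t h (\<lambda>i. X (k + i))" using chain_shift[OF X sh, of k] by simp
      have "Y (k * m) \<in> borel_measurable (F ?t)" using chain_adapted[OF Y st, of "k * m"] unfolding tk by simp
      then obtain Z where Z: "chain ?t h Z" and Z0: "Z 0 = Y (k * m)" using chain_exists[OF sh] by blast
      have [measurable]: "Z n \<in> borel_measurable M" "Y ((k + n) * m) \<in> borel_measurable M" "X (k + n) \<in> borel_measurable M"
        using chain_measurable[OF Z sh t] chain_measurable[OF Y st] chain_measurable[OF X sh] by auto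
      \<comment> \<open>The fine chain at the restart time k h supplies the initial moments of the
        window; this is where moments uniform in time are indispensable. Their order \<theta> is at
        least the exponent that the window estimate demands.\<close>
      have w: "(\<integral>\<^sup>+\<omega>. ennreal (gap h (Y (k * m + n * m) \<omega>) (Z n \<omega>) powr s) \<partial>M) \<le> ennreal (Cw' * h powr s)"
      proof (rule window[OF t sh m hm n Z Yk])
        show "Z 0 = Y (k * m + 0)" using Z0 by simp
        have "(\<integral>\<^sup>+\<omega>. ennreal ((1 + norm (Y (k * m + 0) \<omega>)) powr (16 * real (Suc d) ^ 2 * s)) \<partial>M)
           \<le> (\<integral>\<^sup>+\<omega>. ennreal ((1 + norm (Y (k * m) \<omega>)) powr \<theta>) \<partial>M)"
          using s by (intro nn_integral_mono ennreal_leI) (simp add: powr_mono)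
        also have "\<dots> \<le> ennreal Bm" using mom[OF st _ Y Y0] \<tau>h hb by simp
        finally show "(\<integral>\<^sup>+\<omega>. ennreal ((1 + norm (Y (k * m + 0) \<omega>)) powr (16 * real (Suc d) ^ 2 * s)) \<partial>M) \<le> ennreal Bm" .
      qed
      have c: "(\<integral>\<^sup>+\<omega>. ennreal (gap h (Z n \<omega>) (X (k + n) \<omega>) powr s) \<partial>M) \<le> ennreal (exp (- \<rho> * (real n * h))) * u k"
        using gap_contraction_iterated[OF Z Xk sh t s(1) s2(2) b' k2 rate', of n] by (simp add: u_def Z0)
      have "u (k + n) \<le> (\<integral>\<^sup>+\<omega>. ennreal (gap h (Y ((k + n) * m) \<omega>) (Z n \<omega>) powr s) + ennreal (gap h (Z n \<omega>) (X (k + n) \<omega>) powr s) \<partial>M)"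
        unfolding u_def
      proof (rule nn_integral_mono)
        fix \<omega>
        show "ennreal (gap h (Y ((k + n) * m) \<omega>) (X (k + n) \<omega>) powr s)
          \<le> ennreal (gap h (Y ((k + n) * m) \<omega>) (Z n \<omega>) powr s) + ennreal (gap h (Z n \<omega>) (X (k + n) \<omega>) powr s)"
          using gap_triangle[OF s(1) s2(1), of h "Y ((k + n) * m) \<omega>" "X (k + n) \<omega>" "Z n \<omega>"] h
          by (simp add: ennreal_plus[symmetric] ennreal_leI del: ennreal_plus)
      qed
      also have "\<dots> = (\<integral>\<^sup>+\<omega>. ennreal (gap h (Y ((k + n) * m) \<omega>) (Z n \<omega>) powr s) \<partial>M) + (\<integral>\<^sup>+\<omega>. ennreal (gap h (Z n \<omega>) (X (k + n) \<omega>) powr s) \<partial>M)"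
        unfolding gap_def by (rule nn_integral_add) measurable
      also have "\<dots> \<le> ennreal (Cw' * h powr s) + ennreal (exp (- \<rho> * (real n * h))) * u k"
        using w c by (intro add_mono) (simp_all add: distrib_right)
      finally show ?thesis by (simp add: add.commute)
    qed
    \<comment> \<open>Steps per window. The length \<open>N * h\<close> is at least 1, so one window
      contracts by exp (- \<rho>) whatever h is, and at most 2, as the window estimate was
      instantiated.\<close>
    define N where "N = nat \<lceil>1 / h\<rceil>"
    have "real N = of_int \<lceil>1 / h\<rceil>" using h by (simp add: N_def)
    then have "1 / h \<le> real N" "real N \<le> 1 / h + 1" by linarith+
    then have N: "1 \<le> real N * h" "real N * h \<le> 2" using h hb by (auto simp: field_simps)
    have N0: "N > 0" using N h by (cases N) auto
    have "u (w * N) \<le> u (0 * N) + ennreal (Cw' * h powr s * (1 + \<rho>) / \<rho>)" for w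
    proof (rule affine_recursion_bounded[where a = "\<lambda>w. u (w * N)" and \<tau> = 1])
      fix w
      have "u (Suc w * N) = u (w * N + N)" by (simp add: add.commute)
      also have "\<dots> \<le> ennreal (exp (- \<rho> * (real N * h))) * u (w * N) + ennreal (Cw' * h powr s)" by (rule step[OF N(2)])
      also have "\<dots> \<le> ennreal (exp (- \<rho> * 1)) * u (w * N) + ennreal (Cw' * h powr s * 1)"
        using \<rho> N by (intro add_mono mult_right_mono ennreal_leI) auto
      finally show "u (Suc w * N) \<le> ennreal (exp (- \<rho> * 1)) * u (w * N) + ennreal (Cw' * h powr s * 1)" .
    qed (use \<rho> Cw' in auto)
    moreover have "u 0 = 0" unfolding u_def by (simp add: XY0 gap_def)
    ultimately have uw: "u (w * N) \<le> ennreal (Cw' * h powr s * (1 + \<rho>) / \<rho>)" for w by simp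
    have j: "j = (j div N) * N + j mod N" by simp
    have "u j \<le> ennreal (exp (- \<rho> * (real (j mod N) * h))) * u ((j div N) * N) + ennreal (Cw' * h powr s)"
    proof (subst j, rule step)
      have "real (j mod N) * h \<le> real N * h" using N0 h by (intro mult_right_mono) (auto simp: less_imp_le)
      then show "real (j mod N) * h \<le> 2" using N by linarith
    qed
    also have "\<dots> \<le> ennreal 1 * ennreal (Cw' * h powr s * (1 + \<rho>) / \<rho>) + ennreal (Cw' * h powr s)"
      using \<rho> h Cw' by (intro add_mono mult_mono uw ennreal_leI) auto
    also have "\<dots> = ennreal (C * h powr s)"
      using Cw' \<rho> by (simp add: C_def ennreal_plus[symmetric] algebra_simps add_divide_distrib del: ennreal_plus)
    finally have "u j \<le> ennreal (C * h powr s)" .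
    moreover have "(\<integral>\<^sup>+\<omega>. ennreal (norm (Y (j * m) \<omega> - X j \<omega>) powr (2 * s)) \<partial>M) \<le> u j"
      unfolding u_def
    proof (intro nn_integral_mono ennreal_leI)
      fix \<omega>
      let ?e = "norm (Y (j * m) \<omega> - X j \<omega>)"
      have "?e powr (2 * s) = (?e\<^sup>2) powr s"
        by (cases "?e = 0") (simp_all add: powr_powr flip: powr_numeral)
      also have "\<dots> \<le> gap h (Y (j * m) \<omega>) (X j \<omega>) powr s"
        using s pos h by (intro powr_mono2) (auto simp: gap_def)
      finally show "?e powr (2 * s) \<le> gap h (Y (j * m) \<omega>) (X j \<omega>) powr s" .
    qed
    ultimately show "(\<integral>\<^sup>+\<omega>. ennreal (norm (Y (j * m) \<omega> - X j \<omega>) powr (2 * s)) \<partial>M) \<le> ennreal (C * h powr s)"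
      by (rule order_trans[rotated])
  qed
qed

end

section \<open>Convergence of left Riemann sums to the solution\<close>

lemma (in prob_space) prob_ge_le_nn_integral:
  assumes X[measurable]: "X \<in> borel_measurable M" and C: "(\<integral>\<^sup>+\<omega>. ennreal (X \<omega>) \<partial>M) \<le> ennreal C" "C \<ge> 0" and \<theta>: "\<theta> > 0"
  shows "prob {\<omega> \<in> space M. X \<omega> \<ge> \<theta>} \<le> C / \<theta>"
proof -
  let ?A = "{\<omega> \<in> space M. X \<omega> \<ge> \<theta>}"
  have "ennreal \<theta> * emeasure M ?A = (\<integral>\<^sup>+\<omega>. ennreal \<theta> * indicator ?A \<omega> \<partial>M)"
    by (rule nn_integral_cmult_indicator[symmetric]) measurable
  also have "\<dots> \<le> (\<integral>\<^sup>+\<omega>. ennreal (X \<omega>) \<partial>M)"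
    by (intro nn_integral_mono) (auto simp: indicator_def intro: ennreal_leI)
  finally have "ennreal (\<theta> * prob ?A) \<le> ennreal C"
    using C(1) \<theta> by (simp add: emeasure_eq_measure ennreal_mult)
  then have "\<theta> * prob ?A \<le> C" using C(2) by simp
  then show ?thesis using \<theta> by (simp add: field_simps)
qed

locale bem_solution = bem M F W f g K c1 c2 c3 l1 l2 d
  for M :: "'m measure" and F :: "real \<Rightarrow> 'm measure" and W :: "real \<Rightarrow> 'm \<Rightarrow> real"
    and f g :: "'a::euclidean_space \<Rightarrow> 'a" and K c1 c2 c3 l1 l2 :: real and d :: nat +
  fixes x0 :: 'a and x :: "real \<Rightarrow> 'm \<Rightarrow> 'a"
  assumes sol: "sde_solution M F W f g x0 x"
begin

lemma x_adapted: "0 \<le> t \<Longrightarrow> x t \<in> borel_measurable (F t)"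
  and x_continuous: "\<omega> \<in> space M \<Longrightarrow> continuous_on {0..} (\<lambda>t. x t \<omega>)"
  using sol by (auto simp: sde_solution_def)

lemma x_measurable[measurable]: "0 \<le> t \<Longrightarrow> x t \<in> borel_measurable M"
  using x_adapted F_M by blast

lemma path_continuous:
  assumes "\<omega> \<in> space M" "continuous_on UNIV \<phi>" "T \<ge> 0"
  shows "continuous_on {0..} (\<lambda>t. \<phi> (x (T * t) \<omega>))"
proof (rule continuous_on_compose2[OF assms(2)])
  show "continuous_on {0..} (\<lambda>t. x (T * t) \<omega>)"
    by (rule continuous_on_compose2[OF x_continuous[OF assms(1)]]) (use assms(3) in \<open>auto intro!: continuous_intros\<close>)
qed auto

text \<open>Rational times keep this event measurable; by path continuity they control all times.\<close>

definition rough :: "('a \<Rightarrow> 'a) \<Rightarrow> real \<Rightarrow> real \<Rightarrow> nat \<Rightarrow> 'm set" where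
  "rough \<phi> T \<eta> n = {\<omega> \<in> space M. \<exists>r\<in>\<rat> \<inter> {0..1}. \<exists>s\<in>\<rat> \<inter> {0..1}.
     \<bar>r - s\<bar> \<le> 1 / real n \<and> norm (\<phi> (x (T * r) \<omega>) - \<phi> (x (T * s) \<omega>)) > \<eta>}"

lemma rough_measurable[measurable]:
  assumes "continuous_on UNIV \<phi>" "T \<ge> 0"
  shows "rough \<phi> T \<eta> n \<in> sets M"
proof -
  have [measurable]: "\<phi> \<in> borel_measurable borel" using assms(1) by (rule borel_measurable_continuous_onI)
  have c: "countable (\<rat> \<inter> {0..1 :: real})" using countable_rat by blast
  have S: "{\<omega> \<in> space M. \<bar>r - s\<bar> \<le> 1 / real n \<and> norm (\<phi> (x (T * r) \<omega>) - \<phi> (x (T * s) \<omega>)) > \<eta>} \<in> sets M"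
    if "r \<in> \<rat> \<inter> {0..1}" "s \<in> \<rat> \<inter> {0..1}" for r s
  proof -
    have [measurable]: "x (T * r) \<in> borel_measurable M" "x (T * s) \<in> borel_measurable M"
      using that assms by (auto intro!: x_measurable)
    show ?thesis by measurable
  qed
  have "rough \<phi> T \<eta> n = (\<Union>r\<in>\<rat> \<inter> {0..1}. \<Union>s\<in>\<rat> \<inter> {0..1}.
      {\<omega> \<in> space M. \<bar>r - s\<bar> \<le> 1 / real n \<and> norm (\<phi> (x (T * r) \<omega>) - \<phi> (x (T * s) \<omega>)) > \<eta>})"
    unfolding rough_def by blast
  also have "\<dots> \<in> sets M" by (rule sets.countable_UN''[OF c], rule sets.countable_UN''[OF c], rule S)
  finally show ?thesis .
qed

lemma not_rough:
  assumes "\<omega> \<in> space M" "\<omega> \<notin> rough \<phi> T \<eta> n" "r \<in> \<rat>" "s \<in> \<rat>" "r \<in> {0..1}" "s \<in> {0..1}" "\<bar>r - s\<bar> \<le> 1 / real n"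
  shows "norm (\<phi> (x (T * r) \<omega>) - \<phi> (x (T * s) \<omega>)) \<le> \<eta>"
proof (rule ccontr)
  assume "\<not> ?thesis"
  then have "\<omega> \<in> rough \<phi> T \<eta> n"
    unfolding rough_def using assms by (intro CollectI conjI bexI[of _ r] bexI[of _ s]) auto
  with assms(2) show False by blast
qed

text \<open>The events decrease, and a path lying in all of them would fail to be uniformly
  continuous on a compact interval. No rate results; the rate of the theorem comes from comparing
  schemes only.\<close>

lemma rough_tendsto_0:
  assumes \<phi>: "continuous_on UNIV \<phi>" and T: "T \<ge> 0" and \<eta>: "\<eta> > 0"
  shows "(\<lambda>n. prob (rough \<phi> T \<eta> n)) \<longlonglongrightarrow> 0"
proof -
  have "decseq (\<lambda>n. rough \<phi> T \<eta> (Suc n))"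
  proof (rule decseq_SucI)
    fix n
    have "1 / real (Suc (Suc n)) \<le> 1 / real (Suc n)" by (simp add: frac_le)
    then have "\<bar>r - s\<bar> \<le> 1 / real (Suc n)" if "\<bar>r - s\<bar> \<le> 1 / real (Suc (Suc n))" for r s :: real
      using that by (rule order_trans[rotated])
    then show "rough \<phi> T \<eta> (Suc (Suc n)) \<le> rough \<phi> T \<eta> (Suc n)" unfolding rough_def by blast
  qed
  then have "(\<lambda>n. prob (rough \<phi> T \<eta> (Suc n))) \<longlonglongrightarrow> prob (\<Inter>n. rough \<phi> T \<eta> (Suc n))"
    using rough_measurable[OF \<phi> T] by (intro finite_Lim_measure_decseq) auto
  moreover have "(\<Inter>n. rough \<phi> T \<eta> (Suc n)) = {}"
  proof (rule ccontr)
    assume "(\<Inter>n. rough \<phi> T \<eta> (Suc n)) \<noteq> {}"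
    then obtain \<omega> where \<omega>: "\<And>n. \<omega> \<in> rough \<phi> T \<eta> (Suc n)" by blast
    then have "\<omega> \<in> space M" unfolding rough_def by blast
    then have "continuous_on {0..1} (\<lambda>t. \<phi> (x (T * t) \<omega>))"
      by (intro continuous_on_subset[OF path_continuous[OF _ \<phi> T]]) auto
    then have "uniformly_continuous_on {0..1} (\<lambda>t. \<phi> (x (T * t) \<omega>))"
      by (rule compact_uniformly_continuous) simp
    then obtain e where e: "e > 0" "\<And>r s. r \<in> {0..1} \<Longrightarrow> s \<in> {0..1} \<Longrightarrow> dist r s < e \<Longrightarrow>
        dist (\<phi> (x (T * r) \<omega>)) (\<phi> (x (T * s) \<omega>)) < \<eta>"
      using \<eta> unfolding uniformly_continuous_on_def by meson
    obtain n where n: "1 / real (Suc n) < e" using e(1) by (metis nat_approx_posE)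
    obtain r s where rs: "r \<in> {0..1}" "s \<in> {0..1}" "\<bar>r - s\<bar> \<le> 1 / real (Suc n)" "norm (\<phi> (x (T * r) \<omega>) - \<phi> (x (T * s) \<omega>)) > \<eta>"
      using \<omega>[of n] unfolding rough_def by blast
    then have "dist r s < e" using n by (simp add: dist_real_def)
    from e(2)[OF rs(1,2) this] rs(4) show False by (simp add: dist_norm)
  qed
  ultimately have "(\<lambda>n. prob (rough \<phi> T \<eta> (Suc n))) \<longlonglongrightarrow> 0" by simp
  then show ?thesis by (rule LIMSEQ_imp_Suc)
qed

text \<open>Rational points of the open cell are dense in the closed cell, and the bound passes to
  the closure by continuity of the path.\<close>

lemma not_rough_real:
  assumes \<omega>: "\<omega> \<in> space M" "\<omega> \<notin> rough \<phi> T \<eta> n" and \<phi>: "continuous_on UNIV \<phi>" and T: "T \<ge> 0" and n: "i < n"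
    and u: "u \<in> {real i / real n..real (Suc i) / real n}"
  shows "norm (\<phi> (x (T * u) \<omega>) - \<phi> (x (T * (real i / real n)) \<omega>)) \<le> \<eta>"
proof -
  let ?a = "real i / real n" and ?b = "real (Suc i) / real n"
  have ab: "?a < ?b" "0 \<le> ?a" "?b \<le> 1" "?b - ?a = 1 / real n"
    using n by (auto simp: field_simps)
  let ?S = "{?a<..<?b} \<inter> \<rat>"
  have cl: "closure ?S = {?a..?b}"
    using ab closure_open_Int_superset[of "{?a<..<?b}" "\<rat>"] by (simp add: Rats_closure_real closure_greaterThanLessThan)
  show ?thesis
  proof (rule continuous_le_on_closure[where S = ?S and f = "\<lambda>u. norm (\<phi> (x (T * u) \<omega>) - \<phi> (x (T * (real i / real n)) \<omega>))"])
    show "continuous_on (closure ?S) (\<lambda>u. norm (\<phi> (x (T * u) \<omega>) - \<phi> (x (T * (real i / real n)) \<omega>)))"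
      unfolding cl using ab by (intro continuous_intros continuous_on_subset[OF path_continuous[OF \<omega>(1) \<phi> T]]) auto
    show "u \<in> closure ?S" using u cl by simp
    fix r assume r: "r \<in> ?S"
    show "norm (\<phi> (x (T * r) \<omega>) - \<phi> (x (T * (real i / real n)) \<omega>)) \<le> \<eta>"
    proof (rule not_rough[OF \<omega>])
      show "\<bar>r - real i / real n\<bar> \<le> 1 / real n" using r ab(4) by auto
    qed (use r ab less_imp_le[OF order_le_less_trans[OF ab(2)]] in auto)
  qed
qed

lemma drift_sum_close:
  assumes \<omega>: "\<omega> \<in> space M" "\<omega> \<notin> rough f T \<eta> n" and T: "T > 0" and n: "n > 0" and i: "i \<le> n" and \<eta>: "\<eta> \<ge> 0"
  shows "norm ((T / real n) *\<^sub>R (\<Sum>l<i. f (x (T * (real l / real n)) \<omega>)) - integral {0..T * (real i / real n)} (\<lambda>s. f (x s \<omega>)))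
     \<le> T * \<eta>"
proof -
  have "continuous_on {0..} (\<lambda>t. f (x (1 * t) \<omega>))" by (rule path_continuous[OF \<omega>(1) f_cont]) simp
  then have cont: "continuous_on {0..} (\<lambda>t. f (x t \<omega>))" by simp
  have int: "(\<lambda>s. f (x s \<omega>)) integrable_on {a..b}" if "0 \<le> a" for a b
    by (rule integrable_continuous_real[OF continuous_on_subset[OF cont]]) (use that in auto)
  have "norm ((T / real n) *\<^sub>R (\<Sum>l<i. f (x (T * (real l / real n)) \<omega>)) - integral {0..T * (real i / real n)} (\<lambda>s. f (x s \<omega>)))
     \<le> T * (real i / real n) * \<eta>"
    using i
  proof (induction i)
    case (Suc i)
    let ?\<tau> = "T / real n" and ?a = "T * (real i / real n)" and ?b = "T * (real (Suc i) / real n)"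
    have ab: "0 \<le> ?a" "?a \<le> ?b" "?b - ?a = ?\<tau>" using T n by (auto simp: field_simps)
    let ?c = "f (x ?a \<omega>)"
    have "integral {0..?a} (\<lambda>s. f (x s \<omega>)) + integral {?a..?b} (\<lambda>s. f (x s \<omega>)) = integral {0..?b} (\<lambda>s. f (x s \<omega>))"
      by (rule Henstock_Kurzweil_Integration.integral_combine) (use ab int in auto)
    moreover have "integral {?a..?b} (\<lambda>s. ?c - f (x s \<omega>)) = ?\<tau> *\<^sub>R ?c - integral {?a..?b} (\<lambda>s. f (x s \<omega>))"
      using ab int by (subst Henstock_Kurzweil_Integration.integral_diff) auto
    moreover have "?\<tau> *\<^sub>R (S + ?c) - B = (?\<tau> *\<^sub>R S - A) + D" if "A + C = B" "D = ?\<tau> *\<^sub>R ?c - C" for S A B C D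
      using that by (auto simp: scaleR_add_right)
    ultimately have "?\<tau> *\<^sub>R ((\<Sum>l<i. f (x (T * (real l / real n)) \<omega>)) + ?c) - integral {0..?b} (\<lambda>s. f (x s \<omega>))
      = (?\<tau> *\<^sub>R (\<Sum>l<i. f (x (T * (real l / real n)) \<omega>)) - integral {0..?a} (\<lambda>s. f (x s \<omega>))) + integral {?a..?b} (\<lambda>s. ?c - f (x s \<omega>))"
      by blast
    also have "norm \<dots> \<le> T * (real i / real n) * \<eta> + \<eta> * (?b - ?a)"
    proof (rule order_trans[OF norm_triangle_ineq add_mono])
      show "norm (integral {?a..?b} (\<lambda>s. ?c - f (x s \<omega>))) \<le> \<eta> * (?b - ?a)"
      proof (rule integral_bound[OF ab(2)])
        show "continuous_on {?a..?b} (\<lambda>s. ?c - f (x s \<omega>))"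
          by (intro continuous_intros continuous_on_subset[OF cont]) (use ab in auto)
        fix s assume s: "s \<in> {?a..?b}"
        have "s / T \<in> {real i / real n..real (Suc i) / real n}" using s T by (auto simp: field_simps)
        from not_rough_real[OF \<omega> f_cont _ _ this] show "norm (?c - f (x s \<omega>)) \<le> \<eta>"
          using T Suc.prems by (simp add: norm_minus_commute)
      qed
    qed (use Suc in auto)
    also have "\<dots> = T * (real (Suc i) / real n) * \<eta>" unfolding ab(3) using n by (simp add: field_simps)
    finally show ?case unfolding sum.lessThan_Suc .
  qed simp
  also have "\<dots> \<le> T * 1 * \<eta>" using T i n \<eta> by (intro mult_right_mono mult_left_mono) auto
  finally show ?thesis by simp
qed

section \<open>Left Riemann sums and their refinement\<close>

definition left_sum :: "real \<Rightarrow> nat \<Rightarrow> nat \<Rightarrow> 'm \<Rightarrow> 'a" where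
  "left_sum T n i \<omega> = (\<Sum>l<i. (W (T * (real (Suc l) / real n)) \<omega> - W (T * (real l / real n)) \<omega>) *\<^sub>R g (x (T * (real l / real n)) \<omega>))"

text \<open>Partitions of [0, T i / n] into i k cells all lie on the one grid of mesh T / (n k), so
  a single k can be chosen for all grid times at once.\<close>

lemma ito_sum_left_sum:
  assumes "n > 0" "k > 0"
  shows "ito_sum W (\<lambda>s \<omega>. g (x s \<omega>)) (T * (real i / real n)) (i * k) \<omega> = left_sum T (n * k) (i * k) \<omega>"
proof (cases "i = 0")
  case False
  have "T * (real i / real n) * real l / real (i * k) = T * (real l / real (n * k))" for l
    using False assms by (simp add: field_simps)
  then show ?thesis unfolding ito_sum_def left_sum_def by (simp only:)
qed (simp add: ito_sum_def left_sum_def)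

text \<open>Puts the sum on the refined grid with the integrand frozen on each original cell; both
  sums then use the same Brownian increments and subtract termwise.\<close>

lemma left_sum_refine:
  assumes "n > 0" "k > 0"
  shows "left_sum T n i \<omega> = (\<Sum>l<i * k. (W (T * (real (Suc l) / real (n * k))) \<omega> - W (T * (real l / real (n * k))) \<omega>) *\<^sub>R
     g (x (T * (real (l div k) / real n)) \<omega>))"
proof -
  let ?w = "\<lambda>l. W (T * (real l / real (n * k))) \<omega>"
  have "(\<Sum>l<i * k. (?w (Suc l) - ?w l) *\<^sub>R g (x (T * (real (l div k) / real n)) \<omega>))
     = (\<Sum>m<i. \<Sum>l = m * k..<m * k + k. (?w (Suc l) - ?w l) *\<^sub>R g (x (T * (real (l div k) / real n)) \<omega>))"
    by (rule sum.nat_group[symmetric])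
  also have "\<dots> = (\<Sum>m<i. (W (T * (real (Suc m) / real n)) \<omega> - W (T * (real m / real n)) \<omega>) *\<^sub>R g (x (T * (real m / real n)) \<omega>))"
  proof (rule sum.cong[OF refl])
    fix m
    have "(\<Sum>l = m * k..<m * k + k. (?w (Suc l) - ?w l) *\<^sub>R g (x (T * (real (l div k) / real n)) \<omega>))
       = (\<Sum>l = m * k..<m * k + k. (?w (Suc l) - ?w l) *\<^sub>R g (x (T * (real m / real n)) \<omega>))"
    proof (rule sum.cong[OF refl])
      fix l assume "l \<in> {m * k..<m * k + k}"
      then have "l div k = m" using assms by (intro div_nat_eqI) (auto simp: mult.commute)
      then show "(?w (Suc l) - ?w l) *\<^sub>R g (x (T * (real (l div k) / real n)) \<omega>) = (?w (Suc l) - ?w l) *\<^sub>R g (x (T * (real m / real n)) \<omega>)" by simp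
    qed
    also have "\<dots> = (\<Sum>l = m * k..<m * k + k. ?w (Suc l) - ?w l) *\<^sub>R g (x (T * (real m / real n)) \<omega>)"
      by (rule scaleR_sum_left[symmetric])
    also have "(\<Sum>l = m * k..<m * k + k. ?w (Suc l) - ?w l) = ?w (m * k + k) - ?w (m * k)"
      by (rule sum_Suc_diff') simp
    also have "real (m * k + k) / real (n * k) = real (Suc m) / real n" using assms by (simp add: field_simps)
    also have "real (m * k) / real (n * k) = real m / real n" using assms by simp
    finally show "(\<Sum>l = m * k..<m * k + k. (?w (Suc l) - ?w l) *\<^sub>R g (x (T * (real (l div k) / real n)) \<omega>))
      = (W (T * (real (Suc m) / real n)) \<omega> - W (T * (real m / real n)) \<omega>) *\<^sub>R g (x (T * (real m / real n)) \<omega>)" .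
  qed
  finally show ?thesis unfolding left_sum_def by simp
qed

lemma left_sum_measurable[measurable]: "T \<ge> 0 \<Longrightarrow> left_sum T n i \<in> borel_measurable M"
proof -
  assume T: "T \<ge> 0"
  have [measurable]: "x (T * (real l / real n)) \<in> borel_measurable M" for l using T by (intro x_measurable) auto
  have [measurable]: "(\<lambda>\<omega>. W (T * (real (Suc l) / real n)) \<omega> - W (T * (real l / real n)) \<omega>) \<in> borel_measurable M" for l
    using T by (intro increment_measurable_M) (auto intro!: mult_left_mono divide_right_mono)
  show ?thesis unfolding left_sum_def by measurable
qed

text \<open>On the refined grid the difference is a martingale transform of \<open>J\<close>, the
  variation of g along the path within a cell. Cutting J off once it has exceeded \<eta> makes it
  bounded and keeps it adapted; outside the rough event nothing is cut. The bound is free of k, as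
  the passage to the Ito integral demands.\<close>

lemma left_sum_refinement_close:
  assumes T: "T > 0" and n: "n > 0" and k: "k > 0" and \<eta>: "\<eta> > 0" and \<theta>: "\<theta> > 0"
  shows "prob {\<omega> \<in> space M. \<exists>i\<le>n. norm (left_sum T n i \<omega> - left_sum T (n * k) (i * k) \<omega>) > \<theta>}
    \<le> prob (rough g T \<eta> n) + 2 * \<eta> * sqrt (T + 1) / \<theta>"
proof -
  define N where "N = n * k"
  define \<delta> where "\<delta> = T / real N"
  have N: "N > 0" using n k by (simp add: N_def)
  have \<delta>: "\<delta> > 0" using T N by (simp add: \<delta>_def)
  have grid: "0 + real l * \<delta> = T * (real l / real N)" for l by (simp add: \<delta>_def)
  interpret discrete_filtration M "\<lambda>i. F (0 + real i * \<delta>)" using \<delta> by (intro grid_filtration) auto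
  define dW where "dW l \<omega> = W (0 + real (Suc l) * \<delta>) \<omega> - W (0 + real l * \<delta>) \<omega>" for l \<omega>
  define J where "J l \<omega> = g (x (T * (real (l div k) / real n)) \<omega>) - g (x (0 + real l * \<delta>) \<omega>)" for l \<omega>
  define B where "B l = running_max (\<lambda>l \<omega>. norm (J l \<omega>)) l" for l
  define J' where "J' l \<omega> = (if B l \<omega> \<le> \<eta> then J l \<omega> else 0)" for l \<omega>
  define S where "S j \<omega> = (\<Sum>l<j. dW l \<omega> *\<^sub>R J' l \<omega>)" for j \<omega>
  have Jm: "J l \<in> borel_measurable (F (0 + real l * \<delta>))" for l
  proof -
    have le: "T * (real (l div k) / real n) \<le> 0 + real l * \<delta>"
    proof -
      have "real (l div k * k) \<le> real l" by (intro of_nat_mono) simp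
      then have "real (l div k) / real n \<le> real l / real N" using n k by (simp add: N_def field_simps)
      then show ?thesis using T unfolding grid by (intro mult_left_mono) auto
    qed
    have [measurable]: "x (T * (real (l div k) / real n)) \<in> borel_measurable (F (0 + real l * \<delta>))"
      using T by (intro F_mono[OF x_adapted le]) auto
    have [measurable]: "x (0 + real l * \<delta>) \<in> borel_measurable (F (0 + real l * \<delta>))" using \<delta> by (intro x_adapted) auto
    show ?thesis unfolding J_def by measurable
  qed
  have Bm: "B l \<in> borel_measurable (F (0 + real l * \<delta>))" for l
    unfolding B_def by (rule running_max_measurable) (use Jm in measurable)
  have J'm: "J' l \<in> borel_measurable (F (0 + real l * \<delta>))" for l
    unfolding J'_def using Jm[of l] Bm[of l] by measurable
  have dWm: "dW l \<in> borel_measurable (F (0 + real (Suc l) * \<delta>))" for l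
    unfolding dW_def using \<delta> by (intro increment_measurable) auto
  have Sm: "S j \<in> borel_measurable (F (0 + real j * \<delta>))" for j
    unfolding S_def
  proof (intro borel_measurable_sum borel_measurable_scaleR)
    fix l assume l: "l \<in> {..<j}"
    then show "dW l \<in> borel_measurable (F (0 + real j * \<delta>))" using G_mono[OF _ dWm[of l]] by (simp add: Suc_le_eq)
    show "J' l \<in> borel_measurable (F (0 + real j * \<delta>))" using G_mono[OF _ J'm[of l]] l by simp
  qed
  have J'_le: "norm (J' l \<omega>) \<le> \<eta>" for l \<omega>
    using running_max_ge[of l l "\<lambda>l \<omega>. norm (J l \<omega>)" \<omega>] \<eta> by (auto simp: J'_def B_def)
  \<comment> \<open>A positive supermartingale: each step up to N adds at most
    \<open>\<eta>\<^sup>2 * \<delta>\<close> to the mean square, and the second summand releases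
    just as much. The 1 and the maximum with 0 keep Z positive at every index. The maximal
    inequality with exponent 1/2 then gives a bound linear in \<eta>.\<close>
  define Z where "Z j \<omega> = (norm (S j \<omega>))\<^sup>2 + \<eta>\<^sup>2 * (1 + max 0 (T - real j * \<delta>))" for j \<omega>
  have Z0: "Z j \<omega> > 0" for j \<omega>
  proof -
    have "1 + max 0 (T - real j * \<delta>) > 0" by linarith
    then have "0 < \<eta>\<^sup>2 * (1 + max 0 (T - real j * \<delta>))" using \<eta> by (intro mult_pos_pos) auto
    then show ?thesis unfolding Z_def by (rule add_nonneg_pos[rotated]) simp
  qed
  have "(\<integral>\<^sup>+\<omega>. ennreal (running_max Z N \<omega> powr (1/2)) \<partial>M) \<le> ennreal (1 / (1 - 1/2)) * (\<integral>\<^sup>+\<omega>. ennreal (Z 0 \<omega> powr (1/2)) \<partial>M)"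
  proof (rule running_max_powr)
    fix j
    show "Z j \<in> borel_measurable (F (0 + real j * \<delta>))" unfolding Z_def using Sm[of j] by measurable
    show "0 < Z j \<omega>" for \<omega> by (rule Z0)
    fix v :: "'m \<Rightarrow> ennreal" assume j: "j < N" and v[measurable]: "v \<in> borel_measurable (F (0 + real j * \<delta>))"
    let ?t = "0 + real j * \<delta>" and ?t' = "0 + real (Suc j) * \<delta>"
    let ?c = "\<lambda>j. \<eta>\<^sup>2 * (1 + max 0 (T - real j * \<delta>))"
    have t: "0 \<le> ?t" "?t < ?t'" "?t' - ?t = \<delta>" using \<delta> by (auto simp: algebra_simps)
    have [measurable]: "S j \<in> borel_measurable M" "J' j \<in> borel_measurable M" "v \<in> borel_measurable M" "dW j \<in> borel_measurable M"
      using G_M[OF Sm] G_M[OF J'm] G_M[OF v] G_M[OF dWm] by auto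
    have c: "?c j = ?c (Suc j) + \<eta>\<^sup>2 * \<delta>"
    proof -
      have "real (Suc j) * \<delta> \<le> real N * \<delta>" using j \<delta> by (intro mult_right_mono) auto
      also have "\<dots> = T" using N by (simp add: \<delta>_def)
      finally have "real (Suc j) * \<delta> \<le> T" .
      then show ?thesis using \<delta> by (simp add: algebra_simps)
    qed
    have cn: "?c j \<ge> 0" for j by simp
    have "(\<integral>\<^sup>+\<omega>. v \<omega> * ennreal (Z (Suc j) \<omega>) \<partial>M)
       = (\<integral>\<^sup>+\<omega>. v \<omega> * ennreal ((norm (S j \<omega> + dW j \<omega> *\<^sub>R J' j \<omega>))\<^sup>2) + v \<omega> * ennreal (?c (Suc j)) \<partial>M)"
      by (intro nn_integral_cong) (simp add: Z_def S_def ennreal_plus distrib_left del: of_nat_Suc)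
    also have "\<dots> = (\<integral>\<^sup>+\<omega>. v \<omega> * ennreal ((norm (S j \<omega> + dW j \<omega> *\<^sub>R J' j \<omega>))\<^sup>2) \<partial>M) + (\<integral>\<^sup>+\<omega>. v \<omega> * ennreal (?c (Suc j)) \<partial>M)"
      by (rule nn_integral_add) measurable
    also have "(\<integral>\<^sup>+\<omega>. v \<omega> * ennreal ((norm (S j \<omega> + dW j \<omega> *\<^sub>R J' j \<omega>))\<^sup>2) \<partial>M)
       = (\<integral>\<^sup>+\<omega>. v \<omega> * ennreal ((norm (S j \<omega>))\<^sup>2 + \<delta> * (norm (J' j \<omega>))\<^sup>2) \<partial>M)"
      using increment_second_moment[OF t(1,2) Sm[of j] J'm[of j] v] unfolding t(3) dW_def .
    also have "\<dots> + (\<integral>\<^sup>+\<omega>. v \<omega> * ennreal (?c (Suc j)) \<partial>M)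
       = (\<integral>\<^sup>+\<omega>. v \<omega> * ennreal ((norm (S j \<omega>))\<^sup>2 + \<delta> * (norm (J' j \<omega>))\<^sup>2) + v \<omega> * ennreal (?c (Suc j)) \<partial>M)"
      by (rule nn_integral_add[symmetric]) measurable
    also have "\<dots> \<le> (\<integral>\<^sup>+\<omega>. v \<omega> * ennreal (Z j \<omega>) \<partial>M)"
    proof (rule nn_integral_mono)
      fix \<omega>
      have "(norm (J' j \<omega>))\<^sup>2 \<le> \<eta>\<^sup>2" using J'_le by (intro power_mono) auto
      then have "\<delta> * (norm (J' j \<omega>))\<^sup>2 \<le> \<eta>\<^sup>2 * \<delta>" using \<delta> by (simp add: mult.commute)
      then have "((norm (S j \<omega>))\<^sup>2 + \<delta> * (norm (J' j \<omega>))\<^sup>2) + ?c (Suc j) \<le> Z j \<omega>" unfolding Z_def c by simp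
      then have "v \<omega> * ennreal (((norm (S j \<omega>))\<^sup>2 + \<delta> * (norm (J' j \<omega>))\<^sup>2) + ?c (Suc j)) \<le> v \<omega> * ennreal (Z j \<omega>)"
        by (intro mult_left_mono ennreal_leI) auto
      moreover have "ennreal (((norm (S j \<omega>))\<^sup>2 + \<delta> * (norm (J' j \<omega>))\<^sup>2) + ?c (Suc j)) = ennreal ((norm (S j \<omega>))\<^sup>2 + \<delta> * (norm (J' j \<omega>))\<^sup>2) + ennreal (?c (Suc j))"
        using \<delta> cn by (intro ennreal_plus) auto
      ultimately show "v \<omega> * ennreal ((norm (S j \<omega>))\<^sup>2 + \<delta> * (norm (J' j \<omega>))\<^sup>2) + v \<omega> * ennreal (?c (Suc j)) \<le> v \<omega> * ennreal (Z j \<omega>)"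
        by (simp add: distrib_left)
    qed
    finally show "(\<integral>\<^sup>+\<omega>. v \<omega> * ennreal (Z (Suc j) \<omega>) \<partial>M) \<le> (\<integral>\<^sup>+\<omega>. v \<omega> * ennreal (Z j \<omega>) \<partial>M)" .
  qed auto
  also have "\<dots> = ennreal (2 * (\<eta> * sqrt (T + 1)))"
  proof -
    have "Z 0 \<omega> powr (1/2) = \<eta> * sqrt (T + 1)" for \<omega>
      using T \<eta> by (simp add: Z_def S_def powr_half_sqrt real_sqrt_mult add.commute)
    then show ?thesis using \<eta> T by (simp add: emeasure_space_1 ennreal_mult)
  qed
  finally have EZ: "(\<integral>\<^sup>+\<omega>. ennreal (running_max Z N \<omega> powr (1/2)) \<partial>M) \<le> ennreal (2 * (\<eta> * sqrt (T + 1)))" .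
  let ?E = "{\<omega> \<in> space M. \<exists>i\<le>n. norm (left_sum T n i \<omega> - left_sum T (n * k) (i * k) \<omega>) > \<theta>}"
  let ?Q = "{\<omega> \<in> space M. running_max Z N \<omega> powr (1/2) \<ge> \<theta>}"
  have RZ[measurable]: "running_max Z N \<in> borel_measurable M"
    by (rule G_M[OF running_max_measurable]) (unfold Z_def, use Sm in measurable)
  have R[measurable]: "rough g T \<eta> n \<in> sets M" using T by (intro rough_measurable g_cont) auto
  have sub: "?E \<subseteq> rough g T \<eta> n \<union> ?Q"
  proof
    fix \<omega> assume E: "\<omega> \<in> ?E"
    then obtain i where i: "i \<le> n" "norm (left_sum T n i \<omega> - left_sum T (n * k) (i * k) \<omega>) > \<theta>" and \<omega>: "\<omega> \<in> space M" by blast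
    show "\<omega> \<in> rough g T \<eta> n \<union> ?Q"
    proof (cases "\<omega> \<in> rough g T \<eta> n")
      case False
      have J_le: "norm (J l \<omega>) \<le> \<eta>" if "l < N" for l
      proof -
        have "real (l div k) / real n \<le> real l / real N \<and> real l / real N - real (l div k) / real n \<le> 1 / real n"
        proof -
          have "l = (l div k) * k + l mod k" by simp
          then have "real l = real (l div k) * real k + real (l mod k)" by (metis of_nat_add of_nat_mult)
          moreover have "real (l mod k) \<le> real k" using k by (simp add: less_imp_le)
          ultimately show ?thesis using n k by (simp add: N_def field_simps)
        qed
        moreover have "real l / real N \<le> 1" using that N by simp
        ultimately have "norm (g (x (T * (real (l div k) / real n)) \<omega>) - g (x (T * (real l / real N)) \<omega>)) \<le> \<eta>"
          by (intro not_rough[OF \<omega> False]) auto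
        then show ?thesis by (simp add: J_def grid[simplified])
      qed
      have J': "J' l \<omega> = J l \<omega>" if "l < N" for l
      proof -
        obtain l' where "l' \<le> l" "B l \<omega> = norm (J l' \<omega>)" using running_max_attained[of l "\<lambda>l \<omega>. norm (J l \<omega>)" \<omega>] unfolding B_def by blast
        then show ?thesis using J_le[of l'] that by (simp add: J'_def)
      qed
      have ik: "i * k \<le> N" using i by (simp add: N_def)
      have "left_sum T n i \<omega> - left_sum T (n * k) (i * k) \<omega> = (\<Sum>l<i * k. dW l \<omega> *\<^sub>R J l \<omega>)"
        unfolding left_sum_refine[OF n k] unfolding left_sum_def J_def dW_def grid N_def
        by (simp add: sum_subtractf[symmetric] scaleR_diff_right[symmetric])
      also have "\<dots> = S (i * k) \<omega>" unfolding S_def using ik by (intro sum.cong) (auto simp: J')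
      finally have "\<theta> < norm (S (i * k) \<omega>)" using i by simp
      also have "\<dots> = sqrt ((norm (S (i * k) \<omega>))\<^sup>2)" by simp
      also have "\<dots> \<le> sqrt (Z (i * k) \<omega>)" by (intro real_sqrt_le_mono) (simp add: Z_def)
      also have "\<dots> \<le> sqrt (running_max Z N \<omega>)" using running_max_ge[OF ik, of Z \<omega>] by (intro real_sqrt_le_mono)
      also have "\<dots> = running_max Z N \<omega> powr (1/2)"
        using running_max_ge[of 0 N Z \<omega>] Z0[of 0 \<omega>] by (simp add: powr_half_sqrt)
      finally show ?thesis using \<omega> by auto
    qed simp
  qed
  have Q: "prob ?Q \<le> 2 * (\<eta> * sqrt (T + 1)) / \<theta>"
    by (rule prob_ge_le_nn_integral[OF _ EZ]) (use \<eta> \<theta> T in auto)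
  have "prob ?E \<le> prob (rough g T \<eta> n \<union> ?Q)" by (intro finite_measure_mono sub) measurable
  also have "\<dots> \<le> prob (rough g T \<eta> n) + prob ?Q" by (intro measure_Un_le) auto
  finally show ?thesis using Q by simp
qed

end

section \<open>Euler sums along the exact path and convergence in probability\<close>

context bem_solution
begin

text \<open>Its coefficients are evaluated along the exact path, so that it moves by explicit
  increments of the same shape as the implicit images of a chain and
  \<open>error_process_step\<close> applies to the difference.\<close>

definition left_scheme :: "real \<Rightarrow> nat \<Rightarrow> nat \<Rightarrow> 'm \<Rightarrow> 'a" where
  "left_scheme T n i \<omega> = x0 + (T / real n) *\<^sub>R (\<Sum>l<i. f (x (T * (real l / real n)) \<omega>)) + left_sum T n i \<omega>"

lemma left_scheme_measurable: "T \<ge> 0 \<Longrightarrow> left_scheme T n i \<in> borel_measurable M"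
proof -
  assume T: "T \<ge> 0"
  have [measurable]: "x (T * (real l / real n)) \<in> borel_measurable M" for l using T by (intro x_measurable) auto
  note [measurable] = left_sum_measurable[OF T]
  show ?thesis unfolding left_scheme_def by measurable
qed

text \<open>For fixed n, a refinement index k depending on n brings the refined sums close to the
  Ito integrals at all n + 1 grid times, while the distance between the sums for n and for n k is
  bounded uniformly in k. So k disappears from the conclusion, although the integral at each time is
  a separate limit.\<close>

lemma left_scheme_close:
  assumes T: "T > 0" and \<theta>: "\<theta> > 0" and \<epsilon>: "\<epsilon> > 0"
  shows "\<forall>\<^sub>F n in sequentially. prob {\<omega> \<in> space M. \<exists>i\<le>n. norm (left_scheme T n i \<omega> - x (T * (real i / real n)) \<omega>) > \<theta>} \<le> \<epsilon>"
proof -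
  define \<theta>' where "\<theta>' = \<theta> / 3"
  \<comment> \<open>Chosen so that the Markov term of the refinement estimate equals \<epsilon> /
    4.\<close>
  define \<eta> where "\<eta> = \<epsilon> * \<theta>' / (8 * sqrt (T + 1))"
  have \<theta>': "\<theta>' > 0" and \<eta>: "\<eta> > 0" using \<theta> \<epsilon> T by (auto simp: \<theta>'_def \<eta>_def)
  have \<eta>': "2 * \<eta> * sqrt (T + 1) / \<theta>' = \<epsilon> / 4" using \<theta>' T by (simp add: \<eta>_def)
  have "\<forall>\<^sub>F n in sequentially. prob (rough g T \<eta> n) < \<epsilon> / 4"
    by (rule order_tendstoD(2)[OF rough_tendsto_0[OF g_cont]]) (use T \<epsilon> \<eta> in auto)
  moreover have "\<forall>\<^sub>F n in sequentially. prob (rough f T (\<theta>' / T) n) < \<epsilon> / 4"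
    by (rule order_tendstoD(2)[OF rough_tendsto_0[OF f_cont]]) (use T \<epsilon> \<theta>' in auto)
  moreover have "\<forall>\<^sub>F n::nat in sequentially. n > 0" by (rule eventually_gt_at_top)
  ultimately show ?thesis
  proof eventually_elim
    case (elim n)
    then have n: "n > 0" by simp
    define is_I where "is_I i J \<longleftrightarrow> ito_integral_is M W (\<lambda>s \<omega>. g (x s \<omega>)) (T * (real i / real n)) J \<and>
        (AE \<omega> in M. x (T * (real i / real n)) \<omega> = x0 + integral {0..T * (real i / real n)} (\<lambda>s. f (x s \<omega>)) + J \<omega>)" for i J
    \<comment> \<open>The solution concept provides an integral for each time separately; one
      version is picked per grid time.\<close>
    define I where "I i = (SOME J. is_I i J)" for i
    have "\<exists>J. is_I i J" for i
      using sol T unfolding sde_solution_def is_I_def by simp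
    then have "is_I i (I i)" for i unfolding I_def by (rule someI_ex)
    then have I: "\<And>i. ito_integral_is M W (\<lambda>s \<omega>. g (x s \<omega>)) (T * (real i / real n)) (I i)"
      and xI: "\<And>i. AE \<omega> in M. x (T * (real i / real n)) \<omega> = x0 + integral {0..T * (real i / real n)} (\<lambda>s. f (x s \<omega>)) + I i \<omega>"
      unfolding is_I_def by blast+
    have [measurable]: "I i \<in> borel_measurable M" for i using I[of i] by (simp add: ito_integral_is_def)
    define G where "G k i = {\<omega> \<in> space M. norm (left_sum T (n * k) (i * k) \<omega> - I i \<omega>) > \<theta>'}" for k i
    have Gm[measurable]: "G k i \<in> sets M" for k i
    proof -
      have [measurable]: "left_sum T (n * k) (i * k) \<in> borel_measurable M" using T by (intro left_sum_measurable) auto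
      show ?thesis unfolding G_def by measurable
    qed
    have lim: "(\<lambda>k. prob (G k i)) \<longlonglongrightarrow> 0" for i
    proof (cases "i = 0")
      \<comment> \<open>Here \<open>i * k\<close> does not tend to infinity. All increments at time
        0 vanish, and the limit is taken along k itself.\<close>
      case True
      have "(\<lambda>k. measure M {\<omega> \<in> space M. norm (ito_sum W (\<lambda>s \<omega>. g (x s \<omega>)) (T * (real i / real n)) k \<omega> - I i \<omega>) > \<theta>'}) \<longlonglongrightarrow> 0"
        using I[of i] \<theta>' by (simp add: ito_integral_is_def)
      moreover have "ito_sum W (\<lambda>s \<omega>. g (x s \<omega>)) (T * (real i / real n)) k \<omega> = left_sum T (n * k) (i * k) \<omega>" for k \<omega>
        using True by (simp add: ito_sum_def left_sum_def)
      ultimately show ?thesis unfolding G_def by simp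
    next
      case False
      have "(\<lambda>k. measure M {\<omega> \<in> space M. norm (ito_sum W (\<lambda>s \<omega>. g (x s \<omega>)) (T * (real i / real n)) k \<omega> - I i \<omega>) > \<theta>'}) \<longlonglongrightarrow> 0"
        using I[of i] \<theta>' by (simp add: ito_integral_is_def)
      moreover have "filterlim (\<lambda>k. i * k) sequentially sequentially" using False by (intro mult_nat_left_at_top) simp
      ultimately have "(\<lambda>k. measure M {\<omega> \<in> space M. norm (ito_sum W (\<lambda>s \<omega>. g (x s \<omega>)) (T * (real i / real n)) (i * k) \<omega> - I i \<omega>) > \<theta>'}) \<longlonglongrightarrow> 0"
        by (rule filterlim_compose)
      moreover have "\<forall>\<^sub>F k in sequentially. measure M {\<omega> \<in> space M. norm (ito_sum W (\<lambda>s \<omega>. g (x s \<omega>)) (T * (real i / real n)) (i * k) \<omega> - I i \<omega>) > \<theta>'} = prob (G k i)"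
        using eventually_gt_at_top[of "0::nat"] by eventually_elim (simp only: G_def ito_sum_left_sum[OF n])
      ultimately show ?thesis by (rule Lim_transform_eventually)
    qed
    have "\<forall>\<^sub>F k in sequentially. \<forall>i\<in>{..n}. prob (G k i) < \<epsilon> / (4 * real (Suc n))"
      by (intro eventually_ball_finite ballI order_tendstoD(2)[OF lim]) (use \<epsilon> in auto)
    then have "\<forall>\<^sub>F k in sequentially. (\<forall>i\<in>{..n}. prob (G k i) < \<epsilon> / (4 * real (Suc n))) \<and> k > 0"
      using eventually_gt_at_top[of "0::nat"] by (rule eventually_conj)
    then obtain k where k': "(\<forall>i\<in>{..n}. prob (G k i) < \<epsilon> / (4 * real (Suc n))) \<and> k > 0"
      using eventually_happens'[OF sequentially_bot] by blast
    then have k: "k > 0" and Gk: "\<And>i. i \<le> n \<Longrightarrow> prob (G k i) < \<epsilon> / (4 * real (Suc n))" by auto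
    let ?E = "{\<omega> \<in> space M. \<exists>i\<le>n. norm (left_sum T n i \<omega> - left_sum T (n * k) (i * k) \<omega>) > \<theta>'}"
    let ?B = "{\<omega> \<in> space M. \<exists>i\<le>n. norm (left_scheme T n i \<omega> - x (T * (real i / real n)) \<omega>) > \<theta>}"
    have [measurable]: "left_sum T n i \<in> borel_measurable M" "left_sum T (n * k) i \<in> borel_measurable M"
      "x (T * (real i / real n)) \<in> borel_measurable M" "left_scheme T n i \<in> borel_measurable M" for i
      using T by (auto intro!: left_sum_measurable x_measurable left_scheme_measurable)
    have Em[measurable]: "?E \<in> sets M" by measurable
    have rm[measurable]: "rough f T (\<theta>' / T) n \<in> sets M" using T by (intro rough_measurable f_cont) auto
    have "AE \<omega> in M. \<forall>i\<in>{..n}. x (T * (real i / real n)) \<omega> = x0 + integral {0..T * (real i / real n)} (\<lambda>s. f (x s \<omega>)) + I i \<omega>"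
      using xI by (intro AE_finite_allI) auto
    then have "AE \<omega> in M. \<omega> \<in> ?B \<longrightarrow> \<omega> \<in> ?E \<union> (\<Union>i\<in>{..n}. G k i) \<union> rough f T (\<theta>' / T) n"
    proof eventually_elim
      case (elim \<omega>)
      show ?case
      proof (intro impI, rule ccontr)
        assume B: "\<omega> \<in> ?B" and no: "\<omega> \<notin> ?E \<union> (\<Union>i\<in>{..n}. G k i) \<union> rough f T (\<theta>' / T) n"
        then obtain i where i: "i \<le> n" "norm (left_scheme T n i \<omega> - x (T * (real i / real n)) \<omega>) > \<theta>" and \<omega>: "\<omega> \<in> space M" by blast
        let ?t = "T * (real i / real n)"
        let ?Dr = "(T / real n) *\<^sub>R (\<Sum>l<i. f (x (T * (real l / real n)) \<omega>)) - integral {0..?t} (\<lambda>s. f (x s \<omega>))"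
        let ?L1 = "left_sum T n i \<omega> - left_sum T (n * k) (i * k) \<omega>" and ?L2 = "left_sum T (n * k) (i * k) \<omega> - I i \<omega>"
        have "norm ?Dr \<le> T * (\<theta>' / T)"
          using no \<omega> i T n \<theta>' by (intro drift_sum_close) auto
        then have 1: "norm ?Dr \<le> \<theta>'" using T by simp
        have 2: "norm ?L1 \<le> \<theta>'" using no \<omega> i(1) by (auto simp: not_less)
        have 3: "norm ?L2 \<le> \<theta>'" using no \<omega> i(1) unfolding G_def by (auto simp: not_less)
        have eq: "left_scheme T n i \<omega> - x ?t \<omega> = ?Dr + ?L1 + ?L2"
          using elim i(1) unfolding left_scheme_def by simp
        have "norm (left_scheme T n i \<omega> - x ?t \<omega>) \<le> norm ?Dr + norm ?L1 + norm ?L2"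
          unfolding eq by (rule order_trans[OF norm_triangle_ineq add_right_mono[OF norm_triangle_ineq]])
        then have "norm (left_scheme T n i \<omega> - x ?t \<omega>) \<le> \<theta>' + \<theta>' + \<theta>'" using 1 2 3 by linarith
        also have "\<dots> = \<theta>" by (simp add: \<theta>'_def)
        finally show False using i(2) by linarith
      qed
    qed
    then have "prob ?B \<le> prob (?E \<union> (\<Union>i\<in>{..n}. G k i) \<union> rough f T (\<theta>' / T) n)"
      by (intro finite_measure_mono_AE) auto
    also have "\<dots> \<le> prob ?E + prob (\<Union>i\<in>{..n}. G k i) + prob (rough f T (\<theta>' / T) n)"
      by (intro order_trans[OF measure_Un_le] add_right_mono measure_Un_le) auto
    also have "prob ?E \<le> \<epsilon> / 4 + \<epsilon> / 4"
      using left_sum_refinement_close[OF T n k \<eta> \<theta>'] elim(1) unfolding \<eta>' by linarith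
    also have "prob (\<Union>i\<in>{..n}. G k i) \<le> (\<Sum>i\<in>{..n}. prob (G k i))"
      by (intro finite_measure_subadditive_finite) auto
    also have "\<dots> \<le> (\<Sum>i\<in>{..n}. \<epsilon> / (4 * real (Suc n)))" using Gk by (intro sum_mono less_imp_le) auto
    also have "\<dots> = \<epsilon> / 4" by (simp add: field_simps)
    finally show "prob ?B \<le> \<epsilon>" using elim(2) by simp
  qed
qed

lemma path_bounded_in_probability:
  assumes T: "T \<ge> 0" and \<epsilon>: "\<epsilon> > 0"
  shows "\<exists>R\<ge>0. {\<omega> \<in> space M. \<exists>r\<in>\<rat> \<inter> {0..1}. norm (x (T * r) \<omega>) > R} \<in> sets M \<and>
    prob {\<omega> \<in> space M. \<exists>r\<in>\<rat> \<inter> {0..1}. norm (x (T * r) \<omega>) > R} \<le> \<epsilon>"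
proof -
  define H where "H R = {\<omega> \<in> space M. \<exists>r\<in>\<rat> \<inter> {0..1}. norm (x (T * r) \<omega>) > real R}" for R :: nat
  have c: "countable (\<rat> \<inter> {0..1 :: real})" using countable_rat by blast
  have S: "{\<omega> \<in> space M. norm (x (T * r) \<omega>) > real R} \<in> sets M" if "r \<in> \<rat> \<inter> {0..1}" for r R
  proof -
    have [measurable]: "x (T * r) \<in> borel_measurable M" using that T by (intro x_measurable) auto
    show ?thesis by measurable
  qed
  have Hm: "H R \<in> sets M" for R
  proof -
    have "H R = (\<Union>r\<in>\<rat> \<inter> {0..1}. {\<omega> \<in> space M. norm (x (T * r) \<omega>) > real R})" unfolding H_def by blast
    also have "\<dots> \<in> sets M" by (rule sets.countable_UN''[OF c], rule S)
    finally show ?thesis .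
  qed
  have "decseq H"
  proof (rule decseq_SucI)
    fix n
    have "norm y > real n" if "norm y > real (Suc n)" for y :: 'a using that by simp
    then show "H (Suc n) \<subseteq> H n" unfolding H_def by blast
  qed
  then have "(\<lambda>R. prob (H R)) \<longlonglongrightarrow> prob (\<Inter>R. H R)" using Hm by (intro finite_Lim_measure_decseq) auto
  moreover have "(\<Inter>R. H R) = {}"
  proof (rule ccontr)
    assume "(\<Inter>R. H R) \<noteq> {}"
    then obtain \<omega> where \<omega>: "\<And>R. \<omega> \<in> H R" by blast
    then have "\<omega> \<in> space M" unfolding H_def by blast
    then have "continuous_on {0..} (\<lambda>t. id (x (T * t) \<omega>))" by (intro path_continuous T) (auto simp: continuous_on_id)
    then have "continuous_on {0..1} (\<lambda>t. x (T * t) \<omega>)" by (auto elim: continuous_on_subset)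
    then have "compact ((\<lambda>t. x (T * t) \<omega>) ` {0..1})" by (rule compact_continuous_image) simp
    then obtain B where B: "\<And>t. t \<in> {0..1} \<Longrightarrow> norm (x (T * t) \<omega>) \<le> B"
      using compact_imp_bounded bounded_iff by (metis imageI)
    obtain R :: nat where "B \<le> real R" using real_arch_simple by blast
    then show False using \<omega>[of R] B unfolding H_def by fastforce
  qed
  ultimately have "(\<lambda>R. prob (H R)) \<longlonglongrightarrow> 0" by simp
  then have "\<forall>\<^sub>F R in sequentially. prob (H R) < \<epsilon>" using \<epsilon> by (rule order_tendstoD(2))
  then obtain R where "prob (H R) < \<epsilon>" using eventually_happens'[OF sequentially_bot] by blast
  then show ?thesis using Hm[of R] unfolding H_def by (intro exI[of _ "real R"]) auto
qed

text \<open>The maximal inequality for the energy with exponent 1/2, followed by Markov's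
  inequality; R depends neither on the step size nor on the number of steps.\<close>

lemma chain_bounded_in_probability:
  assumes T: "T > 0" and \<epsilon>: "\<epsilon> > 0"
  shows "\<exists>R\<ge>0. \<forall>\<tau> n Y. small \<tau> \<longrightarrow> real n * \<tau> \<le> T \<longrightarrow> chain 0 \<tau> Y \<longrightarrow> (\<forall>\<omega>\<in>space M. Y 0 \<omega> = x0) \<longrightarrow>
    prob {\<omega> \<in> space M. \<exists>i\<le>n. norm (Y i \<omega>) > R} \<le> \<epsilon>"
proof -
  define E0 where "E0 = (2 + L)\<^sup>2 * (1 + norm x0) ^ (2 * Suc d)"
  define C where "C = exp (2 * (c1 + c2) * T) / (1 - 1/2) * E0 powr (1/2)"
  define R where "R = (3 + 2 * (c1 + c2)) * (C / \<epsilon>)"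
  \<comment> \<open>Evaluated at some admissible step just to see that the step-free bound
    \<open>E0\<close> is at least 1.\<close>
  have "1 \<le> E0" using energy_ge_1 energy_growth[of "min 1 (min (1 / (2 * c1)) (1 / (2 * c3)))" x0] pos
    unfolding E0_def small_def by (force simp: field_simps min_def intro: order_trans)
  then have C: "C > 0" by (simp add: C_def)
  have R: "R \<ge> 0" using C pos \<epsilon> by (simp add: R_def)
  show ?thesis
  proof (intro exI[of _ R] conjI R allI impI)
    fix \<tau> n Y assume \<tau>: "small \<tau>" and n: "real n * \<tau> \<le> T" and Y: "chain 0 \<tau> Y" and Y0: "\<forall>\<omega>\<in>space M. Y 0 \<omega> = x0"
    have tau: "0 < \<tau>" using \<tau> by (simp add: small_def)
    interpret discrete_filtration M "\<lambda>i. F (0 + real i * \<tau>)" using tau by (intro grid_filtration) auto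
    let ?m = "running_max (\<lambda>i \<omega>. energy \<tau> (Y i \<omega>)) n"
    have Ym: "Y i \<in> borel_measurable (F (0 + real i * \<tau>))" for i by (rule chain_adapted[OF Y \<tau>]) simp
    have m[measurable]: "?m \<in> borel_measurable M"
      by (rule G_M[OF running_max_measurable]) (use Ym in \<open>simp add: energy_def\<close>)
    have "(\<integral>\<^sup>+\<omega>. ennreal (?m \<omega> powr (1/2)) \<partial>M)
      \<le> ennreal (exp (2 * (c1 + c2) * (real n * \<tau>)) / (1 - 1/2)) * (\<integral>\<^sup>+\<omega>. ennreal (energy \<tau> (Y 0 \<omega>) powr (1/2)) \<partial>M)"
      by (rule chain_sup_moment[OF Y \<tau>]) auto
    also have "\<dots> \<le> ennreal (exp (2 * (c1 + c2) * T) / (1 - 1/2)) * ennreal (E0 powr (1/2))"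
    proof (rule mult_mono)
      show "ennreal (exp (2 * (c1 + c2) * (real n * \<tau>)) / (1 - 1/2)) \<le> ennreal (exp (2 * (c1 + c2) * T) / (1 - 1/2))"
        using n pos by (intro ennreal_leI divide_right_mono iffD2[OF exp_le_cancel_iff] mult_left_mono) auto
      have "(\<integral>\<^sup>+\<omega>. ennreal (energy \<tau> (Y 0 \<omega>) powr (1/2)) \<partial>M) \<le> (\<integral>\<^sup>+\<omega>. ennreal (E0 powr (1/2)) \<partial>M)"
      proof (intro nn_integral_mono ennreal_leI powr_mono2)
        fix \<omega> assume "\<omega> \<in> space M"
        then show "energy \<tau> (Y 0 \<omega>) \<le> E0" using energy_growth[OF \<tau>, of x0] Y0 by (simp add: E0_def)
        show "0 \<le> energy \<tau> (Y 0 \<omega>)" using energy_ge_1[of \<tau> "Y 0 \<omega>"] by simp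
      qed simp
      then show "(\<integral>\<^sup>+\<omega>. ennreal (energy \<tau> (Y 0 \<omega>) powr (1/2)) \<partial>M) \<le> ennreal (E0 powr (1/2))" by (simp add: emeasure_space_1)
    qed auto
    also have "\<dots> = ennreal C" unfolding C_def by (rule ennreal_mult[symmetric]) auto
    finally have "prob {\<omega> \<in> space M. ?m \<omega> powr (1/2) \<ge> C / \<epsilon>} \<le> C / (C / \<epsilon>)"
      using C \<epsilon> by (intro prob_ge_le_nn_integral) auto
    also have "\<dots> = \<epsilon>" using C \<epsilon> by simp
    finally have P: "prob {\<omega> \<in> space M. ?m \<omega> powr (1/2) \<ge> C / \<epsilon>} \<le> \<epsilon>" .
    have "{\<omega> \<in> space M. \<exists>i\<le>n. norm (Y i \<omega>) > R} \<subseteq> {\<omega> \<in> space M. ?m \<omega> powr (1/2) \<ge> C / \<epsilon>}"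
    proof safe
      fix \<omega> i assume \<omega>: "\<omega> \<in> space M" and i: "i \<le> n" and "R < norm (Y i \<omega>)"
      then have "R < 1 + norm (Y i \<omega>)" by simp
      also have "\<dots> \<le> (3 + 2 * (c1 + c2)) * sqrt (energy \<tau> (Y i \<omega>))" unfolding energy_def by (rule norm_le_implicit[OF \<tau>])
      also have "\<dots> \<le> (3 + 2 * (c1 + c2)) * sqrt (?m \<omega>)"
        using pos running_max_ge[OF i, of "\<lambda>i \<omega>. energy \<tau> (Y i \<omega>)" \<omega>] by (intro mult_left_mono real_sqrt_le_mono) auto
      also have "sqrt (?m \<omega>) = ?m \<omega> powr (1/2)"
        using running_max_ge[of 0 n "\<lambda>i \<omega>. energy \<tau> (Y i \<omega>)" \<omega>] energy_ge_1[of \<tau> "Y 0 \<omega>"] by (simp add: powr_half_sqrt)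
      finally show "C / \<epsilon> \<le> ?m \<omega> powr (1/2)"
        unfolding R_def using pos by (subst (asm) mult_less_cancel_left_pos) auto
    qed
    then have "prob {\<omega> \<in> space M. \<exists>i\<le>n. norm (Y i \<omega>) > R} \<le> prob {\<omega> \<in> space M. ?m \<omega> powr (1/2) \<ge> C / \<epsilon>}"
      by (intro finite_measure_mono) measurable
    with P show "prob {\<omega> \<in> space M. \<exists>i\<le>n. norm (Y i \<omega>) > R} \<le> \<epsilon>" by linarith
  qed
qed

text \<open>The test at index l already includes \<open>a l\<close>, so the summation stops before
  the threshold is crossed and there is no overshoot. For adapted a such weights are
  predictable.\<close>

lemma stopped_sum_le:
  fixes a :: "nat \<Rightarrow> real"
  assumes "\<And>i. a i \<ge> 0" "\<delta> \<ge> 0"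
  shows "(\<Sum>l<k. (if (\<Sum>i<Suc l. a i) \<le> \<delta> then 1 else 0) * a l) \<le> \<delta>"
proof (induction k)
  case (Suc k)
  show ?case
  proof (cases "(\<Sum>i<Suc k. a i) \<le> \<delta>")
    case True
    have "(\<Sum>l<Suc k. (if (\<Sum>i<Suc l. a i) \<le> \<delta> then 1 else 0) * a l) \<le> (\<Sum>l<Suc k. a l)"
      using assms by (intro sum_mono) auto
    then show ?thesis using True by linarith
  next
    case False
    then show ?thesis using Suc by simp
  qed
qed (use assms in simp)

text \<open>No moments of weights along the exact path are at hand, so the error recursion is
  localised: predictable 0-1 weights stop it before the accumulated source exceeds \<delta>. Off
  events of small probability, path and chain are bounded and the left scheme is close to the path;
  there, for large n, nothing is stopped.\<close>

lemma chain_converges: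
  assumes T: "T > 0" and \<epsilon>: "\<epsilon> > 0"
  shows "\<forall>\<^sub>F n in sequentially. \<forall>Y. chain 0 (T / real n) Y \<longrightarrow> (\<forall>\<omega>\<in>space M. Y 0 \<omega> = x0) \<longrightarrow>
     prob {\<omega> \<in> space M. norm (x T \<omega> - Y n \<omega>) > \<epsilon>} \<le> \<epsilon>"
proof -
  obtain R1 where R1: "R1 \<ge> 0" and H[measurable]: "{\<omega> \<in> space M. \<exists>r\<in>\<rat> \<inter> {0..1}. norm (x (T * r) \<omega>) > R1} \<in> sets M"
    and PH: "prob {\<omega> \<in> space M. \<exists>r\<in>\<rat> \<inter> {0..1}. norm (x (T * r) \<omega>) > R1} \<le> \<epsilon> / 4"
    using path_bounded_in_probability[of T "\<epsilon> / 4"] T \<epsilon> by auto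
  obtain R2 where R2: "R2 \<ge> 0" and PY: "\<And>\<tau> n Y. small \<tau> \<Longrightarrow> real n * \<tau> \<le> T \<Longrightarrow> chain 0 \<tau> Y \<Longrightarrow> \<forall>\<omega>\<in>space M. Y 0 \<omega> = x0 \<Longrightarrow>
    prob {\<omega> \<in> space M. \<exists>i\<le>n. norm (Y i \<omega>) > R2} \<le> \<epsilon> / 4"
    using chain_bounded_in_probability[of T "\<epsilon> / 4"] T \<epsilon> by auto
  define Cg where "Cg = exp (2 * (c3 + 1) * T)"
  \<comment> \<open>The stopped recursion bounds the mean square by
    \<open>Cg * (2 * \<delta>)\<close>; Markov's inequality at level
    \<open>(\<epsilon> / 2)\<^sup>2\<close> then gives \<epsilon> / 4.\<close>
  define \<delta> where "\<delta> = \<epsilon> ^ 3 / (32 * Cg)"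
  define A where "A = (1 + R1 + R2) ^ Suc d"
  \<comment> \<open>The second entry makes
    \<open>T * Ca * A\<^sup>2 * (2 * \<theta>\<^sup>2)\<close>, the part of the source that does not
    vanish with the step size, at most \<delta> / 2.\<close>
  define \<theta> where "\<theta> = min (\<epsilon> / 4) (sqrt (\<delta> / (4 * T * Ca * A\<^sup>2)))"
  have Cg: "Cg > 0" by (simp add: Cg_def)
  have \<delta>: "\<delta> > 0" using \<epsilon> Cg by (simp add: \<delta>_def)
  have A: "A \<ge> 1" unfolding A_def using R1 R2 by (intro one_le_power) auto
  have \<theta>: "\<theta> > 0" "\<theta> \<le> \<epsilon> / 4" using \<epsilon> \<delta> T Ca_pos A by (auto simp: \<theta>_def)
  have \<theta>2: "T * Ca * A\<^sup>2 * (2 * \<theta>\<^sup>2) \<le> \<delta> / 2"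
  proof -
    have "\<theta>\<^sup>2 \<le> (sqrt (\<delta> / (4 * T * Ca * A\<^sup>2)))\<^sup>2" using \<theta> by (intro power_mono) (auto simp: \<theta>_def)
    also have "\<dots> = \<delta> / (4 * T * Ca * A\<^sup>2)" using \<delta> T Ca_pos A by simp
    finally show ?thesis using T Ca_pos A by (simp add: field_simps)
  qed
  have lim: "((\<lambda>n. T / real n * B) \<longlongrightarrow> 0) sequentially" for B
    using tendsto_mult[OF tendsto_divide_0[OF tendsto_const filterlim_at_top_imp_at_infinity[OF filterlim_real_sequentially]] tendsto_const[of B]] by simp
  have ev: "\<forall>\<^sub>F n in sequentially. T / real n * B < u" if "u > 0" for B u
    by (rule order_tendstoD(2)[OF lim that])
  have "\<forall>\<^sub>F n in sequentially. prob {\<omega> \<in> space M. \<exists>i\<le>n. norm (left_scheme T n i \<omega> - x (T * (real i / real n)) \<omega>) > \<theta>} \<le> \<epsilon> / 4"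
    using left_scheme_close[OF T \<theta>(1), of "\<epsilon> / 4"] \<epsilon> by simp
  moreover have "\<forall>\<^sub>F n in sequentially. T / real n * (T * Ca * A\<^sup>2 * (2 * L\<^sup>2 * A\<^sup>2 + 1)) < \<delta> / 2" using \<delta> by (intro ev) simp
  moreover have "\<forall>\<^sub>F n in sequentially. T / real n * (L * A) < \<epsilon> / 4" using \<epsilon> by (intro ev) simp
  moreover have "\<forall>\<^sub>F n in sequentially. T / real n * (norm (f x0))\<^sup>2 < \<delta>" using \<delta> by (intro ev)
  moreover have "\<forall>\<^sub>F n in sequentially. T / real n * (1 + 2 * c1 + 2 * c3) < 1" by (intro ev) simp
  moreover have "\<forall>\<^sub>F n::nat in sequentially. n > 0" by (rule eventually_gt_at_top)
  ultimately show ?thesis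
  proof eventually_elim
    case (elim n)
    define \<tau> where "\<tau> = T / real n"
    have n: "n > 0" using elim by simp
    have \<tau>0: "\<tau> > 0" using T n by (simp add: \<tau>_def)
    have e1: "prob {\<omega> \<in> space M. \<exists>i\<le>n. norm (left_scheme T n i \<omega> - x (T * (real i / real n)) \<omega>) > \<theta>} \<le> \<epsilon> / 4"
      and e2: "\<tau> * (T * Ca * A\<^sup>2 * (2 * L\<^sup>2 * A\<^sup>2 + 1)) \<le> \<delta> / 2" and e3: "\<tau> * (L * A) \<le> \<epsilon> / 4"
      and e4: "\<tau> * (norm (f x0))\<^sup>2 \<le> \<delta>" and e5: "\<tau> * (1 + 2 * c1 + 2 * c3) \<le> 1"
      using elim by (auto simp: \<tau>_def)
    have st: "small \<tau>"
    proof -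
      have "\<tau> + \<tau> * (2 * c1) + \<tau> * (2 * c3) \<le> 1" using e5 by (simp add: algebra_simps)
      moreover have "0 \<le> \<tau> * (2 * c1)" "0 \<le> \<tau> * (2 * c3)" using \<tau>0 pos by auto
      moreover have "2 * c1 * \<tau> = \<tau> * (2 * c1)" "2 * c3 * \<tau> = \<tau> * (2 * c3)" by auto
      ultimately show ?thesis unfolding small_def using \<tau>0 by linarith
    qed
    have \<tau>1: "\<tau> \<le> 1" using st by (simp add: small_def)
    have grid: "T * (real l / real n) = 0 + real l * \<tau>" for l by (simp add: \<tau>_def)
    have n\<tau>: "real n * \<tau> = T" using n by (simp add: \<tau>_def)
    show ?case
    proof (intro allI impI)
      fix Y assume "chain 0 (T / real n) Y" and Y0: "\<forall>\<omega>\<in>space M. Y 0 \<omega> = x0"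
      then have Y: "chain 0 \<tau> Y" by (simp add: \<tau>_def)
      interpret discrete_filtration M "\<lambda>i. F (0 + real i * \<tau>)" using \<tau>0 by (intro grid_filtration) auto
      define X where "X i = x (0 + real i * \<tau>)" for i
      define Xh where "Xh i \<omega> = left_scheme T n i \<omega>" for i \<omega>
      \<comment> \<open>Left scheme minus implicit image of the chain: both move by explicit
        increments, with coefficients at X and at Y.\<close>
      define e where "e i \<omega> = Xh i \<omega> - (Y i \<omega> - \<tau> *\<^sub>R f (Y i \<omega>))" for i \<omega>
      define a where "a i \<omega> = \<tau> * (Ca * (weight (X i \<omega>) (Y i \<omega>))\<^sup>2 * ((norm (e i \<omega> - (X i \<omega> - Y i \<omega>)))\<^sup>2 + \<tau>))" for i \<omega>
      define w where "w l \<omega> = (if (\<Sum>i<l. a i \<omega>) \<le> \<delta> then 1 else 0 :: real)" for l \<omega>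
      have Ym: "Y i \<in> borel_measurable (F (0 + real i * \<tau>))" for i by (rule chain_adapted[OF Y st]) simp
      have Xm: "X i \<in> borel_measurable (F (0 + real i * \<tau>))" for i unfolding X_def using \<tau>0 by (intro x_adapted) auto
      have Xhm: "Xh i \<in> borel_measurable (F (0 + real i * \<tau>))" for i
        unfolding Xh_def left_scheme_def left_sum_def grid X_def[symmetric]
      proof (intro borel_measurable_add borel_measurable_scaleR borel_measurable_sum borel_measurable_const)
        fix l assume l: "l \<in> {..<i}"
        then have le: "0 + real l * \<tau> \<le> 0 + real i * \<tau>" "0 + real (Suc l) * \<tau> \<le> 0 + real i * \<tau>" using \<tau>0 by (auto intro!: mult_right_mono)
        have [measurable]: "X l \<in> borel_measurable (F (0 + real i * \<tau>))" by (rule F_mono[OF Xm le(1)])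
        show "(\<lambda>\<omega>. f (X l \<omega>)) \<in> borel_measurable (F (0 + real i * \<tau>))" by measurable
        show "(\<lambda>\<omega>. g (X l \<omega>)) \<in> borel_measurable (F (0 + real i * \<tau>))" by measurable
        show "(\<lambda>\<omega>. W (0 + real (Suc l) * \<tau>) \<omega> - W (0 + real l * \<tau>) \<omega>) \<in> borel_measurable (F (0 + real i * \<tau>))"
          using \<tau>0 by (intro F_mono[OF increment_measurable le(2)]) (auto intro: mult_right_mono)
      qed
      have em: "e i \<in> borel_measurable (F (0 + real i * \<tau>))" for i
        unfolding e_def using Ym[of i] Xhm[of i] by measurable
      have am: "a i \<in> borel_measurable (F (0 + real i * \<tau>))" for i
        unfolding a_def using Ym[of i] Xm[of i] em[of i] by measurable
      have a0: "a i \<omega> \<ge> 0" for i \<omega> unfolding a_def using \<tau>0 Ca_pos by simp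
      have wm: "w (Suc l) \<in> borel_measurable (F (0 + real l * \<tau>))" for l
      proof -
        have [measurable]: "(\<lambda>\<omega>. \<Sum>i<Suc l. a i \<omega>) \<in> borel_measurable (F (0 + real l * \<tau>))"
          by (rule borel_measurable_sum, rule G_mono[OF _ am]) auto
        show ?thesis unfolding w_def by measurable
      qed
      have w01: "w l \<omega> \<in> {0, 1}" for l \<omega> by (simp add: w_def)
      have [measurable]: "Y i \<in> borel_measurable M" "X i \<in> borel_measurable M" "e i \<in> borel_measurable M" "a i \<in> borel_measurable M" "Xh i \<in> borel_measurable M" for i
        by (rule G_M[OF Ym], rule G_M[OF Xm], rule G_M[OF em], rule G_M[OF am], rule G_M[OF Xhm])
      have [measurable]: "w l \<in> borel_measurable M" for l unfolding w_def by measurable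
      let ?c = "1 + 2 * (c3 + 1) * \<tau>"
      have c: "?c \<ge> 1" using pos \<tau>0 by simp
      have "(\<integral>\<^sup>+\<omega>. ennreal (w n \<omega>) * ennreal ((norm (e n \<omega>))\<^sup>2) \<partial>M)
        \<le> ennreal ?c ^ n * (\<integral>\<^sup>+\<omega>. ennreal (w 0 \<omega>) * ennreal ((norm (e 0 \<omega>))\<^sup>2) + (\<Sum>l<n. ennreal (w (Suc l) \<omega>) * ennreal (a l \<omega>)) \<partial>M)"
      proof (rule weighted_growth)
        fix i
        show "(\<lambda>\<omega>. ennreal (w (Suc i) \<omega>)) \<in> borel_measurable (F (0 + real i * \<tau>))" using wm[of i] by measurable
        show "ennreal (w (Suc i) \<omega>) \<le> ennreal (w i \<omega>)" for \<omega>
          using a0[of i \<omega>] by (intro ennreal_leI) (auto simp: w_def)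
        fix v :: "'m \<Rightarrow> ennreal" assume v: "v \<in> borel_measurable (F (0 + real i * \<tau>))"
        have ts: "0 + real (Suc i) * \<tau> - (0 + real i * \<tau>) = \<tau>" by (simp add: algebra_simps)
        have "(\<integral>\<^sup>+\<omega>. v \<omega> * ennreal ((norm (e (Suc i) \<omega>))\<^sup>2) \<partial>M)
          \<le> ennreal (1 + 2 * (c3 + 1) * (0 + real (Suc i) * \<tau> - (0 + real i * \<tau>))) * (\<integral>\<^sup>+\<omega>. v \<omega> * ennreal ((norm (e i \<omega>))\<^sup>2
          + (0 + real (Suc i) * \<tau> - (0 + real i * \<tau>)) * (Ca * (weight (X i \<omega>) (Y i \<omega>))\<^sup>2 * ((norm (e i \<omega> - (X i \<omega> - Y i \<omega>)))\<^sup>2 + (0 + real (Suc i) * \<tau> - (0 + real i * \<tau>))))) \<partial>M)"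
        proof (rule error_process_step[OF _ _ Xm Ym em v])
          fix \<omega> assume \<omega>: "\<omega> \<in> space M"
          have "Xh (Suc i) \<omega> = Xh i \<omega> + \<tau> *\<^sub>R f (X i \<omega>) + (W (0 + real (Suc i) * \<tau>) \<omega> - W (0 + real i * \<tau>) \<omega>) *\<^sub>R g (X i \<omega>)"
            unfolding Xh_def left_scheme_def left_sum_def grid X_def \<tau>_def[symmetric] by (simp add: algebra_simps)
          then show "e (Suc i) \<omega> = e i \<omega> + (0 + real (Suc i) * \<tau> - (0 + real i * \<tau>)) *\<^sub>R (f (X i \<omega>) - f (Y i \<omega>))
             + (W (0 + real (Suc i) * \<tau>) \<omega> - W (0 + real i * \<tau>) \<omega>) *\<^sub>R (g (X i \<omega>) - g (Y i \<omega>))"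
            unfolding ts e_def chain_implicit[OF Y \<omega>] by (simp add: algebra_simps)
        qed (use \<tau>0 in \<open>auto simp: algebra_simps\<close>)
        then show "(\<integral>\<^sup>+\<omega>. v \<omega> * ennreal ((norm (e (Suc i) \<omega>))\<^sup>2) \<partial>M)
          \<le> ennreal ?c * (\<integral>\<^sup>+\<omega>. v \<omega> * (ennreal ((norm (e i \<omega>))\<^sup>2) + ennreal (a i \<omega>)) \<partial>M)"
          unfolding ts a_def[symmetric] using a0 by (simp add: ennreal_plus)
      qed (use c in auto)
      also have "\<dots> \<le> ennreal Cg * ennreal (2 * \<delta>)"
      proof (rule mult_mono)
        have "?c ^ n \<le> exp (2 * (c3 + 1) * \<tau>) ^ n" using c by (intro power_mono exp_ge_add_one_self) auto
        also have "\<dots> = Cg" unfolding Cg_def n\<tau>[symmetric] by (simp add: exp_of_nat_mult[symmetric] mult_ac)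
        finally have "ennreal (?c ^ n) \<le> ennreal Cg" by (rule ennreal_leI)
        moreover have "ennreal ?c ^ n = ennreal (?c ^ n)" by (rule ennreal_power) (use c in linarith)
        ultimately show "ennreal ?c ^ n \<le> ennreal Cg" by (simp only:)
        have "(\<integral>\<^sup>+\<omega>. ennreal (w 0 \<omega>) * ennreal ((norm (e 0 \<omega>))\<^sup>2) + (\<Sum>l<n. ennreal (w (Suc l) \<omega>) * ennreal (a l \<omega>)) \<partial>M) \<le> (\<integral>\<^sup>+\<omega>. ennreal (2 * \<delta>) \<partial>M)"
        proof (rule nn_integral_mono)
          fix \<omega> assume \<omega>: "\<omega> \<in> space M"
          have "e 0 \<omega> = \<tau> *\<^sub>R f x0" unfolding e_def Xh_def left_scheme_def left_sum_def using Y0 \<omega> by simp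
          then have "(norm (e 0 \<omega>))\<^sup>2 = \<tau> * (\<tau> * (norm (f x0))\<^sup>2)" by (simp add: power_mult_distrib power2_eq_square)
          also have "\<dots> \<le> 1 * (\<tau> * (norm (f x0))\<^sup>2)" using \<tau>0 \<tau>1 by (intro mult_right_mono) auto
          finally have 1: "(norm (e 0 \<omega>))\<^sup>2 \<le> \<delta>" using e4 by simp
          have 2: "w 0 \<omega> = 1" using \<delta> by (simp add: w_def)
          have "(\<Sum>l<n. w (Suc l) \<omega> * a l \<omega>) \<le> \<delta>"
            unfolding w_def using a0 \<delta> by (intro stopped_sum_le) auto
          then have "w 0 \<omega> * (norm (e 0 \<omega>))\<^sup>2 + (\<Sum>l<n. w (Suc l) \<omega> * a l \<omega>) \<le> 2 * \<delta>" using 1 2 by simp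
          moreover have wa: "0 \<le> w (Suc l) \<omega> * a l \<omega>" for l using a0 by (simp add: w_def)
          ultimately have "ennreal (w 0 \<omega> * (norm (e 0 \<omega>))\<^sup>2) + (\<Sum>l<n. ennreal (w (Suc l) \<omega> * a l \<omega>)) \<le> ennreal (2 * \<delta>)"
            using 2 by (simp add: sum_ennreal ennreal_plus[symmetric] sum_nonneg ennreal_leI del: ennreal_plus)
          then show "ennreal (w 0 \<omega>) * ennreal ((norm (e 0 \<omega>))\<^sup>2) + (\<Sum>l<n. ennreal (w (Suc l) \<omega>) * ennreal (a l \<omega>)) \<le> ennreal (2 * \<delta>)"
            using a0 2 by (simp add: ennreal_mult'')
        qed
        then show "(\<integral>\<^sup>+\<omega>. ennreal (w 0 \<omega>) * ennreal ((norm (e 0 \<omega>))\<^sup>2) + (\<Sum>l<n. ennreal (w (Suc l) \<omega>) * ennreal (a l \<omega>)) \<partial>M) \<le> ennreal (2 * \<delta>)"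
          by (simp add: emeasure_space_1)
      qed auto
      also have "\<dots> = ennreal (Cg * (2 * \<delta>))" using Cg \<delta> by (simp add: ennreal_mult)
      also have "Cg * (2 * \<delta>) = \<epsilon> ^ 3 / 16" using Cg by (simp add: \<delta>_def)
      finally have "(\<integral>\<^sup>+\<omega>. ennreal (w n \<omega> * (norm (e n \<omega>))\<^sup>2) \<partial>M) \<le> ennreal (\<epsilon> ^ 3 / 16)"
        by (simp add: ennreal_mult'')
      then have "prob {\<omega> \<in> space M. w n \<omega> * (norm (e n \<omega>))\<^sup>2 \<ge> (\<epsilon> / 2)\<^sup>2} \<le> \<epsilon> ^ 3 / 16 / (\<epsilon> / 2)\<^sup>2"
        using \<epsilon> by (intro prob_ge_le_nn_integral) auto
      also have "\<dots> = \<epsilon> / 4" using \<epsilon> by (simp add: power2_eq_square power3_eq_cube field_simps)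
      finally have Pe: "prob {\<omega> \<in> space M. w n \<omega> * (norm (e n \<omega>))\<^sup>2 \<ge> (\<epsilon> / 2)\<^sup>2} \<le> \<epsilon> / 4" .
      let ?B1 = "{\<omega> \<in> space M. \<exists>r\<in>\<rat> \<inter> {0..1}. norm (x (T * r) \<omega>) > R1}"
      let ?B2 = "{\<omega> \<in> space M. \<exists>i\<le>n. norm (Y i \<omega>) > R2}"
      let ?B3 = "{\<omega> \<in> space M. \<exists>i\<le>n. norm (Xh i \<omega> - X i \<omega>) > \<theta>}"
      let ?B4 = "{\<omega> \<in> space M. w n \<omega> * (norm (e n \<omega>))\<^sup>2 \<ge> (\<epsilon> / 2)\<^sup>2}"
      have P2: "prob ?B2 \<le> \<epsilon> / 4" by (rule PY[OF st _ Y Y0]) (simp add: n\<tau>)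
      have P3: "prob ?B3 \<le> \<epsilon> / 4" using e1 unfolding Xh_def X_def grid[symmetric] .
      \<comment> \<open>Off the four events all weights are at most A and the sources sum to at most
        \<delta>, hence \<open>w n = 1\<close> and the unlocalised error is recovered.\<close>
      have sub: "{\<omega> \<in> space M. norm (x T \<omega> - Y n \<omega>) > \<epsilon>} \<subseteq> (?B1 \<union> ?B2) \<union> (?B3 \<union> ?B4)"
      proof (rule subsetI, rule ccontr)
        fix \<omega> assume "\<omega> \<in> {\<omega> \<in> space M. norm (x T \<omega> - Y n \<omega>) > \<epsilon>}" and no: "\<omega> \<notin> (?B1 \<union> ?B2) \<union> (?B3 \<union> ?B4)"
        then have \<omega>: "\<omega> \<in> space M" and big: "norm (x T \<omega> - Y n \<omega>) > \<epsilon>" by auto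
        have X1: "norm (X i \<omega>) \<le> R1" if "i \<le> n" for i
        proof -
          have q: "real i / real n \<in> \<rat> \<inter> {0..1}" using that n by auto
          have "\<forall>r\<in>\<rat> \<inter> {0..1}. norm (x (T * r) \<omega>) \<le> R1" using no \<omega> by (auto simp: not_less)
          then have "norm (x (T * (real i / real n)) \<omega>) \<le> R1" using q by (rule bspec)
          then show ?thesis unfolding X_def grid[symmetric] .
        qed
        have Y1: "norm (Y i \<omega>) \<le> R2" if "i \<le> n" for i using no \<omega> that by (auto simp: not_less)
        have Z1: "norm (Xh i \<omega> - X i \<omega>) \<le> \<theta>" if "i \<le> n" for i using no \<omega> that by (auto simp: not_less)
        have wA: "weight (X i \<omega>) (Y i \<omega>) \<le> A" if "i \<le> n" for i
          unfolding weight_def A_def using X1[OF that] Y1[OF that] by (intro power_mono) auto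
        have fY: "norm (f (Y i \<omega>)) \<le> L * A" if "i \<le> n" for i
          by (rule order_trans[OF growth_weight(2)[of "Y i \<omega>" "X i \<omega>"]]) (use wA[OF that] L_pos in \<open>intro mult_left_mono; simp\<close>)
        have "a i \<omega> \<le> \<tau> * (Ca * A\<^sup>2 * (2 * \<theta>\<^sup>2 + \<tau> * (2 * L\<^sup>2 * A\<^sup>2 + 1)))" if "i \<le> n" for i
        proof -
          have eq: "e i \<omega> - (X i \<omega> - Y i \<omega>) = (Xh i \<omega> - X i \<omega>) + \<tau> *\<^sub>R f (Y i \<omega>)" by (simp add: e_def)
          have "norm (e i \<omega> - (X i \<omega> - Y i \<omega>)) \<le> norm (Xh i \<omega> - X i \<omega>) + \<tau> * norm (f (Y i \<omega>))"
            unfolding eq using norm_triangle_ineq[of "Xh i \<omega> - X i \<omega>" "\<tau> *\<^sub>R f (Y i \<omega>)"] \<tau>0 by simp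
          also have "\<dots> \<le> \<theta> + \<tau> * (L * A)" using \<tau>0 by (intro add_mono mult_left_mono Z1 fY that) auto
          finally have "(norm (e i \<omega> - (X i \<omega> - Y i \<omega>)))\<^sup>2 \<le> (\<theta> + \<tau> * (L * A))\<^sup>2" by (intro power_mono) auto
          also have "\<dots> \<le> 2 * \<theta>\<^sup>2 + 2 * (\<tau> * (L * A))\<^sup>2"
            using sum_squares_bound[of \<theta> "\<tau> * (L * A)"] by (simp add: power2_sum)
          also have "(\<tau> * (L * A))\<^sup>2 = \<tau> * \<tau> * (L\<^sup>2 * A\<^sup>2)" by (simp add: power2_eq_square mult_ac)
          also have "2 * (\<tau> * \<tau> * (L\<^sup>2 * A\<^sup>2)) \<le> 2 * (\<tau> * 1 * (L\<^sup>2 * A\<^sup>2))"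
            using \<tau>0 \<tau>1 by (intro mult_left_mono mult_right_mono) auto
          finally have "(norm (e i \<omega> - (X i \<omega> - Y i \<omega>)))\<^sup>2 + \<tau> \<le> 2 * \<theta>\<^sup>2 + \<tau> * (2 * L\<^sup>2 * A\<^sup>2 + 1)"
            by (simp add: algebra_simps)
          moreover have "(weight (X i \<omega>) (Y i \<omega>))\<^sup>2 \<le> A\<^sup>2"
            using wA[OF that] weight_ge_1[of "X i \<omega>" "Y i \<omega>"] by (intro power_mono) auto
          ultimately show ?thesis unfolding a_def using \<tau>0 Ca_pos by (intro mult_left_mono mult_mono) auto
        qed
        then have "(\<Sum>i<n. a i \<omega>) \<le> (\<Sum>i<n. \<tau> * (Ca * A\<^sup>2 * (2 * \<theta>\<^sup>2 + \<tau> * (2 * L\<^sup>2 * A\<^sup>2 + 1))))" by (intro sum_mono) auto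
        also have "\<dots> = (real n * \<tau>) * (Ca * A\<^sup>2 * (2 * \<theta>\<^sup>2 + \<tau> * (2 * L\<^sup>2 * A\<^sup>2 + 1)))" by simp
        also have "\<dots> = T * Ca * A\<^sup>2 * (2 * \<theta>\<^sup>2) + \<tau> * (T * Ca * A\<^sup>2 * (2 * L\<^sup>2 * A\<^sup>2 + 1))"
          unfolding n\<tau> by (simp add: algebra_simps)
        also have "\<dots> \<le> \<delta>" using \<theta>2 e2 by linarith
        finally have "w n \<omega> = 1" by (simp add: w_def)
        then have "(norm (e n \<omega>))\<^sup>2 < (\<epsilon> / 2)\<^sup>2" using no \<omega> by auto
        then have en: "norm (e n \<omega>) < \<epsilon> / 2" by (rule power2_less_imp_less) (use \<epsilon> in simp)
        have eq: "x T \<omega> - Y n \<omega> = e n \<omega> - (Xh n \<omega> - X n \<omega>) - \<tau> *\<^sub>R f (Y n \<omega>)"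
          unfolding e_def X_def by (simp add: n\<tau>)
        have "norm (x T \<omega> - Y n \<omega>) \<le> norm (e n \<omega>) + norm (Xh n \<omega> - X n \<omega>) + norm (\<tau> *\<^sub>R f (Y n \<omega>))"
          unfolding eq by (rule order_trans[OF norm_triangle_ineq4 add_right_mono[OF norm_triangle_ineq4]])
        moreover have "norm (\<tau> *\<^sub>R f (Y n \<omega>)) \<le> \<tau> * (L * A)" using fY[of n] \<tau>0 by simp
        ultimately show False using en Z1[of n, OF order_refl] \<theta>(2) e3 big by linarith
      qed
      have B1m[measurable]: "?B1 \<in> sets M" by (rule H)
      have B2m[measurable]: "?B2 \<in> sets M" by measurable
      have B3m[measurable]: "?B3 \<in> sets M" by measurable
      have B4m[measurable]: "?B4 \<in> sets M" by measurable
      have "prob {\<omega> \<in> space M. norm (x T \<omega> - Y n \<omega>) > \<epsilon>} \<le> prob ((?B1 \<union> ?B2) \<union> (?B3 \<union> ?B4))"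
        using B1m B2m B3m B4m by (intro finite_measure_mono[OF sub]) (intro sets.Un)
      also have "\<dots> \<le> (prob ?B1 + prob ?B2) + (prob ?B3 + prob ?B4)"
        using B1m B2m B3m B4m by (intro order_trans[OF measure_Un_le] add_mono measure_Un_le) (auto intro: sets.Un)
      also have "\<dots> \<le> \<epsilon>" using PH P2 P3 Pe by linarith
      finally show "prob {\<omega> \<in> space M. norm (x T \<omega> - Y n \<omega>) > \<epsilon>} \<le> \<epsilon>" .
    qed
  qed
qed

end

section \<open>Conclusion\<close>

text \<open>Truncation at K makes the exceptional event cost at most K \<epsilon>, subadditivity of
  the p-th power handles the rest, and monotone convergence in K removes the truncation. Y may
  change with the accuracy; only B is common.\<close>

lemma (in prob_space) nn_integral_powr_le_of_approx:
  fixes X Z :: "'a \<Rightarrow> 'b::euclidean_space"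
  assumes [measurable]: "X \<in> borel_measurable M" "Z \<in> borel_measurable M" and p: "0 < p" "p \<le> 1" and B: "B \<ge> 0"
    and approx: "\<And>\<epsilon>. \<epsilon> > 0 \<Longrightarrow> \<exists>Y. Y \<in> borel_measurable M \<and> prob {\<omega> \<in> space M. norm (Z \<omega> - Y \<omega>) > \<epsilon>} \<le> \<epsilon> \<and>
      (\<integral>\<^sup>+\<omega>. ennreal (norm (Y \<omega> - X \<omega>) powr p) \<partial>M) \<le> ennreal B"
  shows "(\<integral>\<^sup>+\<omega>. ennreal (norm (Z \<omega> - X \<omega>) powr p) \<partial>M) \<le> ennreal B"
proof -
  let ?z = "\<lambda>\<omega>. norm (Z \<omega> - X \<omega>) powr p"
  have trunc: "(\<integral>\<^sup>+\<omega>. ennreal (min (real K) (?z \<omega>)) \<partial>M) \<le> ennreal B" for K :: nat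
  proof (rule ennreal_le_epsilon)
    fix e :: real assume e: "e > 0"
    \<comment> \<open>The first entry gives \<open>K * \<epsilon> \<le> e / 2\<close>, the second
      \<open>\<epsilon> powr p \<le> e / 2\<close>.\<close>
    define \<epsilon> where "\<epsilon> = min (e / (2 * (real K + 1))) ((e / 2) powr (1 / p))"
    have \<epsilon>: "\<epsilon> > 0" using e by (simp add: \<epsilon>_def)
    have "\<epsilon> powr p \<le> ((e / 2) powr (1 / p)) powr p" using p \<epsilon> by (intro powr_mono2) (auto simp: \<epsilon>_def)
    also have "\<dots> = e / 2" using p e by (simp add: powr_powr)
    finally have \<epsilon>1: "\<epsilon> powr p \<le> e / 2" .
    have "real K * \<epsilon> \<le> (real K + 1) * (e / (2 * (real K + 1)))" using \<epsilon> by (intro mult_mono) (auto simp: \<epsilon>_def)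
    also have "\<dots> = e / 2"
    proof -
      have "u * (e / (2 * u)) = e / 2" if "u > 0" for u :: real using that by simp
      then show ?thesis by (metis add_nonneg_pos of_nat_0_le_iff zero_less_one)
    qed
    finally have \<epsilon>2: "real K * \<epsilon> \<le> e / 2" .
    obtain Y where [measurable]: "Y \<in> borel_measurable M" and Y: "prob {\<omega> \<in> space M. norm (Z \<omega> - Y \<omega>) > \<epsilon>} \<le> \<epsilon>"
      "(\<integral>\<^sup>+\<omega>. ennreal (norm (Y \<omega> - X \<omega>) powr p) \<partial>M) \<le> ennreal B"
      using approx[OF \<epsilon>] by blast
    let ?A = "{\<omega> \<in> space M. norm (Z \<omega> - Y \<omega>) > \<epsilon>}"
    have "(\<integral>\<^sup>+\<omega>. ennreal (min (real K) (?z \<omega>)) \<partial>M)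
      \<le> (\<integral>\<^sup>+\<omega>. ennreal (norm (Y \<omega> - X \<omega>) powr p) + (ennreal (\<epsilon> powr p) + ennreal (real K) * indicator ?A \<omega>) \<partial>M)"
    proof (rule nn_integral_mono)
      fix \<omega> assume \<omega>: "\<omega> \<in> space M"
      show "ennreal (min (real K) (?z \<omega>)) \<le> ennreal (norm (Y \<omega> - X \<omega>) powr p) + (ennreal (\<epsilon> powr p) + ennreal (real K) * indicator ?A \<omega>)"
      proof (cases "\<omega> \<in> ?A")
        case True
        have "ennreal (min (real K) (?z \<omega>)) \<le> ennreal (real K)" by (intro ennreal_leI) simp
        also have "\<dots> \<le> ennreal (norm (Y \<omega> - X \<omega>) powr p) + (ennreal (\<epsilon> powr p) + ennreal (real K) * indicator ?A \<omega>)"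
          using True by (simp add: add_increasing)
        finally show ?thesis .
      next
        case False
        then have ZY: "norm (Z \<omega> - Y \<omega>) \<le> \<epsilon>" using \<omega> by simp
        have "norm (Z \<omega> - X \<omega>) \<le> norm (Y \<omega> - X \<omega>) + norm (Z \<omega> - Y \<omega>)"
          using norm_triangle_ineq[of "Y \<omega> - X \<omega>" "Z \<omega> - Y \<omega>"] by simp
        also have "\<dots> \<le> norm (Y \<omega> - X \<omega>) + \<epsilon>" using ZY by simp
        finally have "?z \<omega> \<le> (norm (Y \<omega> - X \<omega>) + \<epsilon>) powr p" using p by (intro powr_mono2) auto
        also have "\<dots> \<le> norm (Y \<omega> - X \<omega>) powr p + \<epsilon> powr p" using p \<epsilon> by (intro powr_add_le) auto
        finally have "ennreal (min (real K) (?z \<omega>)) \<le> ennreal (norm (Y \<omega> - X \<omega>) powr p + \<epsilon> powr p)"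
          by (intro ennreal_leI) simp
        then show ?thesis using False by simp
      qed
    qed
    also have "\<dots> = (\<integral>\<^sup>+\<omega>. ennreal (norm (Y \<omega> - X \<omega>) powr p) \<partial>M) + (ennreal (\<epsilon> powr p) + ennreal (real K) * emeasure M ?A)"
      by (subst nn_integral_add, measurable, subst nn_integral_add, measurable, subst nn_integral_cmult_indicator, measurable)
        (simp add: emeasure_space_1)
    also have "\<dots> \<le> ennreal B + (ennreal (e / 2) + ennreal (e / 2))"
    proof (intro add_mono Y(2) ennreal_leI \<epsilon>1)
      have "ennreal (real K) * emeasure M ?A = ennreal (real K * prob ?A)" by (simp add: emeasure_eq_measure ennreal_mult)
      also have "\<dots> \<le> ennreal (e / 2)"
        using mult_left_mono[OF Y(1), of "real K"] \<epsilon>2 by (intro ennreal_leI) simp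
      finally show "ennreal (real K) * emeasure M ?A \<le> ennreal (e / 2)" .
    qed
    also have "ennreal (e / 2) + ennreal (e / 2) = ennreal e" using e by (simp add: ennreal_plus[symmetric] del: ennreal_plus)
    finally show "(\<integral>\<^sup>+\<omega>. ennreal (min (real K) (?z \<omega>)) \<partial>M) \<le> ennreal B + ennreal e" .
  qed
  have "(\<integral>\<^sup>+\<omega>. ennreal (?z \<omega>) \<partial>M) = (\<integral>\<^sup>+\<omega>. (SUP K. ennreal (min (real K) (?z \<omega>))) \<partial>M)"
  proof (rule nn_integral_cong)
    fix \<omega>
    obtain K :: nat where "?z \<omega> \<le> real K" using real_arch_simple by blast
    then have "ennreal (?z \<omega>) \<le> (SUP K. ennreal (min (real K) (?z \<omega>)))"
      by (intro SUP_upper2[of K]) auto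
    moreover have "(SUP K. ennreal (min (real K) (?z \<omega>))) \<le> ennreal (?z \<omega>)" by (intro SUP_least ennreal_leI) simp
    ultimately show "ennreal (?z \<omega>) = (SUP K. ennreal (min (real K) (?z \<omega>)))" by (rule antisym)
  qed
  also have "\<dots> = (SUP K. \<integral>\<^sup>+\<omega>. ennreal (min (real K) (?z \<omega>)) \<partial>M)"
    by (intro nn_integral_monotone_convergence_SUP) (auto simp: incseq_def le_fun_def intro!: ennreal_leI)
  also have "\<dots> \<le> ennreal B" by (intro SUP_least trunc)
  finally show ?thesis .
qed

lemma growth_weight_bound:
  fixes a b q :: real
  assumes "a \<ge> 0" "b \<ge> 0" "q \<ge> 1" "q \<le> real d"
  shows "1 + a powr (q - 1) + b powr (q - 1) \<le> 3 * (1 + a + b) ^ d"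
proof -
  have *: "u powr (q - 1) \<le> (1 + a + b) ^ d" if "0 \<le> u" "u \<le> a + b" for u
  proof -
    have "u powr (q - 1) \<le> (1 + a + b) powr (q - 1)" using that assms by (intro powr_mono2) auto
    also have "\<dots> \<le> (1 + a + b) powr real d" using assms by (intro powr_mono) auto
    also have "\<dots> = (1 + a + b) ^ d" using assms by (intro powr_realpow) auto
    finally show ?thesis .
  qed
  have "1 \<le> (1 + a + b) ^ d" using assms by (intro one_le_power) auto
  moreover have "a powr (q - 1) \<le> (1 + a + b) ^ d" "b powr (q - 1) \<le> (1 + a + b) ^ d" using assms by (auto intro!: *)
  ultimately show ?thesis by linarith
qed

text \<open>The initial value is encoded only in the equation at t = 0. The Riemann sums there
  vanish identically, so the integral is almost surely 0. This settles j = 0, where no positive time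
  horizon exists.\<close>

lemma (in bem_solution) initial_value: "AE \<omega> in M. x 0 \<omega> = x0"
proof -
  obtain I where I: "ito_integral_is M W (\<lambda>s \<omega>. g (x s \<omega>)) 0 I"
    and xI: "AE \<omega> in M. x 0 \<omega> = x0 + integral {0..0} (\<lambda>s. f (x s \<omega>)) + I \<omega>"
    using sol unfolding sde_solution_def by blast
  have [measurable]: "I \<in> borel_measurable M" using I by (simp add: ito_integral_is_def)
  have "AE \<omega> in M. \<not> norm (I \<omega>) > 1 / real (Suc n)" for n
  proof -
    have "\<forall>\<epsilon>>0. (\<lambda>k. measure M {\<omega> \<in> space M. norm (ito_sum W (\<lambda>s \<omega>. g (x s \<omega>)) 0 k \<omega> - I \<omega>) > \<epsilon>}) \<longlonglongrightarrow> 0"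
      using I unfolding ito_integral_is_def by blast
    then have "(\<lambda>k::nat. measure M {\<omega> \<in> space M. norm (ito_sum W (\<lambda>s \<omega>. g (x s \<omega>)) 0 k \<omega> - I \<omega>) > 1 / real (Suc n)}) \<longlonglongrightarrow> 0"
      by (rule allE[of _ "1 / real (Suc n)"]) simp
    then have "(\<lambda>k::nat. measure M {\<omega> \<in> space M. norm (I \<omega>) > 1 / real (Suc n)}) \<longlonglongrightarrow> 0"
      by (simp add: ito_sum_def del: of_nat_Suc)
    then have "prob {\<omega> \<in> space M. norm (I \<omega>) > 1 / real (Suc n)} = 0" by (simp add: LIMSEQ_const_iff)
    then have "emeasure M {\<omega> \<in> space M. norm (I \<omega>) > 1 / real (Suc n)} = 0" by (simp add: emeasure_eq_measure)
    then show ?thesis by (subst AE_iff_measurable[OF _ refl]) auto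
  qed
  then have "AE \<omega> in M. \<forall>n. \<not> norm (I \<omega>) > 1 / real (Suc n)" by (simp add: AE_all_countable)
  with xI show ?thesis
  proof eventually_elim
    case (elim \<omega>)
    have "I \<omega> = 0"
    proof (rule ccontr)
      assume "I \<omega> \<noteq> 0"
      then obtain n where "1 / real (Suc n) < norm (I \<omega>)" using nat_approx_posE[of "norm (I \<omega>)"] by auto
      with elim(2) show False by blast
    qed
    then show ?case using elim(1) by simp
  qed
qed

text \<open>Boundedness of P is asked for the same exponent p as in the error bound, so it stands
  inside the range of p, while p0 comes from the remaining data. With the nonnegative integral, the
  bound includes finiteness of the moment.\<close>

theorem theorem3p10:
  fixes f g :: "'a::euclidean_space \<Rightarrow> 'a"
    and M :: "'m measure" and F :: "real \<Rightarrow> 'm measure" and W :: "real \<Rightarrow> 'm \<Rightarrow> real"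
    and x0 :: 'a and x :: "real \<Rightarrow> 'm \<Rightarrow> 'a"
    and q L1 c1 c2 c3 l1 l2 :: real
    and \<alpha> D k1 :: real and P :: "'a \<Rightarrow> real"
    and \<beta> k2 :: real
  assumes BM: "brownian_motion M F W"
    and sol: "sde_solution M F W f g x0 x"
    and A1: "q \<ge> 1" "L1 > 0"
      "\<And>x1 x2. norm (f x1 - f x2) \<le> L1 * (1 + norm x1 powr (q - 1) + norm x2 powr (q - 1)) * norm (x1 - x2)"
    and A2: "c1 > 0" "c2 > 0" "c3 > 0" "l1 \<ge> max (2 * q) 3" "l2 \<ge> 3"
      "\<And>y. 2 * (y \<bullet> f y) + l1 * (norm (g y))\<^sup>2 \<le> c1 * (norm y)\<^sup>2 + c2"
      "\<And>x1 x2. 2 * ((x1 - x2) \<bullet> (f x1 - f x2)) + l2 * (norm (g x1 - g x2))\<^sup>2 \<le> c3 * (norm (x1 - x2))\<^sup>2"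
    and A3: "\<alpha> > 0" "D > 0" "k1 + c1 < 0" "P \<in> poly_fun"
      "\<And>y. (1 - l1) * (norm (g y))\<^sup>2 / (D + (norm y)\<^sup>2 + \<alpha> * (norm (g y))\<^sup>2)
             - 2 * \<bar>y \<bullet> g y\<bar>\<^sup>2 / (D + (norm y)\<^sup>2 + \<alpha> * (norm (g y))\<^sup>2)\<^sup>2
           \<le> k1 + P y / (D + (norm y)\<^sup>2 + \<alpha> * (norm (g y))\<^sup>2)\<^sup>2"
    and A4: "\<beta> > 0" "k2 + c3 < 0"
      "\<And>y z. y \<noteq> z \<Longrightarrow>
          (1 - l2) * (norm (g y - g z))\<^sup>2 / ((norm (y - z))\<^sup>2 + \<beta> * (norm (g y - g z))\<^sup>2)
          - 2 * \<bar>(y - z) \<bullet> (g y - g z)\<bar>\<^sup>2 / ((norm (y - z))\<^sup>2 + \<beta> * (norm (g y - g z))\<^sup>2)\<^sup>2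
          \<le> k2"
  shows "\<exists>p0. 0 < p0 \<and> p0 \<le> 1 \<and>
    (\<forall>p. 0 < p \<and> p < p0 \<and>
        (\<exists>C3\<ge>0. \<forall>y. \<bar>P y / (D + (norm y)\<^sup>2 + \<alpha> * (norm (g y))\<^sup>2) powr (2 - p / 2)\<bar> \<le> C3) \<longrightarrow>
      (\<exists>h0>0. \<exists>C>0. \<forall>h X. 0 < h \<and> h < h0 \<and> bem_scheme M W f g x0 h X \<longrightarrow>
         (\<forall>j::nat. (\<integral>\<^sup>+ \<omega>. ennreal (norm (x (real j * h) \<omega> - X j \<omega>) powr p) \<partial>M)
                     \<le> ennreal (C * h powr (p / 2)))))"
proof -
  define d where "d = nat \<lceil>q\<rceil>"
  have qd: "q \<le> real d" using A1(1) unfolding d_def by linarith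
  interpret bem_solution M F W f g "3 * L1" c1 c2 c3 l1 l2 d x0 x
  proof unfold_locales
    show "brownian_motion M F W" by (rule BM)
    show "sde_solution M F W f g x0 x" by (rule sol)
    fix u v
    have "norm (f u - f v) \<le> L1 * (1 + norm u powr (q - 1) + norm v powr (q - 1)) * norm (u - v)" by (rule A1(3))
    also have "\<dots> \<le> L1 * (3 * (1 + norm u + norm v) ^ d) * norm (u - v)"
      using A1 qd by (intro mult_right_mono mult_left_mono growth_weight_bound) auto
    finally show "norm (f u - f v) \<le> 3 * L1 * (1 + norm u + norm v) ^ d * norm (u - v)" by (simp add: mult_ac)
  qed (use A1 A2 in auto)
  let ?D = "real (Suc d)"
  let ?V = "\<lambda>y. D + (norm y)\<^sup>2 + \<alpha> * (norm (g y))\<^sup>2"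
  \<comment> \<open>The midpoint of k1 and - c1: above k1, so that the term with P can be absorbed
    where V is large, and still with k + c1 < 0.\<close>
  define k where "k = (k1 - c1) / 2"
  \<comment> \<open>Makes (1 - r) k equal to (k - c1) / 2, so that half of the margin k + c1
    survives the factor 1 - r.\<close>
  define r where "r = (1 + c1 / k) / 2"
  have "2 * k = k1 - c1" by (simp add: k_def)
  then have k: "k1 < k" "k + c1 < 0" "k < 0" using A3(3) A2(1) by linarith+
  have r: "0 < r" "r < 1" using k A2(1) by (auto simp: r_def field_simps)
  have rk: "(1 - r) * k + c1 < 0"
  proof -
    have "(1 - r) * k = (k - c1) / 2" using k by (simp add: r_def field_simps)
    then show ?thesis using k by simp
  qed
  have k20: "k2 < 0" using A4(2) A2(3) by simp
  \<comment> \<open>For s = p / 2 the second entry gives 16 (d + 1)^2 s \<le> 1, the third 16 (d +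
    1)^2 s \<le> 2 r, the order of the available moments, and the last keeps (1 - s) k2 + c3
    negative.\<close>
  define p0 where "p0 = Min {1, 1 / (8 * ?D\<^sup>2), r / (4 * ?D\<^sup>2), 1 + c3 / k2}"
  have p0: "0 < p0" "p0 \<le> 1" using r k20 A4(2) by (auto simp: p0_def field_simps)
  show ?thesis
  proof (rule exI[of _ p0], intro conjI p0 allI impI)
    fix p assume "0 < p \<and> p < p0 \<and> (\<exists>C3\<ge>0. \<forall>y. \<bar>P y / ?V y powr (2 - p / 2)\<bar> \<le> C3)"
    then obtain C3 where p: "0 < p" "p < p0" and C3: "C3 \<ge> 0" "\<And>y. \<bar>P y / ?V y powr (2 - p / 2)\<bar> \<le> C3" by blast
    define s where "s = p / 2"
    have ps: "p = 2 * s" by (simp add: s_def)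
    have pb: "p < 1" "p < 1 / (8 * ?D\<^sup>2)" "p < r / (4 * ?D\<^sup>2)" "p < 1 + c3 / k2" using p by (auto simp: p0_def)
    have D2: "?D\<^sup>2 > 0" by simp
    have s: "0 < s" "16 * ?D\<^sup>2 * s \<le> 1" "16 * ?D\<^sup>2 * s \<le> 2 * r"
    proof -
      show "0 < s" using p by (simp add: s_def)
      show "16 * ?D\<^sup>2 * s \<le> 1" using pb(2) D2 unfolding ps by (simp only: pos_less_divide_eq mult_pos_pos zero_less_numeral) (simp add: mult_ac)
      show "16 * ?D\<^sup>2 * s \<le> 2 * r" using pb(3) D2 unfolding ps by (simp only: pos_less_divide_eq mult_pos_pos zero_less_numeral) (simp add: mult_ac)
    qed
    have rate: "(1 - s) * k2 + c3 < 0"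
    proof -
      have "1 - s > (1 - c3 / k2) / 2" using pb(4) unfolding ps by simp
      then have "(1 - s) * k2 < (1 - c3 / k2) / 2 * k2" using k20 by (intro mult_strict_right_mono_neg)
      also have "\<dots> = (k2 - c3) / 2" using k20 by (simp add: field_simps)
      finally show ?thesis using A4(2) by simp
    qed
    define \<kappa> where "\<kappa> y = k1 + P y / (?V y)\<^sup>2" for y
    \<comment> \<open>Where V exceeds \<open>Kc\<close>, the term with P is at most k - k1. Where it
      does not, \<open>Lyap powr r\<close> is bounded and the excess goes into the constant
      \<open>CP\<close>.\<close>
    define Kc where "Kc = (C3 / (k - k1)) powr (1 / s)"
    define CP where "CP = Kc powr r * (C3 * D powr (- s))"
    have CP: "CP \<ge> 0" using C3 by (simp add: CP_def)
    have V0: "?V y \<ge> D" "?V y > 0" for y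
      using A3(1,2) by (auto simp: add_pos_nonneg)
    have Pk: "Lyap D \<tau> y powr r * \<kappa> y \<le> k * Lyap D \<tau> y powr r + CP" if \<tau>: "0 < \<tau>" "l1 * \<tau> \<le> \<alpha>" for \<tau> y
    proof -
      let ?v = "?V y" and ?l = "Lyap D \<tau> y"
      have l: "0 \<le> ?l" "?l \<le> ?v" using \<tau> A3(2) pos by (auto simp: Lyap_def mult_right_mono)
      \<comment> \<open>The exponent 2 - p / 2 in the hypothesis is 2 - s, so relative to V^2 the
        polynomial decays at least like V^(-s).\<close>
      have "P y / ?v\<^sup>2 = P y / ?v powr (2 - s) * ?v powr (- s)"
        using V0[of y] by (simp add: powr_diff powr_minus field_simps)
      also have "\<dots> \<le> C3 * ?v powr (- s)"
        using C3(2)[of y] unfolding s_def[symmetric] by (intro mult_right_mono) (rule abs_le_D1, auto)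
      finally have Pv: "P y / ?v\<^sup>2 \<le> C3 * ?v powr (- s)" .
      show ?thesis
      proof (cases "C3 * ?v powr (- s) \<le> k - k1")
        case True
        then have "\<kappa> y \<le> k" using Pv by (simp add: \<kappa>_def)
        then have "?l powr r * \<kappa> y \<le> ?l powr r * k" by (intro mult_left_mono) auto
        then show ?thesis using CP by (simp add: mult.commute)
      next
        case False
        then have "(k - k1) * ?v powr s < C3" using V0[of y] by (simp add: powr_minus field_simps)
        then have "?v powr s \<le> C3 / (k - k1)" using k by (simp add: field_simps)
        then have "(?v powr s) powr (1 / s) \<le> Kc" unfolding Kc_def using s by (intro powr_mono2) auto
        then have "?v \<le> Kc" using s V0[of y] by (simp add: powr_powr)
        then have lK: "?l powr r \<le> Kc powr r" using l r by (intro powr_mono2) auto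
        have "?v powr (- s) \<le> D powr (- s)" using s V0[of y] A3(2) by (intro powr_mono2') auto
        then have "C3 * ?v powr (- s) \<le> C3 * D powr (- s)" using C3 by (intro mult_left_mono)
        then have "\<kappa> y \<le> k + C3 * D powr (- s)" using Pv k by (simp add: \<kappa>_def)
        then have "?l powr r * \<kappa> y \<le> ?l powr r * (k + C3 * D powr (- s))" by (intro mult_left_mono) auto
        also have "\<dots> = k * ?l powr r + ?l powr r * (C3 * D powr (- s))" by (simp add: algebra_simps)
        also have "\<dots> \<le> k * ?l powr r + CP" unfolding CP_def using lK C3 by (intro add_left_mono mult_right_mono) auto
        finally show ?thesis .
      qed
    qed
    have \<kappa>: "(1 - l1) * (norm (g y))\<^sup>2 / ?V y - 2 * (y \<bullet> g y)\<^sup>2 / (?V y)\<^sup>2 \<le> \<kappa> y" for y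
      using A3(5)[of y] by (simp add: \<kappa>_def)
    have k2: "(1 - l2) * (norm (g y - g z))\<^sup>2 / ((norm (y - z))\<^sup>2 + \<beta> * (norm (g y - g z))\<^sup>2)
        - 2 * ((y - z) \<bullet> (g y - g z))\<^sup>2 / ((norm (y - z))\<^sup>2 + \<beta> * (norm (g y - g z))\<^sup>2)\<^sup>2 \<le> k2" if "y \<noteq> z" for y z
      using A4(3)[OF that] by simp
    obtain h1 B where h1: "h1 > 0" and B: "B \<ge> 0" and mom: "\<And>\<tau> Y n. small \<tau> \<Longrightarrow> \<tau> < h1 \<Longrightarrow> chain 0 \<tau> Y \<Longrightarrow> \<forall>\<omega>\<in>space M. Y 0 \<omega> = x0 \<Longrightarrow>
        (\<integral>\<^sup>+\<omega>. ennreal ((1 + norm (Y n \<omega>)) powr (2 * r)) \<partial>M) \<le> ennreal B"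
      using uniform_moment[where r = r and b = \<alpha> and D = D and C = CP and \<kappa> = \<kappa> and k = k and ?x0.0 = x0, OF r A3(1) A3(2) CP \<kappa> Pk rk] by blast
    have "\<exists>h0>0. \<exists>C\<ge>0. \<forall>h \<tau> m X Y j. 0 < h \<longrightarrow> h < h0 \<longrightarrow> m > 0 \<longrightarrow> h = real m * \<tau> \<longrightarrow>
       small h \<and> (chain 0 h X \<longrightarrow> chain 0 \<tau> Y \<longrightarrow> X 0 = Y 0 \<longrightarrow> (\<forall>\<omega>\<in>space M. Y 0 \<omega> = x0) \<longrightarrow>
       (\<integral>\<^sup>+\<omega>. ennreal (norm (Y (j * m) \<omega> - X j \<omega>) powr (2 * s)) \<partial>M) \<le> ennreal (C * h powr s))"
      by (rule uniform_error[OF s A4(1) k2 rate h1 B]) (assumption, rule mom)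
    then obtain h0 C where h0: "h0 > 0" and C: "C \<ge> 0" and err: "\<And>h \<tau> m X Y j. 0 < h \<Longrightarrow> h < h0 \<Longrightarrow> m > 0 \<Longrightarrow> h = real m * \<tau> \<Longrightarrow>
       small h \<and> (chain 0 h X \<longrightarrow> chain 0 \<tau> Y \<longrightarrow> X 0 = Y 0 \<longrightarrow> (\<forall>\<omega>\<in>space M. Y 0 \<omega> = x0) \<longrightarrow>
       (\<integral>\<^sup>+\<omega>. ennreal (norm (Y (j * m) \<omega> - X j \<omega>) powr (2 * s)) \<partial>M) \<le> ennreal (C * h powr s))"
      by blast
    show "\<exists>h0>0. \<exists>C>0. \<forall>h X. 0 < h \<and> h < h0 \<and> bem_scheme M W f g x0 h X \<longrightarrow>
         (\<forall>j::nat. (\<integral>\<^sup>+ \<omega>. ennreal (norm (x (real j * h) \<omega> - X j \<omega>) powr p) \<partial>M) \<le> ennreal (C * h powr (p / 2)))"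
    \<comment> \<open>The constant obtained is only nonnegative; adding 1 makes it positive.\<close>
    proof (rule exI[of _ h0], rule conjI[OF h0], rule exI[of _ "C + 1"], rule conjI, use C in simp, intro allI impI)
      fix h X and j :: nat assume "0 < h \<and> h < h0 \<and> bem_scheme M W f g x0 h X"
      then have h: "0 < h" "h < h0" and X: "bem_scheme M W f g x0 h X" by auto
      have sh: "small h" using err[OF h, of 1 h] by simp
      have X0: "\<forall>\<omega>\<in>space M. X 0 \<omega> = x0" using X by (simp add: bem_scheme_def)
      have "X 0 \<in> borel_measurable (F 0)"
        by (subst measurable_cong[where g = "\<lambda>_. x0"]) (use X0 in \<open>auto simp: space_F\<close>)
      then have Xc: "chain 0 h X" using X unfolding chain_def bem_scheme_def by (simp del: of_nat_Suc)
      have [measurable]: "X j \<in> borel_measurable M" by (rule chain_measurable[OF Xc sh]) simp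
      have [measurable]: "x (real j * h) \<in> borel_measurable M" using h by (intro x_measurable) auto
      have "(\<integral>\<^sup>+ \<omega>. ennreal (norm (x (real j * h) \<omega> - X j \<omega>) powr p) \<partial>M) \<le> ennreal (C * h powr s)"
      proof (cases "j = 0")
        case True
        have "(\<integral>\<^sup>+ \<omega>. ennreal (norm (x (real j * h) \<omega> - X j \<omega>) powr p) \<partial>M) = (\<integral>\<^sup>+ \<omega>. 0 \<partial>M)"
        proof (rule nn_integral_cong_AE)
          have "AE \<omega> in M. X 0 \<omega> = x0" using X0 by (intro AE_I2) auto
          with initial_value show "AE \<omega> in M. ennreal (norm (x (real j * h) \<omega> - X j \<omega>) powr p) = 0"
            by eventually_elim (simp add: True)
        qed
        then show ?thesis by simp
      next
        case False
        show ?thesis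
        proof (rule nn_integral_powr_le_of_approx)
          fix \<epsilon> :: real assume \<epsilon>: "\<epsilon> > 0"
          have "real j * h > 0" using False h by simp
          from chain_converges[OF this \<epsilon>] have "\<forall>\<^sub>F m in sequentially. \<forall>Y. chain 0 (real j * h / real (j * m)) Y \<longrightarrow> (\<forall>\<omega>\<in>space M. Y 0 \<omega> = x0) \<longrightarrow>
             prob {\<omega> \<in> space M. norm (x (real j * h) \<omega> - Y (j * m) \<omega>) > \<epsilon>} \<le> \<epsilon>"
            by (rule eventually_compose_filterlim) (use False in \<open>intro mult_nat_left_at_top; simp\<close>)
          then have "\<forall>\<^sub>F m in sequentially. (\<forall>Y. chain 0 (real j * h / real (j * m)) Y \<longrightarrow> (\<forall>\<omega>\<in>space M. Y 0 \<omega> = x0) \<longrightarrow>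
             prob {\<omega> \<in> space M. norm (x (real j * h) \<omega> - Y (j * m) \<omega>) > \<epsilon>} \<le> \<epsilon>) \<and> m > 0"
            using eventually_gt_at_top[of "0::nat"] by (rule eventually_conj)
          then obtain m where m': "(\<forall>Y. chain 0 (real j * h / real (j * m)) Y \<longrightarrow> (\<forall>\<omega>\<in>space M. Y 0 \<omega> = x0) \<longrightarrow>
             prob {\<omega> \<in> space M. norm (x (real j * h) \<omega> - Y (j * m) \<omega>) > \<epsilon>} \<le> \<epsilon>) \<and> m > 0"
            using eventually_happens'[OF sequentially_bot] by blast
          then have m: "m > 0" by simp
          define \<tau> where "\<tau> = h / real m"
          have \<tau>: "real j * h / real (j * m) = \<tau>" "h = real m * \<tau>" "0 < \<tau>" using False m h by (auto simp: \<tau>_def)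
          have st: "small \<tau>"
          proof (rule small_mono[OF sh \<tau>(3)])
            show "\<tau> \<le> h" using m \<tau>(3) unfolding \<tau>(2) by (simp add: mult_le_cancel_right1)
          qed
          obtain Y where Y: "chain 0 \<tau> Y" and Y0: "Y 0 = X 0" using chain_exists[OF st \<open>X 0 \<in> borel_measurable (F 0)\<close>] by blast
          show "\<exists>Y. Y \<in> borel_measurable M \<and> prob {\<omega> \<in> space M. norm (x (real j * h) \<omega> - Y \<omega>) > \<epsilon>} \<le> \<epsilon> \<and>
              (\<integral>\<^sup>+\<omega>. ennreal (norm (Y \<omega> - X j \<omega>) powr p) \<partial>M) \<le> ennreal (C * h powr s)"
          proof (intro exI[of _ "Y (j * m)"] conjI)
            show "Y (j * m) \<in> borel_measurable M" by (rule chain_measurable[OF Y st]) simp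
            show "prob {\<omega> \<in> space M. norm (x (real j * h) \<omega> - Y (j * m) \<omega>) > \<epsilon>} \<le> \<epsilon>"
              using m' Y Y0 X0 unfolding \<tau>(1) by auto
            show "(\<integral>\<^sup>+\<omega>. ennreal (norm (Y (j * m) \<omega> - X j \<omega>) powr p) \<partial>M) \<le> ennreal (C * h powr s)"
              using err[OF h m \<tau>(2), of X Y j] Xc Y Y0 X0 unfolding ps by auto
          qed
        qed (use p p0 C in auto)
      qed
      also have "\<dots> \<le> ennreal ((C + 1) * h powr (p / 2))"
        unfolding s_def by (intro ennreal_leI mult_right_mono) auto
      finally show "(\<integral>\<^sup>+ \<omega>. ennreal (norm (x (real j * h) \<omega> - X j \<omega>) powr p) \<partial>M) \<le> ennreal ((C + 1) * h powr (p / 2))" .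
    qed
  qed
qed

end
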